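(* In the geometric model, suppose that $\bar\alpha\bar\beta<1$. Then the shape function $g$ satisfies $$g(s,t)=\inf_{z\in(\bar\alpha,1/\bar\beta)}\left\{s\,\mathrm E\left[\frac{a/z}{1-a/z}\right]+t\,\mathrm E\left[\frac{bz}{1-bz}\right]\right\}\quad\text{for all } s,t>0.$$
   Context: Let $\mathbb N=\{1,2,\dots\}$ and $\mathbb Z_+=\{0,1,2,\dots\}$. Geometric model: Let $\mathbf a=(a_n)_{n\in\mathbb N}$ and $\mathbf b=(b_n)_{n\in\mathbb N}$ be stationary random sequences with terms in $(0,1)$, with joint distribution $\mu$. Let $\tau_k$ denote the shift $(c_n)_{n\in\mathbb N}\mapsto(c_{n+k})_{n\in\mathbb N}$. It is assumed that $\mu$ is totally ergodic: for each $k,l\in\mathbb N$ separately, $\mu$ is (stationary and) ergodic under $\tau_k\times\tau_l$, which acts by $(\mathbf a,\mathbf b)\mapsto(\tau_k\mathbf a,\tau_l\mathbf b)$. Given $(\mathbf a,\mathbf b)$, the weights $\{W(i,j):i,j\in\mathbb N\}$ are independent $\mathbb Z_+$-valued random variables under the conditional law $\mathbf P_{\mathbf a,\mathbf b}$ with $\mathbf P_{\mathbf a,\mathbf b}(W(i,j)\ge k)=a_i^kb_j^k$ for $k\in\mathbb Z_+$. Let $\mathbb P(\cdot)=\int\mathbf P_{\mathbf a,\mathbf b}(\cdot)\,\mu(d\mathbf a,d\mathbf b)$ be the unconditional law of the weights. Last-passage times: $G(m,n)=\max_\pi\sum_{(i,j)\in\pi}W(i,j)$, the maximum being over all directed paths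 $\pi$ from $(1,1)$ to $(m,n)$ in $\mathbb Z^2$ (finite sequences of sites with steps in $\{(1,0),(0,1)\}$). Shape function: $g:(0,\infty)^2\to[0,\infty]$ is the deterministic function such that, $\mathbb P$-a.s., $\lim_{n\to\infty}n^{-1}G(\lfloor ns\rfloor,\lfloor nt\rfloor)=g(s,t)$ for all $s,t>0$ (such a function exists). Notation: $\alpha$ and $\beta$ are the distributions of $a=a_1$ and $b=b_1$; $\bar\alpha$ and $\bar\beta$ are the right endpoints of their supports (the essential suprema of $a_1$ and $b_1$); $\mathrm E$ is expectation under $\mu$. *)

theory Defs
  imports "HOL-Probability.Probability"
begin

section \<open>Parameter sequences and total ergodicity\<close>

text \<open>Sequences \<open>(c\<^sub>n)\<close> with \<open>n \<ge> 1\<close> and terms in the open unit interval. They are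
  extensional functions on \<open>{1..}\<close>, hence the restriction in the shift.\<close>

definition param_space :: "(nat \<Rightarrow> real) measure" where
  "param_space = (\<Pi>\<^sub>M n\<in>{1..}. restrict_space borel {0<..<1})"

definition shift :: "nat \<Rightarrow> (nat \<Rightarrow> real) \<Rightarrow> nat \<Rightarrow> real" where
  "shift k c = (\<lambda>n\<in>{1..}. c (n + k))"

definition ergodic :: "'a measure \<Rightarrow> ('a \<Rightarrow> 'a) \<Rightarrow> bool" where
  "ergodic M T \<longleftrightarrow> prob_space M \<and> T \<in> M \<rightarrow>\<^sub>M M \<and> distr M M T = M \<and>
     (\<forall>A\<in>sets M. T -` A \<inter> space M = A \<longrightarrow> measure M A = 0 \<or> measure M A = 1)"

definition totally_ergodic :: "((nat \<Rightarrow> real) \<times> (nat \<Rightarrow> real)) measure \<Rightarrow> bool" where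
  "totally_ergodic \<mu> \<longleftrightarrow> sets \<mu> = sets (param_space \<Otimes>\<^sub>M param_space) \<and>
     (\<forall>k\<ge>1. \<forall>l\<ge>1. ergodic \<mu> (map_prod (shift k) (shift l)))"

section \<open>The weights\<close>

text \<open>The library's \<open>geometric_pmf p\<close> is the number of failures before the first success,
  where \<open>p\<close> is the success probability.\<close>

lemma geometric_pmf_tail:
  fixes x :: real
  assumes "0 \<le> x" "x < 1"
  shows "measure (geometric_pmf (1 - x)) {k..} = x ^ k"
proof -
  have "measure (geometric_pmf (1 - x)) {..<k} = (\<Sum>i<k. x ^ i * (1 - x))"
    using assms by (subst measure_measure_pmf_finite) auto
  also have "\<dots> = 1 - x ^ k"
    by (induction k) (simp_all add: algebra_simps)
  finally have "measure (geometric_pmf (1 - x)) {..<k} = 1 - x ^ k" .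
  moreover have "measure (geometric_pmf (1 - x)) (UNIV - {..<k}) =
      1 - measure (geometric_pmf (1 - x)) {..<k}"
    using measure_pmf.prob_compl[of "{..<k}" "geometric_pmf (1 - x)"] by simp
  moreover have "UNIV - {..<k} = {k..}"
    by auto
  ultimately show ?thesis
    by simp
qed

abbreviation sites :: "(nat \<times> nat) set" where
  "sites \<equiv> {1..} \<times> {1..}"

definition weight_space :: "(nat \<times> nat \<Rightarrow> nat) measure" where
  "weight_space = (\<Pi>\<^sub>M p\<in>sites. count_space UNIV)"

definition quenched_law ::
  "(nat \<Rightarrow> real) \<times> (nat \<Rightarrow> real) \<Rightarrow> (nat \<times> nat \<Rightarrow> nat) measure" where
  "quenched_law = (\<lambda>(a, b). \<Pi>\<^sub>M (i, j)\<in>sites. measure_pmf (geometric_pmf (1 - a i * b j)))"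

definition annealed_law ::
  "((nat \<Rightarrow> real) \<times> (nat \<Rightarrow> real)) measure \<Rightarrow> (nat \<times> nat \<Rightarrow> nat) measure" where
  "annealed_law \<mu> = \<mu> \<bind> quenched_law"

text \<open>The monadic bind is a genuine mixture only if the kernel is measurable.\<close>

lemma space_param_space: "space param_space = (\<Pi>\<^sub>E n\<in>{1..}. {0<..<1})"
  by (simp add: param_space_def space_PiM space_restrict_space)

lemma measurable_param_component:
  assumes "n \<ge> 1"
  shows "(\<lambda>c. c n) \<in> borel_measurable param_space"
proof -
  have "(\<lambda>c. c n) \<in> param_space \<rightarrow>\<^sub>M restrict_space borel {0<..<1::real}"
    unfolding param_space_def using assms by (intro measurable_component_singleton) auto
  then show ?thesis
    by (rule measurable_restrict_space2_iff[THEN iffD1, THEN conjunct1])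
qed

lemma quenched_law_measurable:
  "quenched_law \<in> param_space \<Otimes>\<^sub>M param_space \<rightarrow>\<^sub>M subprob_algebra weight_space"
proof -
  define N where "N = (\<lambda>\<omega> :: (nat \<Rightarrow> real) \<times> (nat \<Rightarrow> real). \<lambda>p :: nat \<times> nat.
    measure_pmf (geometric_pmf (1 - fst \<omega> (fst p) * snd \<omega> (snd p))))"
  have q: "quenched_law \<omega> = PiM sites (N \<omega>)" for \<omega>
    by (simp add: quenched_law_def N_def case_prod_beta')
  interpret P: product_prob_space "N \<omega>" sites for \<omega>
    by (rule product_prob_spaceI) (simp add: N_def measure_pmf.prob_space_axioms)
  have sets_q: "sets (quenched_law \<omega>) = sets weight_space" for \<omega>
    unfolding q weight_space_def by (intro sets_PiM_cong) (auto simp: N_def)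
  have prob_q: "prob_space (quenched_law \<omega>)" for \<omega>
    unfolding q by (rule P.prob_space_axioms)
  let ?M = "param_space \<Otimes>\<^sub>M param_space"
  let ?C = "\<lambda>_ :: nat \<times> nat. count_space (UNIV :: nat set)"
  show ?thesis
  proof (rule measurable_subprob_algebra_generated)
    show "sets weight_space =
        sigma_sets (\<Pi>\<^sub>E p\<in>sites. space (?C p)) (prod_algebra sites ?C)"
      unfolding weight_space_def by (rule sets_PiM)
    show "Int_stable (prod_algebra sites ?C)"
      by (rule Int_stable_prod_algebra)
    show "prod_algebra sites ?C \<subseteq> Pow (\<Pi>\<^sub>E p\<in>sites. space (?C p))"
      by (rule prod_algebra_sets_into_space)
    show "subprob_space (quenched_law \<omega>)" for \<omega>
      using prob_q by (rule prob_space_imp_subprob_space)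
    show "sets (quenched_law \<omega>) = sets weight_space" for \<omega>
      by (rule sets_q)
  next
    fix A assume "A \<in> prod_algebra sites ?C"
    then obtain J E where A: "A = prod_emb sites ?C J (PiE J E)" "finite J" "J \<subseteq> sites"
      by (rule prod_algebraE)
    have emb: "A = prod_emb sites (N \<omega>) J (PiE J E)" for \<omega>
      unfolding A by (simp add: prod_emb_def N_def)
    have eq: "emeasure (quenched_law \<omega>) A = (\<Prod>p\<in>J. emeasure (N \<omega> p) (E p))" for \<omega>
      unfolding q emb[of \<omega>] using A by (intro P.emeasure_PiM_emb) (auto simp: N_def)
    have "(\<lambda>\<omega>. emeasure (N \<omega> p) (E p)) \<in> borel_measurable ?M" if "p \<in> J" for p
    proof -
      have "p \<in> sites"
        using A that by blast
      then obtain i j where p: "p = (i, j)" "i \<ge> 1" "j \<ge> 1"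
        by (cases p) auto
      have [measurable]: "(\<lambda>c. c i) \<in> borel_measurable param_space"
          "(\<lambda>c. c j) \<in> borel_measurable param_space"
        using p by (auto intro: measurable_param_component)
      have *: "emeasure (N \<omega> p) (E p) =
          (\<Sum>n. ennreal ((fst \<omega> i * snd \<omega> j) ^ n * (1 - fst \<omega> i * snd \<omega> j)) * indicator (E p) n)"
        if "\<omega> \<in> space ?M" for \<omega>
      proof -
        have "0 < fst \<omega> i" "fst \<omega> i < 1" "0 < snd \<omega> j" "snd \<omega> j < 1"
          using that p by (auto simp: space_pair_measure space_param_space PiE_iff)
        then have "0 < fst \<omega> i * snd \<omega> j" "fst \<omega> i * snd \<omega> j < 1"
          using mult_strict_mono[of "fst \<omega> i" 1 "snd \<omega> j" 1] by auto
        then show ?thesis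
          unfolding N_def p
          by (subst nn_integral_indicator[symmetric])
             (simp_all add: nn_integral_measure_pmf nn_integral_count_space_nat)
      qed
      show ?thesis
        by (subst measurable_cong[OF *]) measurable
    qed
    then show "(\<lambda>\<omega>. emeasure (quenched_law \<omega>) A) \<in> borel_measurable ?M"
      unfolding eq by (intro borel_measurable_prod_ennreal) auto
  next
    have "emeasure (quenched_law \<omega>) (\<Pi>\<^sub>E p\<in>sites. space (?C p)) = 1" for \<omega>
      using prob_space.emeasure_space_1[OF prob_q[of \<omega>]]
      by (simp add: q space_PiM N_def)
    then show "(\<lambda>\<omega>. emeasure (quenched_law \<omega>) (\<Pi>\<^sub>E p\<in>sites. space (?C p))) \<in> borel_measurable ?M"
      by simp
  qed
qed

section \<open>Last-passage times and the shape function\<close>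

definition directed_path :: "nat \<times> nat \<Rightarrow> nat \<times> nat \<Rightarrow> (nat \<times> nat) list \<Rightarrow> bool" where
  "directed_path p q \<pi> \<longleftrightarrow> \<pi> \<noteq> [] \<and> hd \<pi> = p \<and> last \<pi> = q \<and>
     successively (\<lambda>(i, j) r. r = (i + 1, j) \<or> r = (i, j + 1)) \<pi>"

text \<open>The value is meaningful for \<open>m, n \<ge> 1\<close> only; other arguments have no paths.\<close>

definition last_passage :: "(nat \<times> nat \<Rightarrow> nat) \<Rightarrow> nat \<Rightarrow> nat \<Rightarrow> nat" where
  "last_passage W m n = Max {(\<Sum>p\<leftarrow>\<pi>. W p) | \<pi>. directed_path (1, 1) (m, n) \<pi>}"

text \<open>Only the values of \<open>g\<close> on the open quadrant are constrained. They may be infinite.\<close>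

definition is_shape_function ::
  "((nat \<Rightarrow> real) \<times> (nat \<Rightarrow> real)) measure \<Rightarrow> (real \<Rightarrow> real \<Rightarrow> ennreal) \<Rightarrow> bool" where
  "is_shape_function \<mu> g \<longleftrightarrow>
     (AE W in annealed_law \<mu>. \<forall>s>0. \<forall>t>0.
        (\<lambda>n. ennreal (real (last_passage W (nat \<lfloor>real n * s\<rfloor>) (nat \<lfloor>real n * t\<rfloor>)) / real n))
          \<longlonglongrightarrow> g s t)"

section \<open>Right endpoints of the marginal distributions\<close>

definition alpha_bar :: "((nat \<Rightarrow> real) \<times> (nat \<Rightarrow> real)) measure \<Rightarrow> real" where
  "alpha_bar \<mu> = real_of_ereal (esssup \<mu> (\<lambda>(a, b). ereal (a 1)))"

definition beta_bar :: "((nat \<Rightarrow> real) \<times> (nat \<Rightarrow> real)) measure \<Rightarrow> real" where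
  "beta_bar \<mu> = real_of_ereal (esssup \<mu> (\<lambda>(a, b). ereal (b 1)))"

text \<open>Both essential suprema are finite, so the conversion to reals loses nothing.\<close>

lemma ereal_endpoints:
  assumes "totally_ergodic \<mu>"
  shows "ereal (alpha_bar \<mu>) = esssup \<mu> (\<lambda>(a, b). ereal (a 1))"
    and "ereal (beta_bar \<mu>) = esssup \<mu> (\<lambda>(a, b). ereal (b 1))"
proof -
  from assms have sets_mu [measurable_cong]: "sets \<mu> = sets (param_space \<Otimes>\<^sub>M param_space)"
    and "prob_space \<mu>"
    by (auto simp: totally_ergodic_def ergodic_def)
  then interpret prob_space \<mu> by simp
  have finite_esssup: "ereal (real_of_ereal (esssup \<mu> f)) = esssup \<mu> f"
    if f: "f \<in> borel_measurable \<mu>" "\<And>\<omega>. \<omega> \<in> space \<mu> \<Longrightarrow> 0 \<le> f \<omega> \<and> f \<omega> \<le> 1" for f :: "_ \<Rightarrow> ereal"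
  proof -
    have "esssup \<mu> f \<le> 1"
      using f by (intro esssup_I) auto
    moreover have "esssup \<mu> (\<lambda>_. 0 :: ereal) \<le> esssup \<mu> f"
      using f by (intro esssup_AE_mono) auto
    then have "0 \<le> esssup \<mu> f"
      using esssup_const[of \<mu> "0 :: ereal"] emeasure_space_1 by simp
    ultimately show ?thesis
      by (cases "esssup \<mu> f") auto
  qed
  have [measurable]: "(\<lambda>c. c 1) \<in> borel_measurable param_space"
    by (rule measurable_param_component) simp
  have "space \<mu> = space param_space \<times> space param_space"
    using sets_eq_imp_space_eq[OF sets_mu] by (simp add: space_pair_measure)
  then have bounds: "0 < fst \<omega> 1 \<and> fst \<omega> 1 < 1 \<and> 0 < snd \<omega> 1 \<and> snd \<omega> 1 < 1" if "\<omega> \<in> space \<mu>" for \<omega>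
    using that by (auto simp: space_param_space PiE_iff)
  show "ereal (alpha_bar \<mu>) = esssup \<mu> (\<lambda>(a, b). ereal (a 1))"
    unfolding alpha_bar_def case_prod_beta'
    by (rule finite_esssup) (measurable, use bounds in \<open>auto simp: less_imp_le\<close>)
  show "ereal (beta_bar \<mu>) = esssup \<mu> (\<lambda>(a, b). ereal (b 1))"
    unfolding beta_bar_def case_prod_beta'
    by (rule finite_esssup) (measurable, use bounds in \<open>auto simp: less_imp_le\<close>)
qed

end

theory Submission
  imports Defs
begin

text \<open>
  Write \<open>A(z) = E[(a/z)/(1 - a/z)]\<close>, \<open>B(z) = E[bz/(1 - bz)]\<close> and \<open>h(z) = s A(z) + t B(z)\<close>. For \<open>z\<close> in
  the interval of the infimum, surround the quadrant by independent geometric boundary weights with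
  parameters \<open>a\<^sub>i/z\<close> on the bottom axis and \<open>b\<^sub>j z\<close> on the left axis, as if there were an extra column
  of parameter \<open>z\<close> and an extra row of parameter \<open>1/z\<close>. The increments of this enlarged last-passage
  time \<open>H\<close> obey a Burke property (\<open>burke_sweep_preserves_law\<close>): along the top edge of a rectangle they
  are again independent, with the laws of the bottom weights. So \<open>H\<close> is a sum of two sums of
  independent variables, and the ergodic theorem for the parameters gives
  \<open>H(\<lfloor>Ns\<rfloor>, \<lfloor>Nt\<rfloor>)/N \<rightarrow> h(z)\<close>.

  Upper bound: \<open>H\<close> dominates the last-passage time without boundary, hence \<open>g(s, t) \<le> h(z)\<close> for
  every \<open>z\<close> (\<open>shape_le_stationary_mean\<close>).

  Lower bound: a maximal path for \<open>H\<close> leaves the axes at some point, and from there on it sees the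
  model without boundary on a smaller rectangle. In the limit, \<open>h(z)\<close> is at most \<open>s x A(z) + g(s (1 - x), t)\<close> or
  \<open>t x B(z) + g(s, t (1 - x))\<close> for some \<open>x\<close> (\<open>exit_point_alternative\<close>). The upper bound at another
  parameter \<open>w\<close> gives \<open>g(s (1 - x), t) \<le> h(w) - s x A(w)\<close>. If \<open>h'(z) = 0\<close>, a small move of \<open>w\<close> in the
  direction in which \<open>A\<close> grows changes \<open>h\<close> to second order but \<open>s x A\<close> to first order, which is
  incompatible with \<open>x\<close> bounded away from zero. The path therefore leaves the axes near the corner,
  and \<open>g(s, t) \<ge> h(z)\<close> (\<open>shape_at_stationary_point\<close>).

  If \<open>h\<close> has no stationary point, its derivative has a constant sign. When \<open>h\<close> increases, the infimum
  is the limit at the left endpoint \<open>\<alpha>\<close>. A parameter \<open>z\<close> close to \<open>\<alpha>\<close> is stationary for a flatter direction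
  \<open>(s, t')\<close>; a path can follow that direction and then climb the remaining height \<open>t - t'\<close> in the last
  column. With positive probability the parameter of that column exceeds a given \<open>\<theta> < \<alpha>\<close>, and then the
  climb collects about \<open>(t - t') B(\<theta>)\<close>; as \<open>g\<close> is deterministic, positive probability is enough
  (\<open>shape_add_column\<close>, \<open>shape_when_increasing\<close>). A decreasing \<open>h\<close> is the same situation after
  exchanging rows and columns.

  The weights are handled for fixed parameters, on finite boxes. What remains random are the quenched
  probabilities that a last-passage time is large: their integrals converge to 0 or 1 on the two sides
  of \<open>g\<close> (\<open>annealed_tail_limits\<close>) and are invariant under shifts of the parameters. The locale
  \<open>corner\<close> collects these facts in a form that is symmetric under transposition.
\<close>

section \<open>Directed paths\<close>

lemma directed_path_single [simp]: "directed_path p p [p]"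
  by (simp add: directed_path_def)

lemma directed_path_snoc_iff:
  "directed_path p q (\<pi> @ [r]) \<longleftrightarrow> q = r \<and>
     (\<pi> = [] \<and> p = r \<or>
      (\<exists>q'. directed_path p q' \<pi> \<and>
         (r = (fst q' + 1, snd q') \<or> r = (fst q', snd q' + 1))))"
  by (cases "\<pi> = []")
     (auto simp: directed_path_def successively_append_iff case_prod_beta')

lemma directed_path_snoc:
  assumes "directed_path p q \<pi>" "r = (fst q + 1, snd q) \<or> r = (fst q, snd q + 1)"
  shows "directed_path p r (\<pi> @ [r])"
  using assms by (auto simp: directed_path_def successively_append_iff case_prod_beta')

lemma directed_path_induct [consumes 1, case_names single snoc]:
  assumes "directed_path p q \<pi>"
    and "P p [p]"
    and "\<And>q r \<pi>. directed_path p q \<pi> \<Longrightarrow> P q \<pi> \<Longrightarrow>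
           r = (fst q + 1, snd q) \<or> r = (fst q, snd q + 1) \<Longrightarrow> P r (\<pi> @ [r])"
  shows "P q \<pi>"
  using assms(1)
proof (induction \<pi> arbitrary: q rule: rev_induct)
  case Nil
  then show ?case by (simp add: directed_path_def)
next
  case (snoc r \<pi>)
  then show ?case
    unfolding directed_path_snoc_iff using assms(2,3) by auto
qed

lemma directed_path_in_box:
  assumes "directed_path p q \<pi>"
  shows "set \<pi> \<subseteq> {fst p..fst q} \<times> {snd p..snd q} \<and> fst p \<le> fst q \<and> snd p \<le> snd q
    \<and> length \<pi> + fst p + snd p = fst q + snd q + 1"
  using assms by (induction rule: directed_path_induct) (auto simp: mem_Times_iff)

lemma directed_path_append:
  assumes "directed_path p q \<pi>" "directed_path q r (q # \<rho>)"
  shows "directed_path p r (\<pi> @ \<rho>)"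
  using assms
  by (cases \<rho>) (auto simp: directed_path_def successively_append_iff successively_Cons)

lemma directed_path_column: "directed_path (i, j) (i, j + k) (map (\<lambda>l. (i, l)) [j..<Suc (j + k)])"
proof (induction k)
  case (Suc k)
  from directed_path_snoc[OF this, of "(i, j + Suc k)"] show ?case by simp
qed simp

lemma directed_path_row: "directed_path (i, j) (i + k, j) (map (\<lambda>l. (l, j)) [i..<Suc (i + k)])"
proof (induction k)
  case (Suc k)
  from directed_path_snoc[OF this, of "(i + Suc k, j)"] show ?case by simp
qed simp

lemma directed_path_exists:
  assumes "i \<le> i'" "j \<le> j'"
  shows "\<exists>\<pi>. directed_path (i, j) (i', j') \<pi>"
proof -
  obtain k l where kl: "i' = i + k" "j' = j + l"
    using assms by (auto simp: le_iff_add)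
  define q where "q = (i + k, j)"
  have q: "directed_path q (i', j') (map (Pair (i + k)) [j..<Suc (j + l)])"
    using directed_path_column[of "i + k" j l] by (simp add: kl q_def)
  moreover have "map (Pair (i + k)) [j..<Suc (j + l)] = q # map (Pair (i + k)) [Suc j..<Suc (j + l)]"
    by (subst upt_conv_Cons) (auto simp: q_def)
  ultimately show ?thesis
    using directed_path_append[OF directed_path_row[of i j k, folded q_def]] by metis
qed

lemma finite_directed_paths: "finite {\<pi>. directed_path p q \<pi>}"
proof (rule finite_subset)
  show "{\<pi>. directed_path p q \<pi>} \<subseteq>
      {\<pi>. set \<pi> \<subseteq> {fst p..fst q} \<times> {snd p..snd q} \<and> length \<pi> \<le> fst q + snd q + 1}"
    using directed_path_in_box by fastforce
  show "finite {\<pi>. set \<pi> \<subseteq> {fst p..fst q} \<times> {snd p..snd q} \<and> length \<pi> \<le> fst q + snd q + 1}"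
    by (rule finite_lists_length_le) auto
qed

lemma last_passage_ge:
  assumes "directed_path (1, 1) (m, n) \<pi>"
  shows "(\<Sum>p\<leftarrow>\<pi>. W p) \<le> last_passage W m n"
proof -
  have "{(\<Sum>p\<leftarrow>\<pi>. W p) |\<pi>. directed_path (1, 1) (m, n) \<pi>} =
      (\<lambda>\<pi>. \<Sum>p\<leftarrow>\<pi>. W p) ` {\<pi>. directed_path (1, 1) (m, n) \<pi>}"
    by auto
  then show ?thesis
    unfolding last_passage_def using assms finite_directed_paths
    by (intro Max_ge) auto
qed

lemma last_passage_attained:
  assumes "1 \<le> m" "1 \<le> n"
  obtains \<pi> where "directed_path (1, 1) (m, n) \<pi>" "last_passage W m n = (\<Sum>p\<leftarrow>\<pi>. W p)"
proof -
  have "{(\<Sum>p\<leftarrow>\<pi>. W p) |\<pi>. directed_path (1, 1) (m, n) \<pi>} =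
      (\<lambda>\<pi>. \<Sum>p\<leftarrow>\<pi>. W p) ` {\<pi>. directed_path (1, 1) (m, n) \<pi>}"
    by auto
  moreover have "{\<pi>. directed_path (1, 1) (m, n) \<pi>} \<noteq> {}"
    using directed_path_exists assms by auto
  ultimately have "last_passage W m n \<in>
      (\<lambda>\<pi>. \<Sum>p\<leftarrow>\<pi>. W p) ` {\<pi>. directed_path (1, 1) (m, n) \<pi>}"
    unfolding last_passage_def using finite_directed_paths
    by (metis (no_types, lifting) Max_in finite_imageI image_is_empty)
  then show ?thesis
    using that by auto
qed

lemma last_passage_cong:
  assumes "\<And>i j. 1 \<le> i \<Longrightarrow> i \<le> m \<Longrightarrow> 1 \<le> j \<Longrightarrow> j \<le> n \<Longrightarrow> W (i, j) = W' (i, j)"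
  shows "last_passage W m n = last_passage W' m n"
proof -
  have *: "(\<Sum>p\<leftarrow>\<pi>. W p) = (\<Sum>p\<leftarrow>\<pi>. W' p)" if "directed_path (1, 1) (m, n) \<pi>" for \<pi>
  proof -
    have "map W \<pi> = map W' \<pi>"
      using directed_path_in_box[OF that] assms by (intro map_cong) auto
    then show ?thesis by (rule arg_cong)
  qed
  show ?thesis
    unfolding last_passage_def setcompr_eq_image
    by (intro arg_cong[of _ _ Max] image_cong refl) (simp only: mem_Collect_eq *)
qed

lemma last_passage_mono:
  assumes "1 \<le> m" "1 \<le> n" "m \<le> m'" "n \<le> n'"
  shows "last_passage W m n \<le> last_passage W m' n'"
proof -
  obtain \<pi> where \<pi>: "directed_path (1, 1) (m, n) \<pi>" "last_passage W m n = (\<Sum>p\<leftarrow>\<pi>. W p)"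
    using last_passage_attained assms by metis
  obtain \<rho>' where \<rho>': "directed_path (m, n) (m', n') \<rho>'"
    using directed_path_exists assms by metis
  then obtain \<rho> where \<rho>: "\<rho>' = (m, n) # \<rho>"
    by (cases \<rho>') (auto simp: directed_path_def)
  have "directed_path (1, 1) (m', n') (\<pi> @ \<rho>)"
    using directed_path_append \<pi> \<rho>' \<rho> by metis
  from last_passage_ge[OF this, of W] show ?thesis
    using \<pi> by simp
qed

lemma last_passage_swap:
  "last_passage (\<lambda>p. W (prod.swap p)) m n = last_passage W n m"
proof -
  have swap: "directed_path (prod.swap p) (prod.swap q) (map prod.swap \<pi>)"
    if "directed_path p q \<pi>" for p q \<pi>
    using that
  proof (induction rule: directed_path_induct)
    case (snoc q r \<pi>)
    have "directed_path (prod.swap p) (prod.swap r) (map prod.swap \<pi> @ [prod.swap r])"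
      using snoc by (intro directed_path_snoc[of _ "prod.swap q"]) auto
    then show ?case by simp
  qed simp
  have "{(\<Sum>p\<leftarrow>\<pi>. W (prod.swap p)) |\<pi>. directed_path (1, 1) (m, n) \<pi>} =
      {(\<Sum>p\<leftarrow>\<pi>. W p) |\<pi>. directed_path (1, 1) (n, m) \<pi>}" (is "?A = ?B")
  proof (intro equalityI subsetI)
    fix x assume "x \<in> ?A"
    then obtain \<pi> where "directed_path (1, 1) (m, n) \<pi>" "x = (\<Sum>p\<leftarrow>\<pi>. W (prod.swap p))" by auto
    then show "x \<in> ?B"
      using swap[of "(1,1)" "(m,n)" \<pi>]
      by (auto simp: comp_def intro!: exI[of _ "map prod.swap \<pi>"])
  next
    fix x assume "x \<in> ?B"
    then obtain \<pi> where "directed_path (1, 1) (n, m) \<pi>" "x = (\<Sum>p\<leftarrow>\<pi>. W p)" by auto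
    then show "x \<in> ?A"
      using swap[of "(1,1)" "(n,m)" \<pi>]
      by (auto simp: comp_def intro!: exI[of _ "map prod.swap \<pi>"])
  qed
  then show ?thesis
    by (simp add: last_passage_def)
qed

text \<open>Moving the starting point of a path back only adds weights, and translating the path to
  start at \<open>(1, 1)\<close> turns it into a path for the shifted weights.\<close>

lemma path_sum_le_shifted_last_passage:
  assumes "directed_path (i, j) (k + m, l + n) \<pi>" "k < i" "l < j"
  shows "(\<Sum>p\<leftarrow>\<pi>. W p) \<le> last_passage (\<lambda>(i, j). W (i + k, j + l)) m n"
proof -
  obtain \<rho> where \<rho>: "directed_path (k + 1, l + 1) (i, j) \<rho>"
    using directed_path_exists assms by (metis Suc_eq_plus1 Suc_leI)
  obtain \<pi>' where \<pi>': "\<pi> = (i, j) # \<pi>'"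
    using assms(1) by (cases \<pi>) (auto simp: directed_path_def)
  have path: "directed_path (k + 1, l + 1) (k + m, l + n) (\<rho> @ \<pi>')"
    using directed_path_append \<rho> assms(1) \<pi>' by metis
  have *: "directed_path (fst p - k, snd p - l) (fst q - k, snd q - l) (map (\<lambda>(i, j). (i - k, j - l)) \<pi>)
      \<and> (\<Sum>p\<leftarrow>\<pi>. W p) = (\<Sum>p\<leftarrow>map (\<lambda>(i, j). (i - k, j - l)) \<pi>. (\<lambda>(i, j). W (i + k, j + l)) p)
      \<and> k \<le> fst q \<and> l \<le> snd q"
    if "directed_path p q \<pi>" "k \<le> fst p" "l \<le> snd p" for p q \<pi>
    using that(1)
  proof (induction rule: directed_path_induct)
    case single
    then show ?case using that(2,3) by (auto simp: case_prod_beta')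
  next
    case (snoc q r \<pi>)
    let ?\<theta> = "\<lambda>(i, j). (i - k, j - l)"
    have "directed_path (fst p - k, snd p - l) (?\<theta> r) (map ?\<theta> \<pi> @ [?\<theta> r])"
      using snoc(2,3) by (intro directed_path_snoc) (auto simp: Suc_diff_le)
    then show ?case
      using snoc(2,3) by (auto simp: case_prod_beta')
  qed
  obtain \<rho>' where \<rho>': "\<rho> = \<rho>' @ [(i, j)]"
    using \<rho> by (cases \<rho> rule: rev_cases) (auto simp: directed_path_def)
  have "(\<Sum>p\<leftarrow>\<pi>. W p) \<le> (\<Sum>p\<leftarrow>\<rho> @ \<pi>'. W p)"
    by (simp add: \<pi>' \<rho>')
  also have "\<dots> \<le> last_passage (\<lambda>(i, j). W (i + k, j + l)) m n"
    using *[OF path] last_passage_ge by fastforce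
  finally show ?thesis .
qed

text \<open>The path goes up the last column after its optimal part. This is how the lower bound
  uses an exceptionally favourable column.\<close>

lemma last_passage_add_column:
  assumes "1 \<le> m'" "m' \<le> m" "1 \<le> n'" "n' \<le> n"
  shows "last_passage W m' n' + (\<Sum>j\<in>{n'<..n}. W (m, j)) \<le> last_passage W m n"
proof -
  obtain \<pi> where \<pi>: "directed_path (1, 1) (m, n') \<pi>" "last_passage W m n' = (\<Sum>p\<leftarrow>\<pi>. W p)"
    using last_passage_attained assms by (metis le_trans)
  obtain k where k: "n = n' + k"
    using assms by (auto simp: le_iff_add)
  have "map (Pair m) [n'..<Suc n] = (m, n') # map (Pair m) [Suc n'..<Suc n]"
    using assms by (subst upt_conv_Cons) auto
  then have "directed_path (1, 1) (m, n) (\<pi> @ map (Pair m) [Suc n'..<Suc n])"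
    using directed_path_append[OF \<pi>(1)] directed_path_column[of m n' k] k by metis
  from last_passage_ge[OF this, of W]
  have "last_passage W m n' + (\<Sum>j\<leftarrow>[Suc n'..<Suc n]. W (m, j)) \<le> last_passage W m n"
    by (simp add: \<pi> comp_def)
  also have "(\<Sum>j\<leftarrow>[Suc n'..<Suc n]. W (m, j)) = (\<Sum>j\<in>{n'<..n}. W (m, j))"
    by (subst sum_set_upt_conv_sum_list_nat [symmetric])
       (auto intro!: sum.cong)
  finally show ?thesis
    using last_passage_mono[of m' n' m n' W] assms by linarith
qed

section \<open>Last passage with boundary weights\<close>

text \<open>The last-passage time when the axes carry weights too; the corner itself has none.\<close>

fun boundary_lpp :: "(nat \<times> nat \<Rightarrow> nat) \<Rightarrow> nat \<Rightarrow> nat \<Rightarrow> nat" where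
  "boundary_lpp \<omega> 0 0 = 0"
| "boundary_lpp \<omega> (Suc i) 0 = boundary_lpp \<omega> i 0 + \<omega> (Suc i, 0)"
| "boundary_lpp \<omega> 0 (Suc j) = boundary_lpp \<omega> 0 j + \<omega> (0, Suc j)"
| "boundary_lpp \<omega> (Suc i) (Suc j) =
     max (boundary_lpp \<omega> i (Suc j)) (boundary_lpp \<omega> (Suc i) j) + \<omega> (Suc i, Suc j)"

lemma boundary_lpp_bottom: "boundary_lpp \<omega> i 0 = (\<Sum>l\<in>{0<..i}. \<omega> (l, 0))"
  by (induction i) (auto simp flip: atLeastSucAtMost_greaterThanAtMost)

lemma boundary_lpp_left: "boundary_lpp \<omega> 0 j = (\<Sum>l\<in>{0<..j}. \<omega> (0, l))"
  by (induction j) (auto simp flip: atLeastSucAtMost_greaterThanAtMost)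

lemma path_sum_le_boundary_lpp:
  assumes "directed_path (1, 1) (m, n) \<pi>"
  shows "(\<Sum>p\<leftarrow>\<pi>. \<omega> p) \<le> boundary_lpp \<omega> m n"
proof -
  have "(\<Sum>p\<leftarrow>\<pi>. \<omega> p) \<le> boundary_lpp \<omega> (fst q) (snd q) \<and> 1 \<le> fst q \<and> 1 \<le> snd q"
    if "directed_path (1, 1) q \<pi>" for q
    using that
  proof (induction rule: directed_path_induct)
    case single
    then show ?case by simp
  next
    case (snoc q r \<pi>)
    then obtain i j where "q = (Suc i, Suc j)"
      by (metis One_nat_def Suc_le_D prod.collapse)
    with snoc show ?case by auto
  qed
  from this[OF assms] show ?thesis by simp
qed

lemma last_passage_le_boundary_lpp:
  assumes "1 \<le> m" "1 \<le> n"
  shows "last_passage \<omega> m n \<le> boundary_lpp \<omega> m n"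
proof -
  obtain \<pi> where "directed_path (1, 1) (m, n) \<pi>" "last_passage \<omega> m n = (\<Sum>p\<leftarrow>\<pi>. \<omega> p)"
    by (rule last_passage_attained[OF assms])
  with path_sum_le_boundary_lpp[of m n \<pi> \<omega>] show ?thesis
    by presburger
qed

text \<open>A maximal path first follows one of the axes and then continues inside the quadrant, so
  the maximum decomposes at the exit point.\<close>

lemma boundary_lpp_exit_path:
  assumes "1 \<le> i" "1 \<le> j"
  shows "(\<exists>k\<in>{1..i}. \<exists>\<pi>. directed_path (k, 1) (i, j) \<pi> \<and>
            boundary_lpp \<omega> i j = (\<Sum>l\<in>{0<..k}. \<omega> (l, 0)) + (\<Sum>p\<leftarrow>\<pi>. \<omega> p)) \<or>
         (\<exists>k\<in>{1..j}. \<exists>\<pi>. directed_path (1, k) (i, j) \<pi> \<and>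
            boundary_lpp \<omega> i j = (\<Sum>l\<in>{0<..k}. \<omega> (0, l)) + (\<Sum>p\<leftarrow>\<pi>. \<omega> p))"
proof -
  have "(\<exists>k\<in>{1..Suc i}. \<exists>\<pi>. directed_path (k, 1) (Suc i, Suc j) \<pi> \<and>
            boundary_lpp \<omega> (Suc i) (Suc j) = boundary_lpp \<omega> k 0 + (\<Sum>p\<leftarrow>\<pi>. \<omega> p)) \<or>
         (\<exists>k\<in>{1..Suc j}. \<exists>\<pi>. directed_path (1, k) (Suc i, Suc j) \<pi> \<and>
            boundary_lpp \<omega> (Suc i) (Suc j) = boundary_lpp \<omega> 0 k + (\<Sum>p\<leftarrow>\<pi>. \<omega> p))"
    (is "?L i j \<or> ?R i j") for i j
  proof (induction "i + j" arbitrary: i j rule: less_induct)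
    case less
    have extend: "?L i j \<or> ?R i j"
      if IH: "?L i' j' \<or> ?R i' j'"
        and max: "boundary_lpp \<omega> (Suc i) (Suc j) =
            boundary_lpp \<omega> (Suc i') (Suc j') + \<omega> (Suc i, Suc j)"
        and step: "i = i' + 1 \<and> j = j' \<or> i = i' \<and> j = j' + 1" for i' j'
    proof -
      have path: "directed_path p (Suc i, Suc j) (\<pi> @ [(Suc i, Suc j)])"
        if "directed_path p (Suc i', Suc j') \<pi>" for p \<pi>
        using that step by (auto simp: directed_path_snoc_iff)
      from IH show ?thesis
      proof
        assume "?L i' j'"
        then obtain k \<pi> where k: "k \<in> {1..Suc i'}" "directed_path (k, 1) (Suc i', Suc j') \<pi>"
          "boundary_lpp \<omega> (Suc i') (Suc j') = boundary_lpp \<omega> k 0 + (\<Sum>p\<leftarrow>\<pi>. \<omega> p)" by blast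
        then have "?L i j"
          using path[OF k(2)] step max
          by (intro bexI[of _ k] exI[of _ "\<pi> @ [(Suc i, Suc j)]"]) auto
        then show ?thesis ..
      next
        assume "?R i' j'"
        then obtain k \<pi> where k: "k \<in> {1..Suc j'}" "directed_path (1, k) (Suc i', Suc j') \<pi>"
          "boundary_lpp \<omega> (Suc i') (Suc j') = boundary_lpp \<omega> 0 k + (\<Sum>p\<leftarrow>\<pi>. \<omega> p)" by blast
        then have "?R i j"
          using path[OF k(2)] step max
          by (intro bexI[of _ k] exI[of _ "\<pi> @ [(Suc i, Suc j)]"]) auto
        then show ?thesis ..
      qed
    qed
    consider "boundary_lpp \<omega> (Suc i) (Suc j) = boundary_lpp \<omega> i (Suc j) + \<omega> (Suc i, Suc j)"
      | "boundary_lpp \<omega> (Suc i) (Suc j) = boundary_lpp \<omega> (Suc i) j + \<omega> (Suc i, Suc j)"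
      by (metis boundary_lpp.simps(4) max_def)
    then show ?case
    proof cases
      case 1
      show ?thesis
      proof (cases i)
        case 0
        then have "?R i j"
          using 1 by (intro bexI[of _ "Suc j"] exI[of _ "[(Suc i, Suc j)]"]) auto
        then show ?thesis ..
      next
        case (Suc i')
        then show ?thesis
          using less[of i' j] 1 by (intro extend[of i' j]) auto
      qed
    next
      case 2
      show ?thesis
      proof (cases j)
        case 0
        then have "?L i j"
          using 2 by (intro bexI[of _ "Suc i"] exI[of _ "[(Suc i, Suc j)]"]) auto
        then show ?thesis ..
      next
        case (Suc j')
        then show ?thesis
          using less[of i j'] 2 by (intro extend[of i j']) auto
      qed
    qed
  qed
  from this[of "i - 1" "j - 1"] assms show ?thesis
    by (simp add: boundary_lpp_bottom boundary_lpp_left)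
qed

section \<open>The Burke property\<close>

definition geo :: "real \<Rightarrow> nat pmf" where
  "geo u = geometric_pmf (1 - u)"

lemma pmf_geo: "0 \<le> u \<Longrightarrow> u < 1 \<Longrightarrow> pmf (geo u) k = u ^ k * (1 - u)"
  by (simp add: geo_def)

text \<open>Cell \<open>(i, 0)\<close> holds the current horizontal increment \<open>I\<close> in column \<open>i\<close>, cell \<open>(0, j)\<close> the current
  vertical increment \<open>J\<close> in row \<open>j\<close>, and \<open>(i, j)\<close> the weight \<open>W\<close>. The recursion for the last-passage time
  turns the increments below and to the left of a site into \<open>(I - J)\<^sup>+ + W\<close> and \<open>(J - I)\<^sup>+ + W\<close> above and
  to the right of it. Storing \<open>min I J\<close> in the vacated cell makes the step invertible.\<close>

definition burke_step :: "nat \<times> nat \<Rightarrow> (nat \<times> nat \<Rightarrow> nat) \<Rightarrow> nat \<times> nat \<Rightarrow> nat" where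
  "burke_step = (\<lambda>(i, j) \<omega> x.
     if x = (i, 0) then \<omega> (i, 0) - \<omega> (0, j) + \<omega> (i, j)
     else if x = (0, j) then \<omega> (0, j) - \<omega> (i, 0) + \<omega> (i, j)
     else if x = (i, j) then min (\<omega> (i, 0)) (\<omega> (0, j)) else \<omega> x)"

lemma burke_step_involution:
  assumes "0 < i" "0 < j"
  shows "burke_step (i, j) (burke_step (i, j) \<omega>) = \<omega>"
  using assms by (auto simp: burke_step_def fun_eq_iff min_def)

text \<open>The Burke property at one site. The step is an involution on configurations, and it
  preserves the probability of each of them: the geometric weights multiply to
  \<open>x ^ (I + W) * y ^ (J + W)\<close> up to a constant, where \<open>x\<close> and \<open>y\<close> are the parameters of \<open>I\<close> and \<open>J\<close>, and
  both exponents are invariants of the step.\<close>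

lemma burke_step_preserves_law:
  fixes u :: "nat \<times> nat \<Rightarrow> real"
  assumes ij: "0 < i" "0 < j"
    and S: "finite S" "{(i, 0), (0, j), (i, j)} \<subseteq> S"
    and u: "\<And>x. x \<in> S \<Longrightarrow> 0 < u x \<and> u x < 1"
    and prod: "u (i, j) = u (i, 0) * u (0, j)"
  shows "map_pmf (burke_step (i, j)) (Pi_pmf S 0 (\<lambda>x. geo (u x))) = Pi_pmf S 0 (\<lambda>x. geo (u x))"
    (is "map_pmf ?T ?P = ?P")
proof (rule pmf_eqI)
  fix \<omega>
  have "inj ?T"
    using burke_step_involution[OF ij] by (metis injI)
  from pmf_map_inj'[OF this, of ?P "?T \<omega>"]
  have 1: "pmf (map_pmf ?T ?P) \<omega> = pmf ?P (?T \<omega>)"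
    by (simp add: burke_step_involution ij)
  have T: "?T \<omega> x = \<omega> x" if "x \<notin> {(i, 0), (0, j), (i, j)}" for x
    using that by (auto simp: burke_step_def)
  have "pmf ?P (?T \<omega>) = pmf ?P \<omega>"
  proof (cases "\<forall>x. x \<notin> S \<longrightarrow> \<omega> x = 0")
    case True
    have split: "(\<Prod>x\<in>S. pmf (geo (u x)) (f x)) = pmf (geo (u (i, 0))) (f (i, 0)) *
        pmf (geo (u (0, j))) (f (0, j)) * pmf (geo (u (i, j))) (f (i, j)) *
        (\<Prod>x\<in>S - {(i, 0), (0, j), (i, j)}. pmf (geo (u x)) (f x))" for f
      using prod.subset_diff[OF S(2,1), of "\<lambda>x. pmf (geo (u x)) (f x)"] ij
      by (simp add: mult_ac)
    have rest: "(\<Prod>x\<in>S - {(i, 0), (0, j), (i, j)}. pmf (geo (u x)) (?T \<omega> x)) =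
        (\<Prod>x\<in>S - {(i, 0), (0, j), (i, j)}. pmf (geo (u x)) (\<omega> x))"
      using T by (intro prod.cong) auto
    define I J W where "I = \<omega> (i, 0)" and "J = \<omega> (0, j)" and "W = \<omega> (i, j)"
    have vals: "?T \<omega> (i, 0) = I - J + W" "?T \<omega> (0, j) = J - I + W" "?T \<omega> (i, j) = min I J"
      using ij by (auto simp: burke_step_def I_def J_def W_def)
    \<comment> \<open>The exponents match because \<open>I' + min I J = I + W\<close> and \<open>J' + min I J = J + W\<close>.\<close>
    have pow: "x ^ (I - J + W) * y ^ (J - I + W) * (x * y) ^ min I J = x ^ I * y ^ J * (x * y) ^ W"
      for x y :: real
      by (cases "I \<le> J")
         (simp_all add: power_mult_distrib min_def flip: power_add)
    have core: "pmf (geo (u (i, 0))) (I - J + W) * pmf (geo (u (0, j))) (J - I + W) *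
        pmf (geo (u (i, j))) (min I J) =
        pmf (geo (u (i, 0))) I * pmf (geo (u (0, j))) J * pmf (geo (u (i, j))) W"
    proof -
      have b: "0 \<le> u (i, 0)" "u (i, 0) < 1" "0 \<le> u (0, j)" "u (0, j) < 1"
        "0 \<le> u (i, j)" "u (i, j) < 1"
        using u S(2) by (auto simp: less_imp_le)
      show ?thesis
        using pow[of "u (i, 0)" "u (0, j)"]
        by (simp only: pmf_geo b) (simp add: prod algebra_simps)
    qed
    have "\<forall>x. x \<notin> S \<longrightarrow> ?T \<omega> x = 0"
      using True T S(2) by (metis subsetD)
    then have "pmf ?P (?T \<omega>) = (\<Prod>x\<in>S. pmf (geo (u x)) (?T \<omega> x))"
      unfolding pmf_Pi[OF S(1)] by (rule if_P)
    also have "\<dots> = (\<Prod>x\<in>S. pmf (geo (u x)) (\<omega> x))"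
      unfolding split rest vals core using core by (simp only: I_def J_def W_def)
    also have "\<dots> = pmf ?P \<omega>"
      unfolding pmf_Pi[OF S(1)] using True by (rule if_P[symmetric])
    finally show ?thesis .
  next
    case False
    then obtain x where x: "x \<notin> S" "\<omega> x \<noteq> 0" by auto
    then have "x \<notin> {(i, 0), (0, j), (i, j)}"
      using S(2) by blast
    then have "?T \<omega> x \<noteq> 0"
      using T[of x] x by metis
    with x show ?thesis
      using S(1) by (metis pmf_Pi_outside)
  qed
  with 1 show "pmf (map_pmf ?T ?P) \<omega> = pmf ?P \<omega>" by simp
qed

primrec burke_row :: "nat \<Rightarrow> nat \<Rightarrow> (nat \<times> nat \<Rightarrow> nat) \<Rightarrow> nat \<times> nat \<Rightarrow> nat" where
  "burke_row j 0 \<omega> = \<omega>"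
| "burke_row j (Suc i) \<omega> = burke_step (Suc i, j) (burke_row j i \<omega>)"

primrec burke_sweep :: "nat \<Rightarrow> nat \<Rightarrow> (nat \<times> nat \<Rightarrow> nat) \<Rightarrow> nat \<times> nat \<Rightarrow> nat" where
  "burke_sweep m 0 \<omega> = \<omega>"
| "burke_sweep m (Suc j) \<omega> = burke_row (Suc j) m (burke_sweep m j \<omega>)"

text \<open>Processing a row from left to right maintains the meaning of the axis cells: \<open>(0, Suc j)\<close>
  holds the vertical increment at the current column, and the cells \<open>(k, 0)\<close> already passed hold the
  horizontal increments of the new row.\<close>

lemma burke_row_invariant:
  assumes old: "\<And>i. i < m \<Longrightarrow> boundary_lpp \<omega> (Suc i) j = boundary_lpp \<omega> i j + \<eta> (Suc i, 0)"
    and row: "\<And>i. \<eta> (i, Suc j) = \<omega> (i, Suc j)"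
    and "i \<le> m"
  shows "boundary_lpp \<omega> i (Suc j) = boundary_lpp \<omega> i j + burke_row (Suc j) i \<eta> (0, Suc j) \<and>
    (\<forall>k<m. if k < i
       then boundary_lpp \<omega> (Suc k) (Suc j) = boundary_lpp \<omega> k (Suc j) + burke_row (Suc j) i \<eta> (Suc k, 0)
       else burke_row (Suc j) i \<eta> (Suc k, 0) = \<eta> (Suc k, 0)) \<and>
    (\<forall>k>i. burke_row (Suc j) i \<eta> (k, Suc j) = \<eta> (k, Suc j))"
  using \<open>i \<le> m\<close>
proof (induction i)
  case 0
  then show ?case by (simp add: row)
next
  case (Suc i)
  then have IH: "boundary_lpp \<omega> i (Suc j) = boundary_lpp \<omega> i j + burke_row (Suc j) i \<eta> (0, Suc j)"
    "\<And>k. k < i \<Longrightarrow>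
       boundary_lpp \<omega> (Suc k) (Suc j) = boundary_lpp \<omega> k (Suc j) + burke_row (Suc j) i \<eta> (Suc k, 0)"
    "\<And>k. \<not> k < i \<Longrightarrow> k < m \<Longrightarrow> burke_row (Suc j) i \<eta> (Suc k, 0) = \<eta> (Suc k, 0)"
    "\<And>k. k > i \<Longrightarrow> burke_row (Suc j) i \<eta> (k, Suc j) = \<omega> (k, Suc j)"
    by (auto simp: row split: if_splits)
  have bottom: "boundary_lpp \<omega> (Suc i) j = boundary_lpp \<omega> i j + burke_row (Suc j) i \<eta> (Suc i, 0)"
    using old[of i] IH(3)[of i] Suc.prems by simp
  have corner: "burke_row (Suc j) i \<eta> (Suc i, Suc j) = \<omega> (Suc i, Suc j)"
    using IH(4)[of "Suc i"] by simp
  have "boundary_lpp \<omega> (Suc i) (Suc j) =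
      boundary_lpp \<omega> (Suc i) j + burke_row (Suc j) (Suc i) \<eta> (0, Suc j)"
    "boundary_lpp \<omega> (Suc i) (Suc j) =
      boundary_lpp \<omega> i (Suc j) + burke_row (Suc j) (Suc i) \<eta> (Suc i, 0)"
    using bottom IH(1) corner by (auto simp: burke_step_def max_def)
  moreover have "burke_row (Suc j) (Suc i) \<eta> (Suc k, 0) = burke_row (Suc j) i \<eta> (Suc k, 0)"
    if "k \<noteq> i" for k
    using that by (simp add: burke_step_def)
  moreover have "burke_row (Suc j) (Suc i) \<eta> (k, Suc j) = \<eta> (k, Suc j)" if "k > Suc i" for k
    using that IH(4)[of k] row by (simp add: burke_step_def)
  ultimately show ?case
    using IH Suc.prems by (auto simp: less_Suc_eq simp del: burke_row.simps boundary_lpp.simps)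
qed

lemma burke_sweep_invariant:
  "(\<forall>i<m. boundary_lpp \<omega> (Suc i) j = boundary_lpp \<omega> i j + burke_sweep m j \<omega> (Suc i, 0)) \<and>
   (\<forall>i l. j < l \<longrightarrow> burke_sweep m j \<omega> (i, l) = \<omega> (i, l))"
proof (induction j)
  case (Suc j)
  have other: "burke_row (Suc j) i \<eta> (k, l) = \<eta> (k, l)" if "Suc j < l" for i \<eta> k l
    using that by (induction i) (auto simp: burke_step_def)
  have "\<forall>i<m. boundary_lpp \<omega> (Suc i) (Suc j) =
      boundary_lpp \<omega> i (Suc j) + burke_row (Suc j) m (burke_sweep m j \<omega>) (Suc i, 0)"
    using burke_row_invariant[of m \<omega> j "burke_sweep m j \<omega>" m] Suc
    by (simp del: burke_row.simps boundary_lpp.simps)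
  then show ?case
    using Suc other by simp
qed simp

text \<open>Summing the increments up the left edge and along the top edge. By the next lemma both
  sums have independent geometric terms.\<close>

lemma boundary_lpp_sweep:
  "boundary_lpp \<omega> m n = (\<Sum>j\<in>{0<..n}. \<omega> (0, j)) + (\<Sum>i\<in>{0<..m}. burke_sweep m n \<omega> (i, 0))"
proof -
  have "boundary_lpp \<omega> i n = boundary_lpp \<omega> 0 n + (\<Sum>i\<in>{0<..i}. burke_sweep m n \<omega> (i, 0))"
    if "i \<le> m" for i
    using that
  proof (induction i)
    case (Suc i)
    then show ?case
      using burke_sweep_invariant[of m \<omega> n]
      by (auto simp flip: atLeastSucAtMost_greaterThanAtMost simp del: boundary_lpp.simps)
  qed simp
  from this[of m] show ?thesis
    by (simp add: boundary_lpp_left)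
qed

lemma burke_sweep_preserves_law:
  fixes u :: "nat \<times> nat \<Rightarrow> real"
  assumes S: "finite S" "{0..m} \<times> {0..n} - {(0, 0)} \<subseteq> S"
    and u: "\<And>x. x \<in> S \<Longrightarrow> 0 < u x \<and> u x < 1"
    and prod: "\<And>i j. 0 < i \<Longrightarrow> 0 < j \<Longrightarrow> u (i, j) = u (i, 0) * u (0, j)"
  shows "map_pmf (burke_sweep m n) (Pi_pmf S 0 (\<lambda>x. geo (u x))) = Pi_pmf S 0 (\<lambda>x. geo (u x))"
    (is "_ = ?P")
proof -
  have row: "map_pmf (burke_row (Suc j) i) ?P = ?P" if "i \<le> m" "j < n" for i j
    using that
  proof (induction i)
    case 0
    have "burke_row (Suc j) 0 = id" by (simp add: fun_eq_iff)
    then show ?case by simp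
  next
    case (Suc i)
    have "burke_row (Suc j) (Suc i) = burke_step (Suc i, Suc j) \<circ> burke_row (Suc j) i"
      by (simp add: fun_eq_iff)
    then have "map_pmf (burke_row (Suc j) (Suc i)) ?P =
        map_pmf (burke_step (Suc i, Suc j)) (map_pmf (burke_row (Suc j) i) ?P)"
      by (simp add: pmf.map_comp)
    also have "\<dots> = map_pmf (burke_step (Suc i, Suc j)) ?P"
      using Suc by simp
    also have "\<dots> = ?P"
      using S Suc.prems by (intro burke_step_preserves_law S u prod) auto
    finally show ?case .
  qed
  have "map_pmf (burke_sweep m j) ?P = ?P" if "j \<le> n" for j
    using that
  proof (induction j)
    case 0
    have "burke_sweep m 0 = id" by (simp add: fun_eq_iff)
    then show ?case by simp
  next
    case (Suc j)
    have "burke_sweep m (Suc j) = burke_row (Suc j) m \<circ> burke_sweep m j"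
      by (simp add: fun_eq_iff)
    then have "map_pmf (burke_sweep m (Suc j)) ?P =
        map_pmf (burke_row (Suc j) m) (map_pmf (burke_sweep m j) ?P)"
      by (simp add: pmf.map_comp)
    with Suc row[of m j] show ?case by (simp del: burke_sweep.simps)
  qed
  then show ?thesis by simp
qed

section \<open>Sums of independent geometric variables\<close>

lemma geo_mean:
  assumes "0 \<le> u" "u < 1"
  shows "integrable (geo u) real" "measure_pmf.expectation (geo u) real = u / (1 - u)"
  using integrable_real_geometric_pmf[of "1 - u"] expectation_geometric_pmf[of "1 - u"] assms
  by (auto simp: geo_def)

lemma summable_square_times_power:
  fixes r :: real
  assumes "0 \<le> r" "r < 1"
  shows "summable (\<lambda>k. (real k)\<^sup>2 * r ^ k)"
proof -
  have 1: "summable (\<lambda>n. diffs (\<lambda>_. 1) n * x ^ n)" if "norm x < 1" for x :: real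
    using that by (intro termdiff_converges[of _ 1]) (auto simp: summable_geometric)
  have "summable (\<lambda>n. diffs (diffs (\<lambda>_. 1)) n * r ^ n)"
    using assms 1 by (intro termdiff_converges[of _ 1]) auto
  then have "summable (\<lambda>n. (real n + 1) * (real n + 2) * r ^ n)"
    by (simp add: diffs_def add_ac)
  then show ?thesis
    by (rule summable_comparison_test')
       (use assms in \<open>auto intro!: mult_right_mono simp: power2_eq_square algebra_simps\<close>)
qed

text \<open>One constant serves all parameters up to \<open>r\<close>, so that the variance bounds below are uniform
  over the environment.\<close>

lemma geo_second_moment_bound:
  assumes "0 \<le> r" "r < 1"
  obtains C where "0 \<le> C"
    "\<And>u. 0 \<le> u \<Longrightarrow> u \<le> r \<Longrightarrow> integrable (geo u) (\<lambda>k. (real k)\<^sup>2)"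
    "\<And>u. 0 \<le> u \<Longrightarrow> u \<le> r \<Longrightarrow> measure_pmf.expectation (geo u) (\<lambda>k. (real k)\<^sup>2) \<le> C"
proof
  define C where "C = (\<Sum>k. (real k)\<^sup>2 * r ^ k)"
  have sm: "summable (\<lambda>k. (real k)\<^sup>2 * r ^ k)"
    using summable_square_times_power assms .
  show "0 \<le> C"
    unfolding C_def using sm assms by (intro suminf_nonneg) auto
  fix u :: real assume u: "0 \<le> u" "u \<le> r"
  have "(\<integral>\<^sup>+k. ennreal ((real k)\<^sup>2) \<partial>geo u) = (\<Sum>k. ennreal (u ^ k * (1 - u)) * ennreal ((real k)\<^sup>2))"
    using u assms by (simp add: nn_integral_measure_pmf nn_integral_count_space_nat pmf_geo)
  also have "\<dots> \<le> (\<Sum>k. ennreal ((real k)\<^sup>2 * r ^ k))"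
  proof (intro suminf_le summableI)
    fix k
    have "u ^ k * (1 - u) * (real k)\<^sup>2 \<le> r ^ k * 1 * (real k)\<^sup>2"
      using u assms by (intro mult_mono power_mono) auto
    then show "ennreal (u ^ k * (1 - u)) * ennreal ((real k)\<^sup>2) \<le> ennreal ((real k)\<^sup>2 * r ^ k)"
      using u assms by (subst ennreal_mult[symmetric]) (auto simp: mult_ac intro!: ennreal_leI)
  qed
  also have "\<dots> = ennreal C"
    unfolding C_def using sm assms by (intro suminf_ennreal2) auto
  finally have le: "(\<integral>\<^sup>+k. ennreal ((real k)\<^sup>2) \<partial>geo u) \<le> ennreal C" .
  show "integrable (geo u) (\<lambda>k. (real k)\<^sup>2)"
    using le by (intro integrableI_bounded) (auto simp: le_less_trans[OF _ ennreal_less_top])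
  show "measure_pmf.expectation (geo u) (\<lambda>k. (real k)\<^sup>2) \<le> C"
    using le \<open>0 \<le> C\<close> by (subst integral_eq_nn_integral) (auto intro!: enn2real_leI)
qed

lemma Pi_pmf_component_integral:
  fixes h :: "'b \<Rightarrow> real"
  assumes "finite S" "x \<in> S"
  shows "integrable (Pi_pmf S d p) (\<lambda>\<omega>. h (\<omega> x)) \<longleftrightarrow> integrable (p x) h"
    and "measure_pmf.expectation (Pi_pmf S d p) (\<lambda>\<omega>. h (\<omega> x)) = measure_pmf.expectation (p x) h"
proof -
  have p: "p x = map_pmf (\<lambda>\<omega>. \<omega> x) (Pi_pmf S d p)"
    using assms by (simp add: Pi_pmf_component)
  show "integrable (Pi_pmf S d p) (\<lambda>\<omega>. h (\<omega> x)) \<longleftrightarrow> integrable (p x) h"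
    by (subst p) simp
  show "measure_pmf.expectation (Pi_pmf S d p) (\<lambda>\<omega>. h (\<omega> x)) = measure_pmf.expectation (p x) h"
    by (subst p) simp
qed

lemma Pi_pmf_geo_product_moment:
  assumes S: "finite S" "x \<in> S" "y \<in> S" "x \<noteq> y"
    and v: "\<And>x. x \<in> S \<Longrightarrow> 0 \<le> v x \<and> v x < 1"
  shows "integrable (Pi_pmf S 0 (\<lambda>x. geo (v x))) (\<lambda>\<omega>. real (\<omega> x) * real (\<omega> y))"
    and "measure_pmf.expectation (Pi_pmf S 0 (\<lambda>x. geo (v x))) (\<lambda>\<omega>. real (\<omega> x) * real (\<omega> y)) =
      v x / (1 - v x) * (v y / (1 - v y))"
proof -
  define f where "f = (\<lambda>k w. if k = x \<or> k = y then real w else 1)"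
  have prod2: "(\<Prod>k\<in>S. if k = x then c else if k = y then d else 1) = c * d" for c d :: real
  proof -
    have "(\<Prod>k\<in>S. if k = x then c else if k = y then d else 1) =
        (\<Prod>k\<in>{x, y}. if k = x then c else if k = y then d else 1)"
      using S by (intro prod.mono_neutral_right) auto
    then show ?thesis using S by simp
  qed
  have prodf: "(\<Prod>k\<in>S. f k (\<omega> k)) = real (\<omega> x) * real (\<omega> y)" for \<omega>
    unfolding prod2[symmetric] by (intro prod.cong) (auto simp: f_def)
  have int: "integrable (geo (v k)) (f k)" if "k \<in> S" for k
    using geo_mean(1)[of "v k"] v[OF that] by (cases "k = x \<or> k = y") (auto simp: f_def)
  show "integrable (Pi_pmf S 0 (\<lambda>x. geo (v x))) (\<lambda>\<omega>. real (\<omega> x) * real (\<omega> y))"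
    unfolding prodf[symmetric] using int S by (intro integrable_prod_Pi_pmf)
  have "measure_pmf.expectation (Pi_pmf S 0 (\<lambda>x. geo (v x))) (\<lambda>\<omega>. \<Prod>k\<in>S. f k (\<omega> k)) =
      (\<Prod>k\<in>S. measure_pmf.expectation (geo (v k)) (f k))"
    using int S by (intro expectation_prod_Pi_pmf) (auto simp: f_def)
  also have "\<dots> = (\<Prod>k\<in>S. if k = x then v x / (1 - v x) else if k = y then v y / (1 - v y) else 1)"
    using v geo_mean(2) by (intro prod.cong) (auto simp: f_def)
  finally show "measure_pmf.expectation (Pi_pmf S 0 (\<lambda>x. geo (v x))) (\<lambda>\<omega>. real (\<omega> x) * real (\<omega> y)) =
      v x / (1 - v x) * (v y / (1 - v y))"
    by (simp only: prodf prod2)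
qed

lemma geo_sum_chebyshev:
  assumes "finite S" "B \<subseteq> S" "r < 1"
    and v: "\<And>x. x \<in> S \<Longrightarrow> 0 \<le> v x \<and> v x \<le> r"
    and C: "\<And>u. 0 \<le> u \<Longrightarrow> u \<le> r \<Longrightarrow> integrable (geo u) (\<lambda>k. (real k)\<^sup>2)"
      "\<And>u. 0 \<le> u \<Longrightarrow> u \<le> r \<Longrightarrow> measure_pmf.expectation (geo u) (\<lambda>k. (real k)\<^sup>2) \<le> C"
    and "0 < d"
  shows "measure_pmf.prob (Pi_pmf S 0 (\<lambda>x. geo (v x)))
      {\<omega>. d \<le> \<bar>real (\<Sum>x\<in>B. \<omega> x) - (\<Sum>x\<in>B. v x / (1 - v x))\<bar>} \<le> real (card B) * C / d\<^sup>2"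
    (is "measure_pmf.prob ?P _ \<le> _")
proof -
  define f where "f = (\<lambda>\<omega> :: _ \<Rightarrow> nat. \<Sum>x\<in>B. real (\<omega> x))"
  define m where "m = (\<lambda>x. v x / (1 - v x))"
  have v1: "0 \<le> v x \<and> v x < 1" if "x \<in> S" for x
    using v[OF that] \<open>r < 1\<close> by auto
  have B: "finite B"
    using assms finite_subset by blast
  have int1: "integrable ?P (\<lambda>\<omega>. real (\<omega> x))" if "x \<in> B" for x
    using that assms v1 geo_mean(1) by (subst Pi_pmf_component_integral) auto
  have E1: "measure_pmf.expectation ?P (\<lambda>\<omega>. real (\<omega> x)) = m x" if "x \<in> B" for x
    using that assms v1 geo_mean(2) by (subst Pi_pmf_component_integral) (auto simp: m_def)
  have Ef: "measure_pmf.expectation ?P f = (\<Sum>x\<in>B. m x)"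
    unfolding f_def using int1 E1 by (subst Bochner_Integration.integral_sum) auto
  have int2: "integrable ?P (\<lambda>\<omega>. real (\<omega> x) * real (\<omega> y))"
    and E2: "measure_pmf.expectation ?P (\<lambda>\<omega>. real (\<omega> x) * real (\<omega> y)) \<le>
      m x * m y + (if x = y then C else 0)" if "x \<in> B" "y \<in> B" for x y
  proof -
    have xS: "x \<in> S" "y \<in> S"
      using that assms by auto
    have "integrable ?P (\<lambda>\<omega>. real (\<omega> x) * real (\<omega> y)) \<and>
      measure_pmf.expectation ?P (\<lambda>\<omega>. real (\<omega> x) * real (\<omega> y)) \<le> m x * m y + (if x = y then C else 0)"
    proof (cases "x = y")
      case True
      have "integrable ?P (\<lambda>\<omega>. (real (\<omega> x))\<^sup>2)"
        using C(1) v xS assms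
        by (subst Pi_pmf_component_integral[where h = "\<lambda>k. (real k)\<^sup>2"]) auto
      moreover have "measure_pmf.expectation ?P (\<lambda>\<omega>. (real (\<omega> x))\<^sup>2) \<le> C"
        using C(2) v xS assms
        by (subst Pi_pmf_component_integral[where h = "\<lambda>k. (real k)\<^sup>2"]) auto
      ultimately show ?thesis
        using True zero_le_square[of "m x"]
        by (auto simp: power2_eq_square intro: order_trans)
    next
      case False
      then show ?thesis
        using Pi_pmf_geo_product_moment[of S x y v] v1 xS assms by (simp add: m_def)
    qed
    then show "integrable ?P (\<lambda>\<omega>. real (\<omega> x) * real (\<omega> y))"
      "measure_pmf.expectation ?P (\<lambda>\<omega>. real (\<omega> x) * real (\<omega> y)) \<le>
        m x * m y + (if x = y then C else 0)" by auto
  qed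
  have f2: "(f \<omega>)\<^sup>2 = (\<Sum>x\<in>B. \<Sum>y\<in>B. real (\<omega> x) * real (\<omega> y))" for \<omega>
    by (simp add: f_def power2_eq_square sum_product)
  have int_f2: "integrable ?P (\<lambda>\<omega>. (f \<omega>)\<^sup>2)"
    unfolding f2 using int2 by (intro Bochner_Integration.integrable_sum) auto
  have "measure_pmf.expectation ?P (\<lambda>\<omega>. (f \<omega>)\<^sup>2) =
      (\<Sum>x\<in>B. \<Sum>y\<in>B. measure_pmf.expectation ?P (\<lambda>\<omega>. real (\<omega> x) * real (\<omega> y)))"
    unfolding f2 using int2
    by (subst Bochner_Integration.integral_sum, (intro Bochner_Integration.integrable_sum; simp),
        intro sum.cong refl Bochner_Integration.integral_sum) auto
  also have "\<dots> \<le> (\<Sum>x\<in>B. \<Sum>y\<in>B. m x * m y + (if x = y then C else 0))"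
    using E2 by (intro sum_mono) auto
  also have "\<dots> = (\<Sum>x\<in>B. m x)\<^sup>2 + real (card B) * C"
    using B by (simp add: sum.distrib sum_product power2_eq_square)
  finally have Ef2: "measure_pmf.expectation ?P (\<lambda>\<omega>. (f \<omega>)\<^sup>2) \<le> (\<Sum>x\<in>B. m x)\<^sup>2 + real (card B) * C" .
  have int_f: "integrable ?P f"
    unfolding f_def using int1 by (intro Bochner_Integration.integrable_sum) auto
  have "measure_pmf.variance ?P f \<le> real (card B) * C"
    using measure_pmf.variance_eq[OF int_f int_f2] Ef Ef2 by simp
  moreover have "measure_pmf.prob ?P {\<omega> \<in> space ?P. d \<le> \<bar>f \<omega> - measure_pmf.expectation ?P f\<bar>}
      \<le> measure_pmf.variance ?P f / d\<^sup>2"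
    using int_f2 \<open>0 < d\<close> by (intro measure_pmf.Chebyshev_inequality) auto
  ultimately have "measure_pmf.prob ?P {\<omega> \<in> space ?P. d \<le> \<bar>f \<omega> - measure_pmf.expectation ?P f\<bar>}
      \<le> real (card B) * C / d\<^sup>2"
    by (meson divide_right_mono order_trans zero_le_power2)
  then show ?thesis
    unfolding Ef by (simp add: f_def m_def)
qed

text \<open>The sets and parameters may change with \<open>N\<close>, because the boxes grow and carry different
  finite products.\<close>

lemma geo_sum_concentration:
  assumes fin: "\<And>N. finite (S N)" and sub: "\<And>N. B N \<subseteq> S N"
    and v: "\<And>N x. x \<in> S N \<Longrightarrow> 0 \<le> v N x \<and> v N x \<le> r"
    and r: "0 \<le> r" "r < 1"
    and card: "\<And>N. real (card (B N)) \<le> K * real N"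
    and "0 < \<delta>"
  shows "(\<lambda>N. measure_pmf.prob (Pi_pmf (S N) 0 (\<lambda>x. geo (v N x)))
      {\<omega>. real N * \<delta> \<le> \<bar>real (\<Sum>x\<in>B N. \<omega> x) - (\<Sum>x\<in>B N. v N x / (1 - v N x))\<bar>})
    \<longlonglongrightarrow> 0" (is "?p \<longlonglongrightarrow> 0")
proof -
  obtain C where C: "0 \<le> C"
    "\<And>u. 0 \<le> u \<Longrightarrow> u \<le> r \<Longrightarrow> integrable (geo u) (\<lambda>k. (real k)\<^sup>2)"
    "\<And>u. 0 \<le> u \<Longrightarrow> u \<le> r \<Longrightarrow> measure_pmf.expectation (geo u) (\<lambda>k. (real k)\<^sup>2) \<le> C"
    using geo_second_moment_bound[OF r] by blast
  have bound: "?p N \<le> K * C / \<delta>\<^sup>2 * (1 / real N)" if "0 < N" for N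
  proof -
    have "?p N \<le> real (card (B N)) * C / (real N * \<delta>)\<^sup>2"
      using that \<open>0 < \<delta>\<close> by (intro geo_sum_chebyshev[OF fin sub r(2) v C(2,3)]) auto
    also have "\<dots> \<le> K * real N * C / (real N * \<delta>)\<^sup>2"
      using card C(1) by (intro divide_right_mono mult_right_mono) auto
    also have "\<dots> = K * C / \<delta>\<^sup>2 * (1 / real N)"
      using that by (simp add: power2_eq_square field_simps)
    finally show ?thesis .
  qed
  show ?thesis
  proof (rule tendsto_sandwich[of "\<lambda>_. 0" _ _ "\<lambda>N. K * C / \<delta>\<^sup>2 * (1 / real N)"])
    show "\<forall>\<^sub>F N in sequentially. ?p N \<le> K * C / \<delta>\<^sup>2 * (1 / real N)"
      using eventually_gt_at_top[of 0] by eventually_elim (rule bound)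
    show "(\<lambda>N. K * C / \<delta>\<^sup>2 * (1 / real N)) \<longlonglongrightarrow> 0"
      using tendsto_mult_right_zero[OF lim_1_over_n] by blast
  qed auto
qed

section \<open>The quenched tail of the last-passage time\<close>

text \<open>Only finitely many weights enter, so the probability is taken under a finite product of
  pmfs. The dependence on the parameters is explicit and shifts act on it directly.\<close>

definition quenched_tail ::
  "(nat \<Rightarrow> real) \<Rightarrow> (nat \<Rightarrow> real) \<Rightarrow> nat \<Rightarrow> nat \<Rightarrow> real \<Rightarrow> real" where
  "quenched_tail a b m n y =
     measure_pmf.prob (Pi_pmf ({1..m} \<times> {1..n}) 0 (\<lambda>(i, j). geo (a i * b j)))
       {W. y \<le> real (last_passage W m n)}"

lemma quenched_tail_bounds: "0 \<le> quenched_tail a b m n y" "quenched_tail a b m n y \<le> 1"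
  by (auto simp: quenched_tail_def)

lemma map_Pi_pmf_reindex:
  assumes S: "finite S" and h: "inj_on h B" "h ` B \<subseteq> S"
  shows "map_pmf (\<lambda>\<omega> x. if x \<in> B then \<omega> (h x) else d) (Pi_pmf S d p) = Pi_pmf B d (\<lambda>x. p (h x))"
    (is "map_pmf ?T _ = _")
proof (rule pmf_eqI)
  fix f
  have B: "finite B"
    using h S finite_subset finite_imageD by metis
  show "pmf (map_pmf ?T (Pi_pmf S d p)) f = pmf (Pi_pmf B d (\<lambda>x. p (h x))) f"
  proof (cases "\<forall>x. x \<notin> B \<longrightarrow> f x = d")
    case True
    define E where "E = (\<lambda>s. if s \<in> h ` B then {f (the_inv_into B h s)} else UNIV)"
    have E: "E (h x) = {f x}" if "x \<in> B" for x
      using that h by (auto simp: E_def the_inv_into_f_f)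
    have "?T -` {f} = Pi S E"
    proof (intro equalityI subsetI)
      fix \<omega> assume "\<omega> \<in> ?T -` {f}"
      then have "\<omega> (h x) = f x" if "x \<in> B" for x
        using that by (auto simp: fun_eq_iff split: if_splits)
      then show "\<omega> \<in> Pi S E"
        using E by (auto simp: Pi_iff) (auto simp: E_def)
    next
      fix \<omega> assume "\<omega> \<in> Pi S E"
      then show "\<omega> \<in> ?T -` {f}"
        using True E h(2) by (fastforce simp: fun_eq_iff Pi_iff image_subset_iff)
    qed
    then have "pmf (map_pmf ?T (Pi_pmf S d p)) f = measure_pmf.prob (Pi_pmf S d p) (Pi S E)"
      by (simp add: pmf_map)
    also have "\<dots> = (\<Prod>s\<in>S. measure_pmf.prob (p s) (E s))"
      using S by (rule measure_Pi_pmf_Pi)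
    also have "\<dots> = (\<Prod>s\<in>h ` B. measure_pmf.prob (p s) (E s))"
      using S h by (intro prod.mono_neutral_right) (auto simp: E_def)
    also have "\<dots> = (\<Prod>x\<in>B. pmf (p (h x)) (f x))"
      using h E by (simp add: prod.reindex measure_pmf_single)
    also have "\<dots> = pmf (Pi_pmf B d (\<lambda>x. p (h x))) f"
      unfolding pmf_Pi[OF B] using True by (rule if_P[symmetric])
    finally show ?thesis .
  next
    case False
    then have "?T -` {f} = {}" by fastforce
    then show ?thesis
      using False B by (simp only: pmf_map pmf_Pi if_False) simp
  qed
qed

text \<open>Any box of independent weights with the right parameters has this tail, wherever it sits
  in a larger index set. This yields the shifted boxes beyond an exit point and the transposition.\<close>

lemma prob_reindexed_last_passage:
  assumes "finite S" "inj_on h ({1..m} \<times> {1..n})" "h ` ({1..m} \<times> {1..n}) \<subseteq> S"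
    and v: "\<And>i j. i \<in> {1..m} \<Longrightarrow> j \<in> {1..n} \<Longrightarrow> v (h (i, j)) = a i * b j"
  shows "measure_pmf.prob (Pi_pmf S 0 (\<lambda>x. geo (v x)))
      {\<omega>. y \<le> real (last_passage (\<lambda>p. \<omega> (h p)) m n)} = quenched_tail a b m n y"
proof -
  let ?B = "{1..m} \<times> {1..n}"
  let ?T = "\<lambda>\<omega> x. if x \<in> ?B then \<omega> (h x) else 0"
  have "Pi_pmf ?B 0 (\<lambda>(i, j). geo (a i * b j)) = Pi_pmf ?B 0 (\<lambda>x. geo (v (h x)))"
    using v by (intro Pi_pmf_cong) auto
  also have "\<dots> = map_pmf ?T (Pi_pmf S 0 (\<lambda>x. geo (v x)))"
    using map_Pi_pmf_reindex[OF assms(1-3), of 0 "\<lambda>x. geo (v x)"] by simp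
  finally have "quenched_tail a b m n y = measure_pmf.prob (Pi_pmf S 0 (\<lambda>x. geo (v x)))
      {\<omega>. y \<le> real (last_passage (?T \<omega>) m n)}"
    unfolding quenched_tail_def by (simp add: vimage_def)
  moreover have "last_passage (?T \<omega>) m n = last_passage (\<lambda>p. \<omega> (h p)) m n" for \<omega>
    by (intro last_passage_cong) auto
  ultimately show ?thesis by simp
qed

lemma quenched_tail_swap: "quenched_tail b a n m y = quenched_tail a b m n y"
proof -
  have "quenched_tail b a n m y = measure_pmf.prob (Pi_pmf ({1..m} \<times> {1..n}) 0
      (\<lambda>x. geo (case x of (i, j) \<Rightarrow> a i * b j)))
      {\<omega>. y \<le> real (last_passage (\<lambda>p. \<omega> (prod.swap p)) n m)}"
    by (subst prob_reindexed_last_passage[where a = b and b = a])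
       (auto simp: inj_on_def)
  also have "\<dots> = quenched_tail a b m n y"
    by (simp add: last_passage_swap quenched_tail_def case_prod_beta')
  finally show ?thesis .
qed

section \<open>The stationary model with boundary parameter z\<close>

definition params_upto :: "real \<Rightarrow> (nat \<Rightarrow> real) \<Rightarrow> bool" where
  "params_upto \<alpha> a \<longleftrightarrow> (\<forall>i\<ge>1. 0 < a i \<and> a i \<le> \<alpha>)"

lemma params_upto_pos: "params_upto \<alpha> a \<Longrightarrow> 0 < \<alpha>"
  by (auto simp: params_upto_def dest!: spec[of _ 1])

text \<open>The axes behave like a column with \<open>a\<^sub>0 = z\<close> and a row with \<open>b\<^sub>0 = 1 / z\<close>, which gives the product
  relation between the three parameters of a Burke step.\<close>

definition boundary_param :: "(nat \<Rightarrow> real) \<Rightarrow> (nat \<Rightarrow> real) \<Rightarrow> real \<Rightarrow> nat \<times> nat \<Rightarrow> real" where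
  "boundary_param a b z = (\<lambda>(i, j). if j = 0 then a i / z else if i = 0 then b j * z else a i * b j)"

definition boundary_sites :: "nat \<Rightarrow> nat \<Rightarrow> (nat \<times> nat) set" where
  "boundary_sites m n = {0..m} \<times> {0..n} - {(0, 0)}"

abbreviation boundary_pmf where
  "boundary_pmf a b z m n \<equiv> Pi_pmf (boundary_sites m n) 0 (\<lambda>x. geo (boundary_param a b z x))"

lemma finite_boundary_sites [simp]: "finite (boundary_sites m n)"
  by (simp add: boundary_sites_def)

lemma boundary_pmf_shifted_last_passage:
  assumes "k + m' \<le> m" "l + n' \<le> n"
  shows "measure_pmf.prob (boundary_pmf a b z m n)
      {\<omega>. y \<le> real (last_passage (\<lambda>(i, j). \<omega> (i + k, j + l)) m' n')} =
    quenched_tail (\<lambda>i. a (i + k)) (\<lambda>j. b (j + l)) m' n' y"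
proof -
  have "measure_pmf.prob (boundary_pmf a b z m n)
      {\<omega>. y \<le> real (last_passage (\<lambda>p. \<omega> ((\<lambda>(i, j). (i + k, j + l)) p)) m' n')} =
    quenched_tail (\<lambda>i. a (i + k)) (\<lambda>j. b (j + l)) m' n' y"
    using assms
    by (intro prob_reindexed_last_passage)
       (auto simp: inj_on_def boundary_sites_def boundary_param_def)
  then show ?thesis
    by (simp add: case_prod_beta')
qed

lemma boundary_param_bounds:
  assumes "params_upto \<alpha> a" "params_upto \<beta> b"
    and z: "\<alpha> < z" "\<beta> * z < 1"
    and x: "x \<in> boundary_sites m n"
  shows "0 < boundary_param a b z x \<and> boundary_param a b z x \<le> max (\<alpha> / z) (\<beta> * z)"
proof -
  obtain i j where ij: "x = (i, j)" by (cases x)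
  have \<alpha>: "0 < \<alpha>" and \<beta>: "0 < \<beta>"
    using assms(1,2) params_upto_pos by auto
  then have z0: "0 < z" using z by simp
  consider "j = 0" "1 \<le> i" | "i = 0" "1 \<le> j" | "1 \<le> i" "1 \<le> j"
    using x by (cases "i = 0"; cases "j = 0") (auto simp: boundary_sites_def ij)
  then show ?thesis
  proof cases
    case 1
    then show ?thesis
      using assms(1) z0 by (auto simp: params_upto_def ij boundary_param_def divide_right_mono le_max_iff_disj)
  next
    case 2
    then show ?thesis
      using assms(2) z0 by (auto simp: params_upto_def ij boundary_param_def mult_right_mono le_max_iff_disj)
  next
    case 3
    have "a i * b j \<le> \<alpha> * \<beta>"
      using assms(1,2) 3 \<alpha> by (intro mult_mono) (auto simp: params_upto_def less_imp_le)
    also have "\<dots> \<le> z * \<beta>"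
      using z \<beta> by (intro mult_right_mono) auto
    finally show ?thesis
      using assms(1,2) 3 by (auto simp: params_upto_def ij boundary_param_def mult_ac le_max_iff_disj)
  qed
qed

lemma boundary_max_less_1:
  fixes \<alpha> \<beta> z :: real
  assumes "0 < \<alpha>" "\<alpha> < z" "\<beta> * z < 1"
  shows "max (\<alpha> / z) (\<beta> * z) < 1" "0 \<le> max (\<alpha> / z) (\<beta> * z)"
  using assms by (auto simp: le_max_iff_disj)

lemma boundary_sweep_law:
  assumes "params_upto \<alpha> a" "params_upto \<beta> b"
    and z: "\<alpha> < z" "\<beta> * z < 1"
  shows "map_pmf (burke_sweep m n) (boundary_pmf a b z m n) = boundary_pmf a b z m n"
proof (rule burke_sweep_preserves_law)
  have "0 < \<alpha>" using assms(1) by (rule params_upto_pos)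
  then show "boundary_param a b z (i, j) = boundary_param a b z (i, 0) * boundary_param a b z (0, j)"
    if "0 < i" "0 < j" for i j
    using that z by (simp add: boundary_param_def)
  show "0 < boundary_param a b z x \<and> boundary_param a b z x < 1" if "x \<in> boundary_sites m n" for x
    using boundary_param_bounds[OF assms that] boundary_max_less_1(1)[OF \<open>0 < \<alpha>\<close> z] by linarith
qed (auto simp: boundary_sites_def)

text \<open>The expectation of the last-passage time with boundary is explicit by the Burke property,
  and it dominates the one without boundary; Markov's inequality does the rest.\<close>

lemma quenched_tail_markov:
  assumes ab: "params_upto \<alpha> a" "params_upto \<beta> b"
    and z: "\<alpha> < z" "\<beta> * z < 1"
    and mn: "1 \<le> m" "1 \<le> n" and "0 < y"
  shows "y * quenched_tail a b m n y \<le>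
    (\<Sum>i\<in>{0<..m}. (a i / z) / (1 - a i / z)) + (\<Sum>j\<in>{0<..n}. (b j * z) / (1 - b j * z))"
proof -
  let ?P = "boundary_pmf a b z m n" and ?v = "boundary_param a b z"
  have "0 < \<alpha>" using ab(1) by (rule params_upto_pos)
  have v: "0 \<le> ?v x \<and> ?v x < 1" if "x \<in> boundary_sites m n" for x
    using boundary_param_bounds[OF ab z that] boundary_max_less_1(1)[OF \<open>0 < \<alpha>\<close> z] by auto
  have int: "integrable ?P (\<lambda>\<omega>. real (\<omega> x))"
    and E: "measure_pmf.expectation ?P (\<lambda>\<omega>. real (\<omega> x)) = ?v x / (1 - ?v x)"
    if "x \<in> boundary_sites m n" for x
    using that v geo_mean by (subst Pi_pmf_component_integral; auto)+
  define f where "f = (\<lambda>\<omega> :: nat \<times> nat \<Rightarrow> nat. \<Sum>j\<in>{0<..n}. real (\<omega> (0, j)))"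
  define h where "h = (\<lambda>\<omega> :: nat \<times> nat \<Rightarrow> nat. \<Sum>i\<in>{0<..m}. real (\<omega> (i, 0)))"
  have f: "integrable ?P f"
    unfolding f_def using int mn
    by (intro Bochner_Integration.integrable_sum) (auto simp: boundary_sites_def)
  have Ef: "measure_pmf.expectation ?P f = (\<Sum>j\<in>{0<..n}. (b j * z) / (1 - b j * z))"
    unfolding f_def using int E
    by (subst Bochner_Integration.integral_sum)
       (auto simp: boundary_sites_def boundary_param_def intro!: sum.cong)
  have h: "integrable ?P h"
    unfolding h_def using int mn
    by (intro Bochner_Integration.integrable_sum) (auto simp: boundary_sites_def)
  have Eh: "measure_pmf.expectation ?P h = (\<Sum>i\<in>{0<..m}. (a i / z) / (1 - a i / z))"
    unfolding h_def using int E
    by (subst Bochner_Integration.integral_sum)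
       (auto simp: boundary_sites_def boundary_param_def intro!: sum.cong)
  have law: "map_pmf (burke_sweep m n) ?P = ?P"
    by (rule boundary_sweep_law[OF ab z])
  have h': "integrable ?P (\<lambda>\<omega>. h (burke_sweep m n \<omega>))"
    "measure_pmf.expectation ?P (\<lambda>\<omega>. h (burke_sweep m n \<omega>)) = measure_pmf.expectation ?P h"
    using h integral_map_pmf[of "burke_sweep m n" ?P h] integrable_map_pmf_eq[of "burke_sweep m n" ?P h]
    by (simp_all add: law)
  have blpp: "real (boundary_lpp \<omega> m n) = f \<omega> + h (burke_sweep m n \<omega>)" for \<omega>
    by (simp add: boundary_lpp_sweep f_def h_def)
  have nonneg: "0 \<le> f \<omega>" "0 \<le> h \<omega>" for \<omega>
    by (auto simp: f_def h_def intro!: sum_nonneg)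
  have "quenched_tail a b m n y = measure_pmf.prob ?P {\<omega>. y \<le> real (last_passage \<omega> m n)}"
    using boundary_pmf_shifted_last_passage[of 0 m m 0 n n a b z y] by simp
  also have "\<dots> \<le> measure_pmf.prob ?P {\<omega> \<in> space ?P. y \<le> real (boundary_lpp \<omega> m n)}"
    using last_passage_le_boundary_lpp[OF mn]
    by (intro measure_pmf.finite_measure_mono) (auto intro: order_trans of_nat_mono)
  also have "\<dots> \<le> measure_pmf.expectation ?P (\<lambda>\<omega>. real (boundary_lpp \<omega> m n)) / y"
    using f h' \<open>0 < y\<close>
    by (intro integral_Markov_inequality_measure[where A = "{}"])
       (auto simp: blpp nonneg add_nonneg_nonneg simp del: of_nat_sum)
  also have "measure_pmf.expectation ?P (\<lambda>\<omega>. real (boundary_lpp \<omega> m n)) =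
      (\<Sum>i\<in>{0<..m}. (a i / z) / (1 - a i / z)) + (\<Sum>j\<in>{0<..n}. (b j * z) / (1 - b j * z))"
    unfolding blpp using f h h' Ef Eh by simp
  finally show ?thesis
    using \<open>0 < y\<close> by (simp add: field_simps)
qed

section \<open>Exit points\<close>

text \<open>Exit points are grouped into finitely many blocks, so that a union bound over blocks does not
  grow with the size of the rectangle.\<close>

lemma block_containing:
  fixes k :: "nat \<Rightarrow> nat"
  assumes "k 0 = 0" "k R = m" "0 < i" "i \<le> m"
  obtains r where "r < R" "k r < i" "i \<le> k (Suc r)"
proof -
  define q where "q = (LEAST q. i \<le> k q)"
  have q: "i \<le> k q" "q \<le> R"
    unfolding q_def using assms by (auto intro: LeastI[of _ R] Least_le)
  have less: "k r < i" if "r < q" for r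
    using that not_less_Least[of r "\<lambda>q. i \<le> k q"] by (simp add: q_def not_le)
  obtain r where "q = Suc r"
    using q assms by (cases q) auto
  with q less[of r] that[of r] show ?thesis by auto
qed

text \<open>In block \<open>r\<close> the axis contributes at most the boundary weights up to the end of the block, and
  the interior path at most the last-passage time started at its beginning. If together they reach \<open>y\<close>,
  the first reaches \<open>x r\<close> or the second \<open>y - x r\<close>.\<close>

lemma exit_union_bound:
  assumes mn: "1 \<le> m" "1 \<le> n"
    and k: "k 0 = 0" "k R = m" "\<And>r. r < R \<Longrightarrow> k r < m"
    and l: "l 0 = 0" "l R = n" "\<And>r. r < R \<Longrightarrow> l r < n"
  shows "measure_pmf.prob (boundary_pmf a b z m n) {\<omega>. y \<le> real (boundary_lpp \<omega> m n)} \<le>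
    (\<Sum>r<R. measure_pmf.prob (boundary_pmf a b z m n) {\<omega>. x r \<le> real (\<Sum>i\<in>{0<..k (Suc r)}. \<omega> (i, 0))}
        + quenched_tail (\<lambda>i. a (i + k r)) b (m - k r) n (y - x r)) +
    (\<Sum>r<R. measure_pmf.prob (boundary_pmf a b z m n) {\<omega>. w r \<le> real (\<Sum>j\<in>{0<..l (Suc r)}. \<omega> (0, j))}
        + quenched_tail a (\<lambda>j. b (j + l r)) m (n - l r) (y - w r))"
proof -
  let ?P = "boundary_pmf a b z m n"
  define E1 where "E1 = (\<lambda>r. {\<omega> :: nat \<times> nat \<Rightarrow> nat. x r \<le> real (\<Sum>i\<in>{0<..k (Suc r)}. \<omega> (i, 0))})"
  define E2 where "E2 = (\<lambda>r. {\<omega> :: nat \<times> nat \<Rightarrow> nat.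
    y - x r \<le> real (last_passage (\<lambda>(i, j). \<omega> (i + k r, j + 0)) (m - k r) n)})"
  define F1 where "F1 = (\<lambda>r. {\<omega> :: nat \<times> nat \<Rightarrow> nat. w r \<le> real (\<Sum>j\<in>{0<..l (Suc r)}. \<omega> (0, j))})"
  define F2 where "F2 = (\<lambda>r. {\<omega> :: nat \<times> nat \<Rightarrow> nat.
    y - w r \<le> real (last_passage (\<lambda>(i, j). \<omega> (i + 0, j + l r)) m (n - l r))})"
  have E2: "measure_pmf.prob ?P (E2 r) = quenched_tail (\<lambda>i. a (i + k r)) b (m - k r) n (y - x r)"
    if "r < R" for r
    unfolding E2_def using k(3)[OF that]
    by (subst boundary_pmf_shifted_last_passage) auto
  have F2: "measure_pmf.prob ?P (F2 r) = quenched_tail a (\<lambda>j. b (j + l r)) m (n - l r) (y - w r)"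
    if "r < R" for r
    unfolding F2_def using l(3)[OF that]
    by (subst boundary_pmf_shifted_last_passage) auto
  have sub: "{\<omega>. y \<le> real (boundary_lpp \<omega> m n)} \<subseteq> (\<Union>r<R. E1 r \<union> E2 r) \<union> (\<Union>r<R. F1 r \<union> F2 r)"
  proof
    fix \<omega> :: "nat \<times> nat \<Rightarrow> nat"
    assume "\<omega> \<in> {\<omega>. y \<le> real (boundary_lpp \<omega> m n)}"
    then have y: "y \<le> real (boundary_lpp \<omega> m n)" by simp
    from boundary_lpp_exit_path[OF mn, of \<omega>]
    show "\<omega> \<in> (\<Union>r<R. E1 r \<union> E2 r) \<union> (\<Union>r<R. F1 r \<union> F2 r)"
    proof (elim disjE bexE exE conjE)
      fix i \<pi>
      assume i: "i \<in> {1..m}" and \<pi>: "directed_path (i, 1) (m, n) \<pi>"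
        and eq: "boundary_lpp \<omega> m n = (\<Sum>l\<in>{0<..i}. \<omega> (l, 0)) + (\<Sum>p\<leftarrow>\<pi>. \<omega> p)"
      obtain r where r: "r < R" "k r < i" "i \<le> k (Suc r)"
        using block_containing[OF k(1,2), of i] i by auto
      have "(\<Sum>p\<leftarrow>\<pi>. \<omega> p) \<le> last_passage (\<lambda>(i, j). \<omega> (i + k r, j + 0)) (m - k r) n"
        using \<pi> r(2) k(3)[OF r(1)] by (intro path_sum_le_shifted_last_passage[of i 1]) auto
      moreover have "(\<Sum>l\<in>{0<..i}. \<omega> (l, 0)) \<le> (\<Sum>l\<in>{0<..k (Suc r)}. \<omega> (l, 0))"
        using r by (intro sum_mono2) auto
      ultimately have "boundary_lpp \<omega> m n \<le> (\<Sum>l\<in>{0<..k (Suc r)}. \<omega> (l, 0)) +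
          last_passage (\<lambda>(i, j). \<omega> (i + k r, j + 0)) (m - k r) n"
        unfolding eq by (intro add_mono)
      then have "real (boundary_lpp \<omega> m n) \<le> real (\<Sum>l\<in>{0<..k (Suc r)}. \<omega> (l, 0)) +
          real (last_passage (\<lambda>(i, j). \<omega> (i + k r, j + 0)) (m - k r) n)"
        unfolding of_nat_add[symmetric] by (rule of_nat_mono)
      with y have "y \<le> real (\<Sum>l\<in>{0<..k (Suc r)}. \<omega> (l, 0)) +
          real (last_passage (\<lambda>(i, j). \<omega> (i + k r, j + 0)) (m - k r) n)"
        by (rule order_trans)
      then have "\<omega> \<in> E1 r \<union> E2 r"
        by (auto simp: E1_def E2_def)
      then show ?thesis using r(1) by blast
    next
      fix i \<pi>
      assume i: "i \<in> {1..n}" and \<pi>: "directed_path (1, i) (m, n) \<pi>"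
        and eq: "boundary_lpp \<omega> m n = (\<Sum>l\<in>{0<..i}. \<omega> (0, l)) + (\<Sum>p\<leftarrow>\<pi>. \<omega> p)"
      obtain r where r: "r < R" "l r < i" "i \<le> l (Suc r)"
        using block_containing[OF l(1,2), of i] i by auto
      have "(\<Sum>p\<leftarrow>\<pi>. \<omega> p) \<le> last_passage (\<lambda>(i, j). \<omega> (i + 0, j + l r)) m (n - l r)"
        using \<pi> r(2) l(3)[OF r(1)] by (intro path_sum_le_shifted_last_passage[of 1 i]) auto
      moreover have "(\<Sum>l\<in>{0<..i}. \<omega> (0, l)) \<le> (\<Sum>l\<in>{0<..l (Suc r)}. \<omega> (0, l))"
        using r by (intro sum_mono2) auto
      ultimately have "boundary_lpp \<omega> m n \<le> (\<Sum>j\<in>{0<..l (Suc r)}. \<omega> (0, j)) +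
          last_passage (\<lambda>(i, j). \<omega> (i + 0, j + l r)) m (n - l r)"
        unfolding eq by (intro add_mono)
      then have "real (boundary_lpp \<omega> m n) \<le> real (\<Sum>j\<in>{0<..l (Suc r)}. \<omega> (0, j)) +
          real (last_passage (\<lambda>(i, j). \<omega> (i + 0, j + l r)) m (n - l r))"
        unfolding of_nat_add[symmetric] by (rule of_nat_mono)
      with y have "y \<le> real (\<Sum>j\<in>{0<..l (Suc r)}. \<omega> (0, j)) +
          real (last_passage (\<lambda>(i, j). \<omega> (i + 0, j + l r)) m (n - l r))"
        by (rule order_trans)
      then have "\<omega> \<in> F1 r \<union> F2 r"
        by (auto simp: F1_def F2_def)
      then show ?thesis using r(1) by blast
    qed
  qed
  have union: "measure_pmf.prob ?P (\<Union>r<R. G r \<union> H r) \<le>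
      (\<Sum>r<R. measure_pmf.prob ?P (G r) + measure_pmf.prob ?P (H r))" for G H
  proof -
    have "measure_pmf.prob ?P (\<Union>r<R. G r \<union> H r) \<le> (\<Sum>r<R. measure_pmf.prob ?P (G r \<union> H r))"
      by (intro measure_pmf.finite_measure_subadditive_finite) auto
    also have "\<dots> \<le> (\<Sum>r<R. measure_pmf.prob ?P (G r) + measure_pmf.prob ?P (H r))"
      by (intro sum_mono measure_Un_le) auto
    finally show ?thesis .
  qed
  have "measure_pmf.prob ?P {\<omega>. y \<le> real (boundary_lpp \<omega> m n)} \<le>
      measure_pmf.prob ?P ((\<Union>r<R. E1 r \<union> E2 r) \<union> (\<Union>r<R. F1 r \<union> F2 r))"
    using sub by (intro measure_pmf.finite_measure_mono) auto
  also have "\<dots> \<le> measure_pmf.prob ?P (\<Union>r<R. E1 r \<union> E2 r) + measure_pmf.prob ?P (\<Union>r<R. F1 r \<union> F2 r)"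
    by (intro measure_Un_le) auto
  also have "\<dots> \<le> (\<Sum>r<R. measure_pmf.prob ?P (E1 r) + measure_pmf.prob ?P (E2 r)) +
      (\<Sum>r<R. measure_pmf.prob ?P (F1 r) + measure_pmf.prob ?P (F2 r))"
    by (intro add_mono union)
  also have "(\<Sum>r<R. measure_pmf.prob ?P (E1 r) + measure_pmf.prob ?P (E2 r)) =
      (\<Sum>r<R. measure_pmf.prob ?P (E1 r) + quenched_tail (\<lambda>i. a (i + k r)) b (m - k r) n (y - x r))"
    by (intro sum.cong refl) (simp add: E2)
  also have "(\<Sum>r<R. measure_pmf.prob ?P (F1 r) + measure_pmf.prob ?P (F2 r)) =
      (\<Sum>r<R. measure_pmf.prob ?P (F1 r) + quenched_tail a (\<lambda>j. b (j + l r)) m (n - l r) (y - w r))"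
    by (intro sum.cong refl) (simp add: F2)
  finally show ?thesis
    unfolding E1_def F1_def .
qed

lemma boundary_lpp_lower_tail:
  assumes "params_upto \<alpha> a" "params_upto \<beta> b" "\<alpha> < z" "\<beta> * z < 1"
  shows "1 - measure_pmf.prob (boundary_pmf a b z m n) {\<omega>. real (\<Sum>j\<in>{0<..n}. \<omega> (0, j)) \<le> y1}
      - measure_pmf.prob (boundary_pmf a b z m n) {\<omega>. real (\<Sum>i\<in>{0<..m}. \<omega> (i, 0)) \<le> y2}
    \<le> measure_pmf.prob (boundary_pmf a b z m n) {\<omega>. y1 + y2 \<le> real (boundary_lpp \<omega> m n)}"
proof -
  let ?P = "boundary_pmf a b z m n"
  let ?E = "{\<omega> :: nat \<times> nat \<Rightarrow> nat. y1 + y2 \<le> real (boundary_lpp \<omega> m n)}"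
  let ?F1 = "{\<omega> :: nat \<times> nat \<Rightarrow> nat. real (\<Sum>j\<in>{0<..n}. \<omega> (0, j)) \<le> y1}"
  let ?F2 = "{\<omega> :: nat \<times> nat \<Rightarrow> nat. real (\<Sum>i\<in>{0<..m}. \<omega> (i, 0)) \<le> y2}"
  have "UNIV = ?E \<union> (?F1 \<union> burke_sweep m n -` ?F2)"
    unfolding boundary_lpp_sweep of_nat_add vimage_Collect_eq by (auto simp del: of_nat_sum)
  then have "1 = measure_pmf.prob ?P (?E \<union> (?F1 \<union> burke_sweep m n -` ?F2))"
    by (metis measure_pmf.prob_space space_measure_pmf)
  also have "\<dots> \<le> measure_pmf.prob ?P ?E + measure_pmf.prob ?P (?F1 \<union> burke_sweep m n -` ?F2)"
    by (intro measure_Un_le) auto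
  also have "\<dots> \<le> measure_pmf.prob ?P ?E +
      (measure_pmf.prob ?P ?F1 + measure_pmf.prob ?P (burke_sweep m n -` ?F2))"
    by (intro add_left_mono measure_Un_le) auto
  also have "measure_pmf.prob ?P (burke_sweep m n -` ?F2) = measure_pmf.prob ?P ?F2"
    unfolding measure_map_pmf[symmetric] boundary_sweep_law[OF assms] ..
  finally show ?thesis
    by (simp only: diff_diff_eq diff_le_eq)
qed

section \<open>Asymptotics along a fixed environment\<close>

definition scaled :: "real \<Rightarrow> nat \<Rightarrow> nat" where
  "scaled s N = nat \<lfloor>real N * s\<rfloor>"

lemma scaled_mono: "s \<le> s' \<Longrightarrow> scaled s N \<le> scaled s' N"
  by (auto simp: scaled_def intro!: nat_mono floor_mono mult_left_mono)

lemma scaled_bounds: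
  assumes "0 \<le> s"
  shows "s * real N - 1 \<le> real (scaled s N)" "real (scaled s N) \<le> s * real N"
proof -
  have "0 \<le> real N * s" using assms by simp
  then show "s * real N - 1 \<le> real (scaled s N)" "real (scaled s N) \<le> s * real N"
    unfolding scaled_def mult.commute[of s] by linarith+
qed

lemma tendsto_scaled:
  assumes "0 \<le> s"
  shows "(\<lambda>N. real (scaled s N) / real N) \<longlonglongrightarrow> s"
proof (rule tendsto_sandwich)
  show "(\<lambda>N. s - 1 / real N) \<longlonglongrightarrow> s"
    using tendsto_diff[OF tendsto_const[of s] lim_1_over_n] by simp
  show "(\<lambda>N. s) \<longlonglongrightarrow> s" by simp
  show "\<forall>\<^sub>F N in sequentially. s - 1 / real N \<le> real (scaled s N) / real N"
    using eventually_gt_at_top[of 0]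
    by eventually_elim
       (use scaled_bounds(1)[OF assms] in \<open>simp add: pos_le_divide_eq left_diff_distrib\<close>)
  show "\<forall>\<^sub>F N in sequentially. real (scaled s N) / real N \<le> s"
    using eventually_gt_at_top[of 0]
    by eventually_elim (use scaled_bounds(2)[OF assms] in \<open>simp add: pos_divide_le_eq\<close>)
qed

lemma eventually_scaled_ge:
  assumes "0 < s"
  shows "\<forall>\<^sub>F N in sequentially. k \<le> scaled s N"
proof -
  have "filterlim (\<lambda>N. s * real N) at_top sequentially"
    using assms by (intro filterlim_tendsto_pos_mult_at_top[OF tendsto_const] filterlim_real_sequentially)
  then have "\<forall>\<^sub>F N in sequentially. real k \<le> s * real N"
    by (simp add: filterlim_at_top)
  then show ?thesis
    by eventually_elim (simp add: scaled_def le_nat_iff le_floor_iff mult.commute)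
qed

text \<open>Cesaro averages along an index of linear growth. The limit \<open>\<theta> = 0\<close> is included, where the
  index need not tend to infinity.\<close>

lemma tendsto_partial_sums_along:
  fixes c :: "nat \<Rightarrow> real"
  assumes avg: "(\<lambda>n. (\<Sum>i\<in>{0<..n}. c i) / real n) \<longlonglongrightarrow> A"
    and \<kappa>: "(\<lambda>N. real (\<kappa> N) / real N) \<longlonglongrightarrow> \<theta>"
  shows "(\<lambda>N. (\<Sum>i\<in>{0<..\<kappa> N}. c i) / real N) \<longlonglongrightarrow> \<theta> * A"
proof -
  let ?avg = "\<lambda>n. (\<Sum>i\<in>{0<..n}. c i) / real n"
  have eq: "(\<Sum>i\<in>{0<..\<kappa> N}. c i) / real N = real (\<kappa> N) / real N * ?avg (\<kappa> N)" for N
    by (cases "\<kappa> N = 0") auto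
  have "0 \<le> \<theta>"
    using \<kappa> by (rule tendsto_lowerbound) auto
  then consider "\<theta> = 0" | "0 < \<theta>" by linarith
  then show ?thesis
  proof cases
    case 1
    have "Bseq ?avg"
      by (intro convergent_imp_Bseq convergentI[OF avg])
    then obtain K where K: "\<And>n. norm (?avg n) \<le> K"
      unfolding Bseq_def by blast
    have "(\<lambda>N. real (\<kappa> N) / real N * ?avg (\<kappa> N)) \<longlonglongrightarrow> 0"
    proof (rule Lim_null_comparison)
      show "\<forall>\<^sub>F N in sequentially. norm (real (\<kappa> N) / real N * ?avg (\<kappa> N)) \<le> real (\<kappa> N) / real N * K"
        unfolding norm_mult using K by (intro always_eventually allI mult_mono) auto
      show "(\<lambda>N. real (\<kappa> N) / real N * K) \<longlonglongrightarrow> 0"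
        using tendsto_mult_left_zero \<kappa> 1 by blast
    qed
    then show ?thesis unfolding eq using 1 by simp
  next
    case 2
    have product: "filterlim (\<lambda>N. real (\<kappa> N) / real N * real N) at_top sequentially"
      using 2 \<kappa> by (intro filterlim_tendsto_pos_mult_at_top filterlim_real_sequentially)
    have "\<forall>\<^sub>F N in sequentially. real (\<kappa> N) / real N * real N = real (\<kappa> N)"
      using eventually_gt_at_top[of 0] by eventually_elim simp
    from iffD1[OF filterlim_cong[OF refl refl this] product]
    have "filterlim (\<lambda>N. real (\<kappa> N)) at_top sequentially" .
    then have "filterlim \<kappa> at_top sequentially"
      by (simp add: filterlim_sequentially_iff_filterlim_real)
    from filterlim_compose[OF avg this] show ?thesis
      unfolding eq using \<kappa> by (intro tendsto_mult)
  qed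
qed


lemma sum_image_left: "(\<Sum>x\<in>(\<lambda>i. (i, 0::nat)) ` A. f x) = (\<Sum>i\<in>A. f (i, 0))"
  by (subst sum.reindex) (auto simp: inj_on_def)

lemma sum_image_right: "(\<Sum>x\<in>Pair c ` A. f x) = (\<Sum>j\<in>A. f (c, j))"
  by (subst sum.reindex) (auto simp: inj_on_def)

lemma lower_tail_subset:
  fixes f :: "'b \<Rightarrow> real"
  shows "{x. f x \<le> n * (c - d)} \<subseteq> {x. n * d \<le> \<bar>f x - n * c\<bar>}"
proof (intro Collect_mono impI)
  fix x assume "f x \<le> n * (c - d)"
  with abs_ge_minus_self[of "f x - n * c"] show "n * d \<le> \<bar>f x - n * c\<bar>"
    by (simp add: right_diff_distrib)
qed

lemma upper_tail_subset:
  fixes f :: "'b \<Rightarrow> real"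
  shows "{x. n * (c + d) \<le> f x} \<subseteq> {x. n * d \<le> \<bar>f x - n * c\<bar>}"
proof (intro Collect_mono impI)
  fix x assume "n * (c + d) \<le> f x"
  with abs_ge_self[of "f x - n * c"] show "n * d \<le> \<bar>f x - n * c\<bar>"
    by (simp add: distrib_left)
qed

lemma pmf_prob_tendsto_0_mono:
  assumes "(\<lambda>N. measure_pmf.prob (P N) (E N)) \<longlonglongrightarrow> 0" "\<forall>\<^sub>F N in sequentially. D N \<subseteq> E N"
  shows "(\<lambda>N. measure_pmf.prob (P N) (D N)) \<longlonglongrightarrow> 0"
proof (rule tendsto_sandwich[OF _ _ tendsto_const assms(1)])
  show "\<forall>\<^sub>F N in sequentially. measure_pmf.prob (P N) (D N) \<le> measure_pmf.prob (P N) (E N)"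
    using assms(2) by eventually_elim (intro measure_pmf.finite_measure_mono, auto)
qed auto

text \<open>The law of large numbers for the boundary weights combines the fluctuation bound for fixed
  parameters with the convergence of the conditional means.\<close>

lemma boundary_bottom_concentration:
  assumes ab: "params_upto \<alpha> a" "params_upto \<beta> b" and z: "\<alpha> < z" "\<beta> * z < 1"
    and \<kappa>: "\<And>N. \<kappa> N \<le> m N" "\<And>N. real (m N) \<le> K * real N"
    and lim: "(\<lambda>N. (\<Sum>i\<in>{0<..\<kappa> N}. (a i / z) / (1 - a i / z)) / real N) \<longlonglongrightarrow> c"
    and \<delta>: "0 < \<delta>"
  shows "(\<lambda>N. measure_pmf.prob (boundary_pmf a b z (m N) (n N))
     {\<omega>. real N * \<delta> \<le> \<bar>real (\<Sum>i\<in>{0<..\<kappa> N}. \<omega> (i, 0)) - real N * c\<bar>}) \<longlonglongrightarrow> 0"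
proof (rule pmf_prob_tendsto_0_mono)
  let ?mean = "\<lambda>N. \<Sum>i\<in>{0<..\<kappa> N}. (a i / z) / (1 - a i / z)"
  have "(\<lambda>N. measure_pmf.prob (boundary_pmf a b z (m N) (n N))
     {\<omega>. real N * (\<delta> / 2) \<le> \<bar>real (\<Sum>x\<in>(\<lambda>i. (i, 0)) ` {0<..\<kappa> N}. \<omega> x) -
        (\<Sum>x\<in>(\<lambda>i. (i, 0)) ` {0<..\<kappa> N}. boundary_param a b z x / (1 - boundary_param a b z x))\<bar>}) \<longlonglongrightarrow> 0"
  proof (rule geo_sum_concentration)
    show "0 \<le> boundary_param a b z x \<and> boundary_param a b z x \<le> max (\<alpha> / z) (\<beta> * z)"
      if "x \<in> boundary_sites (m N) (n N)" for N x
      using boundary_param_bounds[OF ab z that] by auto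
    show "0 \<le> max (\<alpha> / z) (\<beta> * z)" "max (\<alpha> / z) (\<beta> * z) < 1"
      using boundary_max_less_1[OF params_upto_pos[OF ab(1)] z] by auto
    show "(\<lambda>i. (i, 0)) ` {0<..\<kappa> N} \<subseteq> boundary_sites (m N) (n N)" for N
      using \<kappa>(1)[of N] by (auto simp: boundary_sites_def)
    show "real (card ((\<lambda>i. (i, 0::nat)) ` {0<..\<kappa> N})) \<le> K * real N" for N
    proof -
      have "real (card ((\<lambda>i. (i, 0::nat)) ` {0<..\<kappa> N})) = real (\<kappa> N)"
        by (subst card_image) (auto simp: inj_on_def)
      then show ?thesis
        using \<kappa>[of N] by linarith
    qed
  qed (use \<delta> in auto)
  then show "(\<lambda>N. measure_pmf.prob (boundary_pmf a b z (m N) (n N))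
     {\<omega>. real N * (\<delta> / 2) \<le> \<bar>real (\<Sum>i\<in>{0<..\<kappa> N}. \<omega> (i, 0)) - ?mean N\<bar>}) \<longlonglongrightarrow> 0"
    unfolding sum_image_left by (simp add: boundary_param_def)
  have "\<forall>\<^sub>F N in sequentially. dist (?mean N / real N) c < \<delta> / 2"
    using lim \<delta> by (intro tendstoD) auto
  then show "\<forall>\<^sub>F N in sequentially.
      {\<omega>. real N * \<delta> \<le> \<bar>real (\<Sum>i\<in>{0<..\<kappa> N}. \<omega> (i, 0)) - real N * c\<bar>} \<subseteq>
      {\<omega>. real N * (\<delta> / 2) \<le> \<bar>real (\<Sum>i\<in>{0<..\<kappa> N}. \<omega> (i, 0)) - ?mean N\<bar>}"
    using eventually_gt_at_top[of 0]
  proof eventually_elim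
    case (elim N)
    define x where "x = ?mean N"
    have "\<bar>x - real N * c\<bar> = real N * \<bar>x / real N - c\<bar>"
      using elim(2) by (simp add: abs_mult[symmetric, of "real N", simplified] right_diff_distrib)
    also have "\<dots> \<le> real N * (\<delta> / 2)"
      using elim by (intro mult_left_mono) (auto simp: dist_real_def x_def)
    finally have x: "\<bar>x - real N * c\<bar> \<le> real N * (\<delta> / 2)" .
    have "real N * (\<delta> / 2) \<le> \<bar>y - x\<bar>" if "real N * \<delta> \<le> \<bar>y - real N * c\<bar>" for y
      using that x by (simp add: abs_if split: if_splits)
    then show ?case
      unfolding x_def by blast
  qed
qed

text \<open>Transposing the sites exchanges \<open>a\<close> with \<open>b\<close> and \<open>z\<close> with \<open>1 / z\<close>.\<close>

lemma boundary_pmf_left_prob: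
  assumes "0 < z"
  shows "measure_pmf.prob (boundary_pmf a b z m n) {\<omega>. Q (\<lambda>j. \<omega> (0, j))} =
    measure_pmf.prob (boundary_pmf b a (1 / z) n m) {\<omega>. Q (\<lambda>j. \<omega> (j, 0))}"
proof -
  let ?T = "\<lambda>\<omega> x. if x \<in> boundary_sites n m then \<omega> (prod.swap x) else 0 :: nat"
  have "map_pmf ?T (boundary_pmf a b z m n) =
      Pi_pmf (boundary_sites n m) 0 (\<lambda>x. geo (boundary_param a b z (prod.swap x)))"
    by (rule map_Pi_pmf_reindex) (auto simp: boundary_sites_def)
  also have "\<dots> = boundary_pmf b a (1 / z) n m"
  proof (intro Pi_pmf_cong refl)
    fix x assume "x \<in> boundary_sites n m"
    then have "boundary_param a b z (prod.swap x) = boundary_param b a (1 / z) x"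
      by (cases x) (auto simp: boundary_sites_def boundary_param_def mult_ac)
    then show "geo (boundary_param a b z (prod.swap x)) = geo (boundary_param b a (1 / z) x)"
      by simp
  qed
  finally have law: "map_pmf ?T (boundary_pmf a b z m n) = boundary_pmf b a (1 / z) n m" .
  let ?E = "{\<omega>. Q (\<lambda>j. \<omega> (j, 0))}"
  have transposed: "measure_pmf.prob (boundary_pmf b a (1 / z) n m) ?E =
      measure_pmf.prob (boundary_pmf a b z m n) (?T -` ?E)"
    using measure_map_pmf[of ?T "boundary_pmf a b z m n" ?E] unfolding law .
  have agree: "\<omega> \<in> {\<omega>. Q (\<lambda>j. \<omega> (0, j))} \<longleftrightarrow> \<omega> \<in> ?T -` ?E"
    if "pmf (boundary_pmf a b z m n) \<omega> \<noteq> 0" for \<omega>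
  proof -
    have "\<omega> x = 0" if "x \<notin> boundary_sites m n" for x
      using \<open>pmf _ \<omega> \<noteq> 0\<close> that pmf_Pi_outside[OF finite_boundary_sites] by metis
    then have "?T \<omega> (j, 0) = \<omega> (0, j)" for j
      by (auto simp: boundary_sites_def)
    then show ?thesis
      by simp
  qed
  have "measure_pmf.prob (boundary_pmf a b z m n) {\<omega>. Q (\<lambda>j. \<omega> (0, j))} =
      measure_pmf.prob (boundary_pmf a b z m n) (?T -` ?E)"
    by (rule measure_prob_cong_0) (use agree in blast)+
  then show ?thesis
    unfolding transposed .
qed

lemma boundary_left_concentration:
  assumes ab: "params_upto \<alpha> a" "params_upto \<beta> b" and z: "\<alpha> < z" "\<beta> * z < 1"
    and \<kappa>: "\<And>N. \<kappa> N \<le> n N" "\<And>N. real (n N) \<le> K * real N"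
    and lim: "(\<lambda>N. (\<Sum>j\<in>{0<..\<kappa> N}. (b j * z) / (1 - b j * z)) / real N) \<longlonglongrightarrow> c"
    and \<delta>: "0 < \<delta>"
  shows "(\<lambda>N. measure_pmf.prob (boundary_pmf a b z (m N) (n N))
     {\<omega>. real N * \<delta> \<le> \<bar>real (\<Sum>j\<in>{0<..\<kappa> N}. \<omega> (0, j)) - real N * c\<bar>}) \<longlonglongrightarrow> 0"
proof -
  have "0 < z" using params_upto_pos[OF ab(1)] z by simp
  then have "\<beta> < 1 / z" "\<alpha> * (1 / z) < 1" using z by (auto simp: field_simps)
  from boundary_bottom_concentration[OF ab(2,1) this \<kappa> _ \<delta>, of c m] lim show ?thesis
    by (subst boundary_pmf_left_prob[OF \<open>0 < z\<close>,
          where Q = "\<lambda>f. real N * \<delta> \<le> \<bar>real (\<Sum>j\<in>{0<..\<kappa> N}. f j) - real N * c\<bar>" for N]) simp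
qed

text \<open>The exit columns are cut at distance \<open>\<lfloor>N s (1 - r / R)\<rfloor>\<close> from the right edge, so that the
  rectangles beyond the cuts have exactly the sizes at which the shape function is a limit.\<close>

definition exit_cut :: "real \<Rightarrow> nat \<Rightarrow> nat \<Rightarrow> nat \<Rightarrow> nat" where
  "exit_cut s R r N = scaled s N - scaled (s * (1 - r / R)) N"

lemma exit_cut_limit:
  assumes "0 < s" "r \<le> R" "0 < R"
  shows "(\<lambda>N. real (exit_cut s R r N) / real N) \<longlonglongrightarrow> s * (r / R)"
proof -
  have r: "0 \<le> real r / real R" "real r / real R \<le> 1"
    using assms by auto
  have le: "scaled (s * (1 - r / R)) N \<le> scaled s N" for N
    using assms r by (intro scaled_mono) (auto simp: algebra_simps)
  have "(\<lambda>N. real (scaled s N) / real N - real (scaled (s * (1 - r / R)) N) / real N)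
      \<longlonglongrightarrow> s - s * (1 - r / R)"
    using assms r by (intro tendsto_diff tendsto_scaled) auto
  then show ?thesis
    using le by (simp add: exit_cut_def of_nat_diff diff_divide_distrib right_diff_distrib)
qed

text \<open>The time with boundary exceeds \<open>N (s A + t B - \<delta>)\<close> with high probability, and the boundary
  weights in a block rarely exceed their mean by \<open>N \<delta>\<close>. The union bound over exit blocks thus forces
  one of the interior last-passage times to be large.\<close>

lemma exit_points_liminf:
  fixes A B s t z \<delta> :: real
  assumes ab: "params_upto \<alpha> a" "params_upto \<beta> b" and z: "\<alpha> < z" "\<beta> * z < 1"
    and A: "(\<lambda>n. (\<Sum>i\<in>{0<..n}. (a i / z) / (1 - a i / z)) / real n) \<longlonglongrightarrow> A"
    and B: "(\<lambda>n. (\<Sum>j\<in>{0<..n}. (b j * z) / (1 - b j * z)) / real n) \<longlonglongrightarrow> B"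
    and st: "0 < s" "0 < t" and R: "0 < R" and \<delta>: "0 < \<delta>" and \<epsilon>: "0 < \<epsilon>"
  shows "\<forall>\<^sub>F N in sequentially. 1 - \<epsilon> \<le>
    (\<Sum>r<R. quenched_tail (\<lambda>i. a (i + exit_cut s R r N)) b (scaled (s * (1 - r / R)) N) (scaled t N)
        (real N * (s * A + t * B - s * (Suc r / R) * A - 2 * \<delta>))) +
    (\<Sum>r<R. quenched_tail a (\<lambda>j. b (j + exit_cut t R r N)) (scaled s N) (scaled (t * (1 - r / R)) N)
        (real N * (s * A + t * B - t * (Suc r / R) * B - 2 * \<delta>)))"
proof -
  let ?P = "\<lambda>N. boundary_pmf a b z (scaled s N) (scaled t N)"
  define p1 where "p1 = (\<lambda>N. measure_pmf.prob (?P N)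
    {\<omega>. real (\<Sum>j\<in>{0<..scaled t N}. \<omega> (0, j)) \<le> real N * (t * B - \<delta> / 2)})"
  define p2 where "p2 = (\<lambda>N. measure_pmf.prob (?P N)
    {\<omega>. real (\<Sum>i\<in>{0<..scaled s N}. \<omega> (i, 0)) \<le> real N * (s * A - \<delta> / 2)})"
  define q1 where "q1 = (\<lambda>r N. measure_pmf.prob (?P N)
    {\<omega>. real N * (s * (Suc r / R) * A + \<delta>) \<le> real (\<Sum>i\<in>{0<..exit_cut s R (Suc r) N}. \<omega> (i, 0))})"
  define q2 where "q2 = (\<lambda>r N. measure_pmf.prob (?P N)
    {\<omega>. real N * (t * (Suc r / R) * B + \<delta>) \<le> real (\<Sum>j\<in>{0<..exit_cut t R (Suc r) N}. \<omega> (0, j))})"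
  have floor: "(\<lambda>N. real (scaled s N) / real N) \<longlonglongrightarrow> s" "(\<lambda>N. real (scaled t N) / real N) \<longlonglongrightarrow> t"
    using st by (auto intro: tendsto_scaled)
  have le: "real (scaled s N) \<le> s * real N" "real (scaled t N) \<le> t * real N" for N
    using st by (auto intro: scaled_bounds)
  have p1: "p1 \<longlonglongrightarrow> 0"
    unfolding p1_def
  proof (rule pmf_prob_tendsto_0_mono[OF
      boundary_left_concentration[OF ab z order_refl le(2) tendsto_partial_sums_along[OF B floor(2)], of "\<delta> / 2"]])
    show "0 < \<delta> / 2" using \<delta> by simp
  qed (intro always_eventually allI lower_tail_subset)
  have p2: "p2 \<longlonglongrightarrow> 0"
    unfolding p2_def
  proof (rule pmf_prob_tendsto_0_mono[OF
      boundary_bottom_concentration[OF ab z order_refl le(1) tendsto_partial_sums_along[OF A floor(1)], of "\<delta> / 2"]])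
    show "0 < \<delta> / 2" using \<delta> by simp
  qed (intro always_eventually allI lower_tail_subset)
  have exit_cut_le: "exit_cut s R r N \<le> scaled s N" for s r N
    by (simp add: exit_cut_def)
  have q1: "q1 r \<longlonglongrightarrow> 0" if "r < R" for r
    unfolding q1_def
  proof (rule pmf_prob_tendsto_0_mono[OF
      boundary_bottom_concentration[OF ab z exit_cut_le le(1) _ \<delta>]])
    show "(\<lambda>N. (\<Sum>i\<in>{0<..exit_cut s R (Suc r) N}. (a i / z) / (1 - a i / z)) / real N)
        \<longlonglongrightarrow> s * (Suc r / R) * A"
      using that st by (intro tendsto_partial_sums_along[OF A exit_cut_limit]) auto
  qed (intro always_eventually allI upper_tail_subset)
  have q2: "q2 r \<longlonglongrightarrow> 0" if "r < R" for r
    unfolding q2_def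
  proof (rule pmf_prob_tendsto_0_mono[OF
      boundary_left_concentration[OF ab z exit_cut_le le(2) _ \<delta>]])
    show "(\<lambda>N. (\<Sum>j\<in>{0<..exit_cut t R (Suc r) N}. (b j * z) / (1 - b j * z)) / real N)
        \<longlonglongrightarrow> t * (Suc r / R) * B"
      using that st by (intro tendsto_partial_sums_along[OF B exit_cut_limit]) auto
  qed (intro always_eventually allI upper_tail_subset)
  have "(\<lambda>N. p1 N + p2 N + (\<Sum>r<R. q1 r N) + (\<Sum>r<R. q2 r N)) \<longlonglongrightarrow> 0 + 0 + (\<Sum>r<R. 0) + (\<Sum>r<R. 0)"
    using p1 p2 q1 q2 by (intro tendsto_add tendsto_sum) auto
  then have "\<forall>\<^sub>F N in sequentially. p1 N + p2 N + (\<Sum>r<R. q1 r N) + (\<Sum>r<R. q2 r N) < \<epsilon>"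
    using \<epsilon> by (intro order_tendstoD(2)) auto
  moreover have "\<forall>\<^sub>F N in sequentially. \<forall>r\<in>{..<R}. 1 \<le> scaled (s * (1 - r / R)) N"
    using st R
    by (intro eventually_ball_finite ballI eventually_scaled_ge) auto
  moreover have "\<forall>\<^sub>F N in sequentially. \<forall>r\<in>{..<R}. 1 \<le> scaled (t * (1 - r / R)) N"
    using st R
    by (intro eventually_ball_finite ballI eventually_scaled_ge) auto
  ultimately show ?thesis
  proof eventually_elim
    case (elim N)
    define Y where "Y = real N * (t * B - \<delta> / 2) + real N * (s * A - \<delta> / 2)"
    have bulk: "scaled (s * (1 - r / R)) N \<le> scaled s N" "scaled (t * (1 - r / R)) N \<le> scaled t N" for r :: nat
      using st by (auto intro!: scaled_mono simp: algebra_simps)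
    have Y1: "Y - real N * (s * (Suc r / R) * A + \<delta>) =
        real N * (s * A + t * B - s * (Suc r / R) * A - 2 * \<delta>)" for r
      by (simp add: Y_def algebra_simps)
    have Y2: "Y - real N * (t * (Suc r / R) * B + \<delta>) =
        real N * (s * A + t * B - t * (Suc r / R) * B - 2 * \<delta>)" for r
      by (simp add: Y_def algebra_simps)
    have m1: "scaled s N - exit_cut s R r N = scaled (s * (1 - r / R)) N"
      "scaled t N - exit_cut t R r N = scaled (t * (1 - r / R)) N" for r
      using bulk[of r] by (auto simp: exit_cut_def)
    have pos: "1 \<le> scaled s N" "1 \<le> scaled t N"
      using elim(2,3) R by (auto dest!: bspec[of _ _ 0])
    have "1 - p1 N - p2 N \<le> measure_pmf.prob (?P N)
        {\<omega>. Y \<le> real (boundary_lpp \<omega> (scaled s N) (scaled t N))}"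
      unfolding p1_def p2_def Y_def by (rule boundary_lpp_lower_tail[OF ab z])
    also have "\<dots> \<le>
      (\<Sum>r<R. measure_pmf.prob (?P N) {\<omega>. real N * (s * (Suc r / R) * A + \<delta>) \<le>
            real (\<Sum>i\<in>{0<..exit_cut s R (Suc r) N}. \<omega> (i, 0))}
          + quenched_tail (\<lambda>i. a (i + exit_cut s R r N)) b (scaled s N - exit_cut s R r N) (scaled t N)
              (Y - real N * (s * (Suc r / R) * A + \<delta>))) +
      (\<Sum>r<R. measure_pmf.prob (?P N) {\<omega>. real N * (t * (Suc r / R) * B + \<delta>) \<le>
            real (\<Sum>j\<in>{0<..exit_cut t R (Suc r) N}. \<omega> (0, j))}
          + quenched_tail a (\<lambda>j. b (j + exit_cut t R r N)) (scaled s N) (scaled t N - exit_cut t R r N)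
              (Y - real N * (t * (Suc r / R) * B + \<delta>)))"
    proof (rule exit_union_bound[OF pos])
      show "exit_cut s R 0 N = 0" "exit_cut t R 0 N = 0"
        by (auto simp: exit_cut_def)
      show "exit_cut s R R N = scaled s N" "exit_cut t R R N = scaled t N"
        using R by (auto simp: exit_cut_def scaled_def)
      show "exit_cut s R r N < scaled s N" "exit_cut t R r N < scaled t N" if "r < R" for r
        using elim(2,3) that pos by (auto simp: exit_cut_def dest!: bspec[of _ _ r])
    qed
    finally have bound: "1 - p1 N - p2 N \<le> \<dots>" .
    have combine: "1 - e \<le> v + w" if "1 - p - q \<le> (x + v) + (y + w)" "p + q + x + y < e"
      for e p q v w x y :: real
      using that by linarith
    show ?case
      by (rule combine[OF bound[unfolded m1 Y1 Y2 sum.distrib] elim(1)[unfolded q1_def q2_def]])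
  qed
qed

text \<open>A column of parameter at least \<open>\<theta>\<close> collects at least the sum of the conditional means at
  parameter \<open>\<theta>\<close>, up to a fluctuation that is small uniformly in the parameter. Uniformity matters since
  the column \<open>scaled s N\<close> moves with \<open>N\<close>.\<close>

lemma column_liminf:
  fixes s s' t t' \<theta> B x \<delta> \<epsilon> :: real
  assumes ab: "params_upto \<alpha> a" "params_upto \<beta> b" "\<alpha> * \<beta> < 1"
    and \<theta>: "0 < \<theta>" "\<theta> \<le> \<alpha>"
    and B: "(\<lambda>n. (\<Sum>j\<in>{0<..n}. (b j * \<theta>) / (1 - b j * \<theta>)) / real n) \<longlonglongrightarrow> B"
    and s: "0 < s'" "s' \<le> s" and t: "0 < t'" "t' \<le> t" and \<delta>: "0 < \<delta>" and \<epsilon>: "0 < \<epsilon>"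
  shows "\<forall>\<^sub>F N in sequentially. \<theta> \<le> a (scaled s N) \<longrightarrow>
    quenched_tail a b (scaled s' N) (scaled t' N) (real N * x) - \<epsilon> \<le>
    quenched_tail a b (scaled s N) (scaled t N) (real N * (x + (t - t') * B - \<delta>))"
proof -
  let ?S = "\<lambda>N. {1..scaled s N} \<times> {1..scaled t N}"
  let ?v = "\<lambda>(i, j). a i * b j"
  let ?P = "\<lambda>N. Pi_pmf (?S N) 0 (\<lambda>x. geo (?v x))"
  define C where "C = (\<lambda>N. Pair (scaled s N) ` {scaled t' N<..scaled t N})"
  define p where "p = (\<lambda>N. measure_pmf.prob (?P N)
    {\<omega>. real N * (\<delta> / 2) \<le> \<bar>real (\<Sum>x\<in>C N. \<omega> x) - (\<Sum>x\<in>C N. ?v x / (1 - ?v x))\<bar>})"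
  have pos: "0 < \<alpha>" "0 < \<beta>"
    using ab params_upto_pos by auto
  have st0: "0 < s" "0 < t" using s t by auto
  have v: "0 < a i * b j \<and> a i * b j \<le> \<alpha> * \<beta>" if "1 \<le> i" "1 \<le> j" for i j
    using ab(1,2) that pos by (auto simp: params_upto_def less_imp_le intro!: mult_mono)
  have ev: "\<forall>\<^sub>F N in sequentially. 1 \<le> scaled s' N \<and> 1 \<le> scaled t' N"
    using s t by (intro eventually_conj eventually_scaled_ge) auto
  have evs: "\<forall>\<^sub>F N in sequentially. 1 \<le> scaled s N"
    using st0 by (intro eventually_scaled_ge) auto
  have "(\<lambda>N. measure_pmf.prob (Pi_pmf (?S N) 0 (\<lambda>x. geo (?v x)))
    {\<omega>. real N * (\<delta> / 2) \<le> \<bar>real (\<Sum>x\<in>C N \<inter> ?S N. \<omega> x) - (\<Sum>x\<in>C N \<inter> ?S N. ?v x / (1 - ?v x))\<bar>}) \<longlonglongrightarrow> 0"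
  proof (rule geo_sum_concentration[where r = "\<alpha> * \<beta>" and K = t])
    show "0 \<le> ?v x \<and> ?v x \<le> \<alpha> * \<beta>" if "x \<in> ?S N" for N x
      using that v by (auto simp: less_imp_le)
    show "real (card (C N \<inter> ?S N)) \<le> t * real N" for N
    proof -
      have "card (C N \<inter> ?S N) \<le> card (C N)"
        by (intro card_mono) (auto simp: C_def)
      also have "\<dots> \<le> card {scaled t' N<..scaled t N}"
        unfolding C_def by (intro card_image_le) auto
      finally have "real (card (C N \<inter> ?S N)) \<le> real (scaled t N)" by simp
      also have "\<dots> \<le> t * real N"
        using st0 by (intro scaled_bounds) auto
      finally show ?thesis .
    qed
  qed (use ab pos \<delta> in auto)
  then have "p \<longlonglongrightarrow> 0"
  proof (rule Lim_transform_eventually)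
    show "\<forall>\<^sub>F N in sequentially. measure_pmf.prob (Pi_pmf (?S N) 0 (\<lambda>x. geo (?v x)))
      {\<omega>. real N * (\<delta> / 2) \<le> \<bar>real (\<Sum>x\<in>C N \<inter> ?S N. \<omega> x) - (\<Sum>x\<in>C N \<inter> ?S N. ?v x / (1 - ?v x))\<bar>} = p N"
      using evs
    proof eventually_elim
      case (elim N)
      then have "C N \<inter> ?S N = C N" by (auto simp: C_def)
      then show ?case by (simp only: p_def)
    qed
  qed
  then have "\<forall>\<^sub>F N in sequentially. p N < \<epsilon>"
    using \<epsilon> order_tendstoD(2) by blast
  moreover have "\<forall>\<^sub>F N in sequentially. (t - t') * B - \<delta> / 2 <
      (\<Sum>j\<in>{scaled t' N<..scaled t N}. (b j * \<theta>) / (1 - b j * \<theta>)) / real N"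
  proof -
    let ?sum = "\<lambda>n. \<Sum>j\<in>{0<..n}. (b j * \<theta>) / (1 - b j * \<theta>)"
    have eq: "(\<Sum>j\<in>{scaled t' N<..scaled t N}. (b j * \<theta>) / (1 - b j * \<theta>)) / real N =
        ?sum (scaled t N) / real N - ?sum (scaled t' N) / real N" for N
    proof -
      have "scaled t' N \<le> scaled t N" using t by (intro scaled_mono)
      then have "{0<..scaled t N} = {0<..scaled t' N} \<union> {scaled t' N<..scaled t N}" by auto
      then have "?sum (scaled t N) = ?sum (scaled t' N) +
          (\<Sum>j\<in>{scaled t' N<..scaled t N}. (b j * \<theta>) / (1 - b j * \<theta>))"
        by (simp add: sum.union_disjoint)
      then show ?thesis by (simp add: add_divide_distrib)
    qed
    have "(\<lambda>N. (\<Sum>j\<in>{scaled t' N<..scaled t N}. (b j * \<theta>) / (1 - b j * \<theta>)) / real N) \<longlonglongrightarrow> t * B - t' * B"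
      unfolding eq using t
      by (intro tendsto_diff tendsto_partial_sums_along[OF B]) (auto intro!: tendsto_scaled)
    then show ?thesis
      using \<delta> by (intro order_tendstoD(1)) (auto simp: left_diff_distrib)
  qed
  ultimately show ?thesis
    using ev eventually_gt_at_top[of 0]
  proof eventually_elim
    case (elim N)
    let ?M = "scaled s N"
    show ?case
    proof
      assume a: "\<theta> \<le> a ?M"
      have M: "1 \<le> ?M" using elim(3) scaled_mono[OF s(2), of N] by auto
      have mean: "real N * ((t - t') * B - \<delta> / 2) \<le> (\<Sum>x\<in>C N. ?v x / (1 - ?v x))"
      proof -
        have "real N * ((t - t') * B - \<delta> / 2) \<le> (\<Sum>j\<in>{scaled t' N<..scaled t N}. (b j * \<theta>) / (1 - b j * \<theta>))"
          using elim(2,4) by (simp add: field_simps)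
        also have "\<dots> \<le> (\<Sum>j\<in>{scaled t' N<..scaled t N}. a ?M * b j / (1 - a ?M * b j))"
        proof (rule sum_mono)
          fix j assume "j \<in> {scaled t' N<..scaled t N}"
          then have j: "0 < b j" "a ?M * b j < 1"
            using ab(2,3) v[OF M, of j] by (auto simp: params_upto_def)
          have "b j * \<theta> \<le> a ?M * b j" using a j by (simp add: mult.commute)
          then show "b j * \<theta> / (1 - b j * \<theta>) \<le> a ?M * b j / (1 - a ?M * b j)"
            using j \<theta> by (intro frac_le) auto
        qed
        also have "\<dots> = (\<Sum>x\<in>C N. ?v x / (1 - ?v x))"
          unfolding C_def sum_image_right by simp
        finally show ?thesis .
      qed
      define E where "E = {W. real N * x \<le> real (last_passage W (scaled s' N) (scaled t' N))}"
      define F where "F = {W. real N * (x + (t - t') * B - \<delta>) \<le> real (last_passage W ?M (scaled t N))}"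
      define G where "G = {\<omega>. real N * (\<delta> / 2) \<le> \<bar>real (\<Sum>x\<in>C N. \<omega> x) - (\<Sum>x\<in>C N. ?v x / (1 - ?v x))\<bar>}"
      have "E \<subseteq> F \<union> G"
      proof
        fix W assume "W \<in> E"
        then have W: "real N * x \<le> real (last_passage W (scaled s' N) (scaled t' N))"
          by (simp add: E_def)
        have "last_passage W (scaled s' N) (scaled t' N) + (\<Sum>j\<in>{scaled t' N<..scaled t N}. W (?M, j))
            \<le> last_passage W ?M (scaled t N)"
          using elim(3) s t by (intro last_passage_add_column scaled_mono) auto
        then have "last_passage W (scaled s' N) (scaled t' N) + (\<Sum>x\<in>C N. W x) \<le> last_passage W ?M (scaled t N)"
          by (simp only: C_def sum_image_right)
        then have "real (last_passage W (scaled s' N) (scaled t' N)) + real (\<Sum>x\<in>C N. W x)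
            \<le> real (last_passage W ?M (scaled t N))"
          unfolding of_nat_add[symmetric] by (rule of_nat_mono)
        moreover have "real N * ((t - t') * B - \<delta>) \<le> real (\<Sum>x\<in>C N. W x)" if "W \<notin> G"
        proof -
          define S where "S = real (\<Sum>x\<in>C N. W x)"
          define M where "M = (\<Sum>x\<in>C N. ?v x / (1 - ?v x))"
          have "\<bar>S - M\<bar> < real N * (\<delta> / 2)"
            using that unfolding G_def S_def M_def by (simp only: mem_Collect_eq not_le)
          moreover have "real N * ((t - t') * B - \<delta>) = real N * ((t - t') * B - \<delta> / 2) - real N * (\<delta> / 2)"
            by (simp add: algebra_simps)
          ultimately show ?thesis
            using mean unfolding S_def[symmetric] M_def[symmetric] by linarith
        qed
        ultimately show "W \<in> F \<union> G"
          using W by (cases "W \<in> G") (auto simp: F_def distrib_left right_diff_distrib simp del: of_nat_sum)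
      qed
      then have "measure_pmf.prob (?P N) E \<le> measure_pmf.prob (?P N) (F \<union> G)"
        by (intro measure_pmf.finite_measure_mono) auto
      also have "\<dots> \<le> measure_pmf.prob (?P N) F + measure_pmf.prob (?P N) G"
        by (intro measure_Un_le) auto
      finally have "measure_pmf.prob (?P N) E \<le> measure_pmf.prob (?P N) F + p N"
        by (simp only: p_def G_def)
      moreover have "measure_pmf.prob (?P N) E =
          quenched_tail a b (scaled s' N) (scaled t' N) (real N * x)"
        unfolding E_def using s t scaled_mono[of s' s N] scaled_mono[of t' t N]
        by (intro prob_reindexed_last_passage[where h = "\<lambda>p. p"]) auto
      moreover have "measure_pmf.prob (?P N) F =
          quenched_tail a b ?M (scaled t N) (real N * (x + (t - t') * B - \<delta>))"
        unfolding F_def by (intro prob_reindexed_last_passage[where h = "\<lambda>p. p"]) auto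
      ultimately show "quenched_tail a b (scaled s' N) (scaled t' N) (real N * x) - \<epsilon> \<le>
          quenched_tail a b ?M (scaled t N) (real N * (x + (t - t') * B - \<delta>))"
        using elim(1) by linarith
    qed
  qed
qed

section \<open>The pointwise ergodic theorem for an ergodic map\<close>

text \<open>Garsia's argument: with \<open>m n\<close> the maximum of the first \<open>n\<close> partial sums, including the empty one,
  \<open>f \<ge> m n - m n \<circ> T\<close> wherever \<open>m n > 0\<close>, and the right-hand side has integral zero.\<close>

lemma maximal_ergodic:
  fixes f :: "'a \<Rightarrow> real"
  assumes T: "T \<in> M \<rightarrow>\<^sub>M M" "distr M M T = M"
    and f: "integrable M f"
    and pos: "AE x in M. \<exists>n. 0 < (\<Sum>k<n. f ((T ^^ k) x))"
  shows "0 \<le> (\<integral>x. f x \<partial>M)"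
proof -
  define S where "S = (\<lambda>n x. \<Sum>k<n. f ((T ^^ k) x))"
  define m where "m = (\<lambda>n x. Max ((\<lambda>k. S k x) ` {..n}))"
  have Tk: "(T ^^ k) \<in> M \<rightarrow>\<^sub>M M" for k
    by (induction k) (use T in \<open>auto simp: comp_def\<close>)
  have Tk_distr: "distr M M (T ^^ k) = M" for k
  proof (induction k)
    case (Suc k)
    have "distr M M (T ^^ Suc k) = distr (distr M M (T ^^ k)) M T"
      using T Tk by (simp add: distr_distr comp_def)
    then show ?case by (simp only: Suc T(2))
  qed (simp add: distr_id2)
  have int_T: "integrable M (\<lambda>x. h (T x))" "(\<integral>x. h (T x) \<partial>M) = (\<integral>x. h x \<partial>M)"
    if "integrable M h" for h :: "'a \<Rightarrow> real"
    using that integrable_distr[of T M M h] integral_distr[of T M M h] T by auto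
  have int_fT: "integrable M (\<lambda>x. f ((T ^^ k) x))" for k
    using integrable_distr[of "T ^^ k" M M f] Tk Tk_distr f by simp
  have int_S: "integrable M (S n)" for n
    unfolding S_def using int_fT by (intro Bochner_Integration.integrable_sum) auto
  have m_Suc: "m (Suc n) x = max (S (Suc n) x) (m n x)" for n x
  proof -
    have "(\<lambda>k. S k x) ` {..Suc n} = insert (S (Suc n) x) ((\<lambda>k. S k x) ` {..n})"
      by (simp add: atMost_Suc)
    then show ?thesis
      by (simp add: m_def Max_insert)
  qed
  have m_0: "m 0 x = 0" for x
    by (simp add: m_def S_def)
  have int_m: "integrable M (m n)" for n
  proof (induction n)
    case 0
    have "m 0 = (\<lambda>_. 0)" by (simp add: fun_eq_iff m_0)
    then show ?case by simp
  next
    case (Suc n)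
    have "m (Suc n) = (\<lambda>x. max (S (Suc n) x) (m n x))" by (simp add: fun_eq_iff m_Suc)
    then show ?case using Suc int_S by (simp add: integrable_max)
  qed
  have S_le_m: "S k x \<le> m n x" if "k \<le> n" for k n x
    unfolding m_def using that by (intro Max_ge) auto
  have m_nonneg: "0 \<le> m n x" for n x
    using S_le_m[of 0 n x] by (simp add: S_def)
  have S_Suc: "S (Suc k) x = f x + S k (T x)" for k x
    unfolding S_def by (subst sum.lessThan_Suc_shift) (simp add: funpow_swap1)
  have key: "m n x - m n (T x) \<le> f x * indicator {x. 0 < m n x} x" for n x
  proof (cases "0 < m n x")
    case True
    have "m n x \<in> (\<lambda>k. S k x) ` {..n}"
      unfolding m_def by (intro Max_in) auto
    then obtain k where k: "k \<le> n" "m n x = S k x" by auto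
    with True have "k \<noteq> 0" by (auto simp: S_def intro!: gr0I)
    then obtain l where l: "k = Suc l" by (cases k) auto
    then have "m n x \<le> f x + m n (T x)"
      using k S_Suc S_le_m[of l n "T x"] by simp
    then show ?thesis using True by simp
  next
    case False
    then show ?thesis using m_nonneg[of n x] m_nonneg[of n "T x"] by simp
  qed
  have meas: "{x \<in> space M. 0 < m n x} \<in> sets M" for n
    using borel_measurable_integrable[OF int_m[of n]] by measurable
  have int_ind: "integrable M (\<lambda>x. f x * indicator {x. 0 < m n x} x)" for n
  proof -
    have "integrable M (\<lambda>x. f x * indicator {x \<in> space M. 0 < m n x} x)"
      using meas f by (rule integrable_real_mult_indicator)
    moreover have "f x * indicator {x \<in> space M. 0 < m n x} x = f x * indicator {x. 0 < m n x} x"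
      if "x \<in> space M" for x
      using that by (auto split: split_indicator)
    ultimately show ?thesis
      by (simp cong: Bochner_Integration.integrable_cong)
  qed
  have nonneg: "0 \<le> (\<integral>x. f x * indicator {x. 0 < m n x} x \<partial>M)" for n
  proof -
    have "0 = (\<integral>x. m n x - m n (T x) \<partial>M)"
      using int_T[OF int_m] int_m by simp
    also have "\<dots> \<le> (\<integral>x. f x * indicator {x. 0 < m n x} x \<partial>M)"
      using int_T[OF int_m] int_m int_ind key by (intro integral_mono) auto
    finally show ?thesis .
  qed
  have "(\<lambda>n. \<integral>x. f x * indicator {x. 0 < m n x} x \<partial>M) \<longlonglongrightarrow> (\<integral>x. f x \<partial>M)"
  proof (rule integral_dominated_convergence)
    show "integrable M (\<lambda>x. \<bar>f x\<bar>)" using f by simp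
    show "AE x in M. (\<lambda>n. f x * indicator {x. 0 < m n x} x) \<longlonglongrightarrow> f x"
      using pos
    proof eventually_elim
      case (elim x)
      then obtain n where n: "0 < S n x" by (auto simp: S_def)
      have "\<forall>\<^sub>F k in sequentially. f x * indicator {x. 0 < m k x} x = f x"
        using eventually_ge_at_top[of n]
      proof eventually_elim
        case (elim k)
        then have "0 < m k x" using n S_le_m[of n k x] by simp
        then show ?case by simp
      qed
      then show ?case by (rule tendsto_eventually)
    qed
    show "AE x in M. norm (f x * indicator {x. 0 < m n x} x) \<le> \<bar>f x\<bar>" for n
      by (auto split: split_indicator)
    show "(\<lambda>x. f x * indicator {x. 0 < m n x} x) \<in> borel_measurable M" for n
      using int_ind by (rule borel_measurable_integrable)
  qed (use f in auto)
  then show ?thesis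
    by (rule LIMSEQ_le_const) (use nonneg in auto)
qed

text \<open>Unboundedness of the sums of \<open>f - c\<close> is a strictly invariant event. If it had full measure,
  the maximal inequality would give \<open>c \<le> \<integral>f\<close>.\<close>

lemma ergodic_average_limsup:
  fixes f :: "'a \<Rightarrow> real"
  assumes erg: "ergodic M T" and f: "integrable M f" and c: "(\<integral>x. f x \<partial>M) < c"
  shows "AE x in M. \<exists>K. \<forall>n. (\<Sum>k<n. f ((T ^^ k) x)) - c * real n \<le> real K"
proof -
  interpret prob_space M
    using erg by (simp add: ergodic_def)
  have T: "T \<in> M \<rightarrow>\<^sub>M M" "distr M M T = M"
    using erg by (auto simp: ergodic_def)
  define D where "D = (\<lambda>n x. (\<Sum>k<n. f ((T ^^ k) x)) - c * real n)"
  have Tk [measurable]: "(T ^^ k) \<in> M \<rightarrow>\<^sub>M M" for k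
    by (induction k) (use T in \<open>auto simp: comp_def\<close>)
  have [measurable]: "f \<in> borel_measurable M" using f by simp
  have [measurable]: "D n \<in> borel_measurable M" for n
    unfolding D_def by measurable
  \<comment> \<open>The set where the centred sums are unbounded is strictly invariant.\<close>
  define A where "A = {x \<in> space M. \<forall>K::nat. \<exists>n. real K < D n x}"
  have A: "A \<in> sets M"
    unfolding A_def by measurable
  have D_Suc: "D (Suc n) x = f x - c + D n (T x)" for n x
    unfolding D_def by (subst sum.lessThan_Suc_shift) (simp add: funpow_swap1 algebra_simps)
  have bdd: "(\<exists>K::nat. \<forall>n. D n x \<le> real K) \<longleftrightarrow> (\<exists>K::nat. \<forall>n. D n (T x) \<le> real K)" for x
  proof
    assume "\<exists>K::nat. \<forall>n. D n x \<le> real K"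
    then obtain K where K: "\<And>n. D n x \<le> real K" by auto
    obtain L :: nat where L: "real K - (f x - c) \<le> real L" using real_arch_simple by blast
    have "D n (T x) \<le> real L" for n
      using K[of "Suc n"] L D_Suc[of n x] by linarith
    then show "\<exists>K::nat. \<forall>n. D n (T x) \<le> real K" by auto
  next
    assume "\<exists>K::nat. \<forall>n. D n (T x) \<le> real K"
    then obtain K where K: "\<And>n. D n (T x) \<le> real K" by auto
    obtain L :: nat where L: "\<bar>f x - c\<bar> + real K \<le> real L" using real_arch_simple by blast
    have "D n x \<le> real L" for n
    proof (cases n)
      case 0
      then show ?thesis by (simp add: D_def)
    next
      case (Suc k)
      then have "D n x = f x - c + D k (T x)" by (simp only: D_Suc)
      with K[of k] L show ?thesis by linarith
    qed
    then show "\<exists>K::nat. \<forall>n. D n x \<le> real K" by auto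
  qed
  have invariant: "T -` A \<inter> space M = A"
  proof -
    have "x \<in> A \<longleftrightarrow> x \<in> space M \<and> \<not> (\<exists>K::nat. \<forall>n. D n x \<le> real K)" for x
      by (auto simp: A_def not_le)
    then show ?thesis
      using bdd measurable_space[OF T(1)] by (auto simp only: vimage_eq Int_iff)
  qed
  have "prob A = 0"
  proof (rule ccontr)
    assume "prob A \<noteq> 0"
    then have "prob A = 1"
      using erg A invariant by (auto simp: ergodic_def)
    then have AE_A: "AE x in M. x \<in> A"
      using A AE_in_set_eq_1 by blast
    have "0 \<le> (\<integral>x. f x - c \<partial>M)"
    proof (rule maximal_ergodic[OF T])
      show "AE x in M. \<exists>n. 0 < (\<Sum>k<n. f ((T ^^ k) x) - c)"
        using AE_A
      proof eventually_elim
        case (elim x)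
        then have "\<exists>n. real 0 < D n x"
          unfolding A_def by blast
        then show ?case by (auto simp: D_def sum_subtractf mult.commute intro!: exI[of _ n])
      qed
    qed (use f in auto)
    then show False
      using f c by (simp add: prob_space)
  qed
  then have "AE x in M. x \<notin> A"
    using A by (simp add: AE_iff_measurable[OF _ refl] prob_eq_0)
  with AE_space show ?thesis
    by eventually_elim (auto simp: A_def D_def not_less)
qed

lemma ergodic_average_tendsto:
  fixes f :: "'a \<Rightarrow> real"
  assumes erg: "ergodic M T" and f: "integrable M f"
  shows "AE x in M. (\<lambda>n. (\<Sum>k<n. f ((T ^^ k) x)) / real n) \<longlonglongrightarrow> (\<integral>x. f x \<partial>M)"
proof -
  have upper: "AE x in M. \<forall>j::nat. \<forall>\<^sub>F n in sequentially.
      (\<Sum>k<n. h ((T ^^ k) x)) / real n < (\<integral>x. h x \<partial>M) + 1 / Suc j"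
    if h: "integrable M h" for h :: "'a \<Rightarrow> real"
    unfolding AE_all_countable
  proof
    fix j :: nat
    define c where "c = (\<integral>x. h x \<partial>M) + 1 / (2 * Suc j)"
    have c: "(\<integral>x. h x \<partial>M) < c" "c < (\<integral>x. h x \<partial>M) + 1 / Suc j"
      by (auto simp: c_def field_simps)
    from ergodic_average_limsup[OF erg h c(1)]
    show "AE x in M. \<forall>\<^sub>F n in sequentially.
      (\<Sum>k<n. h ((T ^^ k) x)) / real n < (\<integral>x. h x \<partial>M) + 1 / Suc j"
    proof eventually_elim
      case (elim x)
      then obtain K where K: "\<And>n. (\<Sum>k<n. h ((T ^^ k) x)) - c * real n \<le> real K" by auto
      have "(\<lambda>n. c + real K * (1 / real n)) \<longlonglongrightarrow> c + real K * 0"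
        by (intro tendsto_intros lim_1_over_n)
      then have "\<forall>\<^sub>F n in sequentially. c + real K * (1 / real n) < (\<integral>x. h x \<partial>M) + 1 / Suc j"
        using c(2) by (intro order_tendstoD(2)) auto
      then show ?case
        using eventually_gt_at_top[of 0]
      proof eventually_elim
        case (elim n)
        have "(\<Sum>k<n. h ((T ^^ k) x)) / real n \<le> (c * real n + real K) / real n"
          using K[of n] by (intro divide_right_mono) auto
        also have "\<dots> = c + real K * (1 / real n)"
          using elim by (simp add: add_divide_distrib)
        finally show ?case using elim by linarith
      qed
    qed
  qed
  have "integrable M (\<lambda>x. - f x)" using f by simp
  from upper[OF f] upper[OF this] show ?thesis
  proof eventually_elim
    case (elim x)
    show ?case
    proof (rule order_tendstoI)
      fix a assume "a < (\<integral>x. f x \<partial>M)"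
      then obtain j :: nat where j: "1 / Suc j < (\<integral>x. f x \<partial>M) - a"
        using nat_approx_posE[of "(\<integral>x. f x \<partial>M) - a"] by auto
      from elim(2) have "\<forall>\<^sub>F n in sequentially.
          (\<Sum>k<n. - f ((T ^^ k) x)) / real n < (\<integral>x. - f x \<partial>M) + 1 / Suc j" by blast
      then show "\<forall>\<^sub>F n in sequentially. a < (\<Sum>k<n. f ((T ^^ k) x)) / real n"
      proof eventually_elim
        case (elim n)
        then show ?case using j by (simp add: sum_negf)
      qed
    next
      fix a assume "(\<integral>x. f x \<partial>M) < a"
      then obtain j :: nat where j: "1 / Suc j < a - (\<integral>x. f x \<partial>M)"
        using nat_approx_posE[of "a - (\<integral>x. f x \<partial>M)"] by auto
      from elim(1) have "\<forall>\<^sub>F n in sequentially.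
          (\<Sum>k<n. f ((T ^^ k) x)) / real n < (\<integral>x. f x \<partial>M) + 1 / Suc j" by blast
      then show "\<forall>\<^sub>F n in sequentially. (\<Sum>k<n. f ((T ^^ k) x)) / real n < a"
      proof eventually_elim
        case (elim n)
        then show ?case using j by linarith
      qed
    qed
  qed
qed

section \<open>From the annealed law to quenched tails\<close>

lemma last_passage_ge_iff:
  assumes "1 \<le> m" "1 \<le> n"
  shows "y \<le> real (last_passage W m n) \<longleftrightarrow>
    (\<exists>\<pi>\<in>{\<pi>. directed_path (1, 1) (m, n) \<pi>}. y \<le> real (\<Sum>p\<leftarrow>\<pi>. W p))"
proof
  assume y: "y \<le> real (last_passage W m n)"
  obtain \<pi> where "directed_path (1, 1) (m, n) \<pi>" "last_passage W m n = (\<Sum>p\<leftarrow>\<pi>. W p)"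
    using last_passage_attained[OF assms] .
  with y show "\<exists>\<pi>\<in>{\<pi>. directed_path (1, 1) (m, n) \<pi>}. y \<le> real (\<Sum>p\<leftarrow>\<pi>. W p)"
    by auto
next
  assume "\<exists>\<pi>\<in>{\<pi>. directed_path (1, 1) (m, n) \<pi>}. y \<le> real (\<Sum>p\<leftarrow>\<pi>. W p)"
  then obtain \<pi> where "directed_path (1, 1) (m, n) \<pi>" and y: "y \<le> real (\<Sum>p\<leftarrow>\<pi>. W p)"
    by blast
  with of_nat_mono[OF last_passage_ge[OF this(1), of W], where 'a = real]
  show "y \<le> real (last_passage W m n)"
    by linarith
qed

lemma last_passage_event_measurable:
  assumes "1 \<le> m" "1 \<le> n" and I: "{1..m} \<times> {1..n} \<subseteq> I"
    and M: "sets M = sets (\<Pi>\<^sub>M p\<in>I. count_space (UNIV :: nat set))"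
  shows "{W \<in> space M. y \<le> real (last_passage W m n)} \<in> sets M"
proof -
  have comp: "(\<lambda>W. real (W p)) \<in> borel_measurable M" if "p \<in> I" for p
  proof -
    have "(\<lambda>W. W p) \<in> M \<rightarrow>\<^sub>M count_space (UNIV :: nat set)"
      using that by (subst measurable_cong_sets[OF M refl]) (rule measurable_component_singleton)
    then show ?thesis by measurable
  qed
  have "(\<lambda>W. real (\<Sum>p\<leftarrow>\<pi>. W p)) \<in> borel_measurable M" if "set \<pi> \<subseteq> I" for \<pi>
    using that by (induction \<pi>) (auto intro!: borel_measurable_add comp)
  moreover have "set \<pi> \<subseteq> I" if "directed_path (1, 1) (m, n) \<pi>" for \<pi>
    using directed_path_in_box[OF that] I by auto
  ultimately have "{W \<in> space M. y \<le> real (\<Sum>p\<leftarrow>\<pi>. W p)} \<in> sets M"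
    if "\<pi> \<in> {\<pi>. directed_path (1, 1) (m, n) \<pi>}" for \<pi>
    using that by (intro borel_measurable_le) auto
  then show ?thesis
    unfolding last_passage_ge_iff[OF assms(1,2)]
    by (rule sets.sets_Collect_finite_Ex[OF _ finite_directed_paths])
qed

text \<open>The event depends on the weights of one box, whose joint law is a finite product.\<close>

lemma quenched_law_tail:
  assumes mn: "1 \<le> m" "1 \<le> n"
  shows "measure (quenched_law \<omega>) {W \<in> space weight_space. y \<le> real (last_passage W m n)} =
    quenched_tail (fst \<omega>) (snd \<omega>) m n y"
proof -
  obtain a b where \<omega>: "\<omega> = (a, b)" by (cases \<omega>)
  define B where "B = {1..m} \<times> {1..n}"
  define p where "p = (\<lambda>(i, j). geo (a i * b j))"
  let ?C = "\<lambda>_ :: nat \<times> nat. count_space (UNIV :: nat set)"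
  let ?P = "Pi_pmf B 0 p"
  have B: "finite B" "B \<noteq> {}" "B \<subseteq> sites"
    using mn by (auto simp: B_def)
  have q: "quenched_law (a, b) = (\<Pi>\<^sub>M x\<in>sites. measure_pmf (p x))"
    by (simp add: quenched_law_def p_def geo_def case_prod_beta')
  interpret Q: product_prob_space "\<lambda>x. measure_pmf (p x)" sites
    by (rule product_prob_spaceI) (simp add: measure_pmf.prob_space_axioms)
  have sets_eq: "sets (\<Pi>\<^sub>M x\<in>I. measure_pmf (p x)) = sets (Pi\<^sub>M I ?C)" for I
    by (intro sets_PiM_cong) auto
  have space_eq: "space (\<Pi>\<^sub>M x\<in>I. measure_pmf (p x)) = space (Pi\<^sub>M I ?C)" for I
    using sets_eq by (rule sets_eq_imp_space_eq)
  define E where "E = {W \<in> space (Pi\<^sub>M B ?C). y \<le> real (last_passage W m n)}"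
  have E: "E \<in> sets (Pi\<^sub>M B ?C)"
    unfolding E_def using mn by (intro last_passage_event_measurable) (auto simp: B_def)
  have restrict: "last_passage (restrict W B) m n = last_passage W m n" for W
    by (intro last_passage_cong) (auto simp: B_def)
  have "(\<Pi>\<^sub>M x\<in>B. measure_pmf (p x)) = distr ?P (Pi\<^sub>M B ?C) (\<lambda>f. restrict f B)"
  proof -
    have "distr ?P (Pi\<^sub>M B ?C) (\<lambda>f. \<lambda>x\<in>B. f x) = (\<Pi>\<^sub>M x\<in>B. distr ?P (count_space UNIV) (\<lambda>f. f x))"
      using indep_vars_Pi_pmf[OF B(1), of 0 p] B(2)
      by (subst (asm) prob_space.indep_vars_iff_distr_eq_PiM'[OF measure_pmf.prob_space_axioms]) auto
    also have "\<dots> = (\<Pi>\<^sub>M x\<in>B. measure_pmf (p x))"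
    proof (intro PiM_cong refl)
      fix x assume "x \<in> B"
      then have "p x = map_pmf (\<lambda>f. f x) ?P"
        using B(1) by (simp add: Pi_pmf_component)
      then show "distr ?P (count_space UNIV) (\<lambda>f. f x) = measure_pmf (p x)"
        by (simp add: map_pmf_rep_eq)
    qed
    finally show ?thesis by simp
  qed
  then have "measure (\<Pi>\<^sub>M x\<in>B. measure_pmf (p x)) E = measure ?P ((\<lambda>f. restrict f B) -` E \<inter> space ?P)"
    using E by (simp add: measure_distr space_PiM)
  also have "(\<lambda>f. restrict f B) -` E \<inter> space ?P = {f. y \<le> real (last_passage f m n)}"
    by (auto simp: E_def restrict space_PiM)
  also have "measure ?P \<dots> = quenched_tail a b m n y"
    by (simp add: quenched_tail_def B_def p_def)
  finally have 1: "measure (\<Pi>\<^sub>M x\<in>B. measure_pmf (p x)) E = quenched_tail a b m n y" .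
  have "(\<Pi>\<^sub>M x\<in>B. measure_pmf (p x)) =
      distr (quenched_law (a, b)) (\<Pi>\<^sub>M x\<in>B. measure_pmf (p x)) (\<lambda>f. restrict f B)"
    unfolding q by (rule Q.distr_PiM_restrict_finite[OF B(1,3), symmetric])
  then have "measure (\<Pi>\<^sub>M x\<in>B. measure_pmf (p x)) E =
      measure (distr (quenched_law (a, b)) (\<Pi>\<^sub>M x\<in>B. measure_pmf (p x)) (\<lambda>f. restrict f B)) E"
    by (rule arg_cong)
  also have "\<dots> = measure (quenched_law (a, b)) ((\<lambda>f. restrict f B) -` E \<inter> space (quenched_law (a, b)))"
    using E B unfolding q by (intro measure_distr measurable_restrict_subset) (auto simp: sets_eq)
  also have "(\<lambda>f. restrict f B) -` E \<inter> space (quenched_law (a, b)) =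
      {W \<in> space weight_space. y \<le> real (last_passage W m n)}"
    unfolding q space_eq weight_space_def
    by (auto simp: E_def restrict space_PiM)
  finally show ?thesis
    using 1 by (simp add: \<omega>)
qed

text \<open>A box without sites admits no path, and the last-passage time is then a fixed default value.
  Treating this case keeps measurability and stationarity free of side conditions.\<close>

lemma quenched_tail_degenerate:
  assumes "\<not> (1 \<le> m \<and> 1 \<le> n)"
  shows "quenched_tail a b m n y = quenched_tail a' b' m n y"
proof -
  have "\<not> directed_path (1, 1) (m, n) \<pi>" for \<pi>
    using directed_path_in_box[of "(1, 1)" "(m, n)" \<pi>] assms by auto
  then have "last_passage W m n = last_passage (\<lambda>_. 0) m n" for W
    unfolding last_passage_def by simp
  then have eq: "{W. y \<le> real (last_passage W m n)} =
      (if y \<le> real (last_passage (\<lambda>_. 0) m n) then UNIV else {})"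
    by auto metis+
  show ?thesis
    unfolding quenched_tail_def eq by simp
qed

lemma quenched_tail_cong:
  assumes "\<And>i. 1 \<le> i \<Longrightarrow> a i = a' i" "\<And>j. 1 \<le> j \<Longrightarrow> b j = b' j"
  shows "quenched_tail a b m n y = quenched_tail a' b' m n y"
proof -
  have "Pi_pmf ({1..m} \<times> {1..n}) 0 (\<lambda>(i, j). geo (a i * b j)) =
      Pi_pmf ({1..m} \<times> {1..n}) 0 (\<lambda>(i, j). geo (a' i * b' j))"
    using assms by (intro Pi_pmf_cong) auto
  then show ?thesis by (simp add: quenched_tail_def)
qed

context
  fixes \<mu> :: "((nat \<Rightarrow> real) \<times> (nat \<Rightarrow> real)) measure"
  assumes te: "totally_ergodic \<mu>"
begin

lemma prob_\<mu>: "prob_space \<mu>"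
  and sets_\<mu>: "sets \<mu> = sets (param_space \<Otimes>\<^sub>M param_space)"
  and space_\<mu>: "space \<mu> = space param_space \<times> space param_space"
proof -
  show "prob_space \<mu>" "sets \<mu> = sets (param_space \<Otimes>\<^sub>M param_space)"
    using te by (auto simp: totally_ergodic_def ergodic_def)
  then show "space \<mu> = space param_space \<times> space param_space"
    using sets_eq_imp_space_eq[of \<mu>] by (simp add: space_pair_measure)
qed

lemma param_in_unit_interval:
  assumes "\<omega> \<in> space \<mu>" "1 \<le> i"
  shows "0 < fst \<omega> i \<and> fst \<omega> i < 1" "0 < snd \<omega> i \<and> snd \<omega> i < 1"
  using assms by (auto simp: space_\<mu> space_param_space PiE_iff mem_Times_iff)

lemma param_measurable:
  assumes "1 \<le> i"
  shows "(\<lambda>\<omega>. fst \<omega> i) \<in> borel_measurable \<mu>" "(\<lambda>\<omega>. snd \<omega> i) \<in> borel_measurable \<mu>"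
proof -
  have [measurable]: "(\<lambda>c. c i) \<in> borel_measurable param_space"
    using assms by (rule measurable_param_component)
  note [measurable_cong] = sets_\<mu>
  show "(\<lambda>\<omega>. fst \<omega> i) \<in> borel_measurable \<mu>" "(\<lambda>\<omega>. snd \<omega> i) \<in> borel_measurable \<mu>"
    by measurable
qed

lemma shift_measurable: "shift k \<in> param_space \<rightarrow>\<^sub>M param_space"
  unfolding shift_def param_space_def
  by (intro measurable_restrict measurable_component_singleton) auto

lemma shifts_measurable: "map_prod (shift k) (shift l) \<in> \<mu> \<rightarrow>\<^sub>M \<mu>"
proof -
  note [measurable] = shift_measurable
  have "map_prod (shift k) (shift l) \<in>
      param_space \<Otimes>\<^sub>M param_space \<rightarrow>\<^sub>M param_space \<Otimes>\<^sub>M param_space"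
    unfolding map_prod_def by measurable
  then show ?thesis
    using measurable_cong_sets[OF sets_\<mu> sets_\<mu>] by simp
qed

text \<open>Total ergodicity speaks of shifts by positive amounts only; shifts by zero in one
  coordinate are covered because every shift is a quotient of two positive ones.\<close>

lemma shifts_preserve: "distr \<mu> \<mu> (map_prod (shift k) (shift l)) = \<mu>"
proof -
  have one: "distr \<mu> \<mu> (map_prod (shift (Suc k)) (shift (Suc l))) = \<mu>" for k l
    using te by (auto simp: totally_ergodic_def ergodic_def)
  have "distr \<mu> \<mu> (map_prod (shift k) (shift l)) =
      distr (distr \<mu> \<mu> (map_prod (shift (Suc 0)) (shift (Suc 0)))) \<mu> (map_prod (shift k) (shift l))"
    by (simp only: one)
  also have "\<dots> = distr \<mu> \<mu> (map_prod (shift k) (shift l) \<circ> map_prod (shift (Suc 0)) (shift (Suc 0)))"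
    by (intro distr_distr shifts_measurable)
  also have "map_prod (shift k) (shift l) \<circ> map_prod (shift (Suc 0)) (shift (Suc 0)) =
      map_prod (shift (Suc k)) (shift (Suc l))"
    by (auto simp: fun_eq_iff shift_def)
  finally show ?thesis
    by (simp only: one)
qed

lemma quenched_law_measurable': "quenched_law \<in> \<mu> \<rightarrow>\<^sub>M subprob_algebra weight_space"
  using quenched_law_measurable measurable_cong_sets[OF sets_\<mu> refl] by blast

lemma last_passage_event: "1 \<le> m \<Longrightarrow> 1 \<le> n \<Longrightarrow>
    {W \<in> space weight_space. y \<le> real (last_passage W m n)} \<in> sets weight_space"
  by (rule last_passage_event_measurable[where I = sites]) (auto simp: weight_space_def)

lemma quenched_tail_measurable:
  "(\<lambda>\<omega>. quenched_tail (fst \<omega>) (snd \<omega>) m n y) \<in> borel_measurable \<mu>"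
proof (cases "1 \<le> m \<and> 1 \<le> n")
  case True
  then have "{W \<in> space weight_space. y \<le> real (last_passage W m n)} \<in> sets weight_space"
    by (intro last_passage_event) auto
  with quenched_law_measurable'
  have "(\<lambda>\<omega>. measure (quenched_law \<omega>) {W \<in> space weight_space. y \<le> real (last_passage W m n)})
      \<in> borel_measurable \<mu>"
    by measurable
  then show ?thesis
    using quenched_law_tail[of m n] True by simp
next
  case False
  then have "quenched_tail (fst \<omega>) (snd \<omega>) m n y = quenched_tail (\<lambda>_. 0) (\<lambda>_. 0) m n y"
    for \<omega> :: "(nat \<Rightarrow> real) \<times> (nat \<Rightarrow> real)"
    by (rule quenched_tail_degenerate)
  then show ?thesis by simp
qed

lemma quenched_tail_shift:
  "quenched_tail (\<lambda>i. fst \<omega> (i + k)) (\<lambda>j. snd \<omega> (j + l)) m n y =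
    quenched_tail (fst (map_prod (shift k) (shift l) \<omega>)) (snd (map_prod (shift k) (shift l) \<omega>)) m n y"
  by (intro quenched_tail_cong) (auto simp: shift_def split: prod.split)

lemma shifted_quenched_tail_measurable:
  "(\<lambda>\<omega>. quenched_tail (\<lambda>i. fst \<omega> (i + k)) (\<lambda>j. snd \<omega> (j + l)) m n y) \<in> borel_measurable \<mu>"
  unfolding quenched_tail_shift
  by (rule measurable_compose[OF shifts_measurable quenched_tail_measurable])

lemma quenched_tail_stationary:
  "(\<integral>\<omega>. quenched_tail (\<lambda>i. fst \<omega> (i + k)) (\<lambda>j. snd \<omega> (j + l)) m n y \<partial>\<mu>) =
    (\<integral>\<omega>. quenched_tail (fst \<omega>) (snd \<omega>) m n y \<partial>\<mu>)"
  unfolding quenched_tail_shift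
  using integral_distr[OF shifts_measurable quenched_tail_measurable, of k l m n y]
  unfolding shifts_preserve by simp

lemma annealed_tail:
  assumes "1 \<le> m" "1 \<le> n"
  shows "measure (annealed_law \<mu>) {W \<in> space weight_space. y \<le> real (last_passage W m n)} =
    (\<integral>\<omega>. quenched_tail (fst \<omega>) (snd \<omega>) m n y \<partial>\<mu>)"
proof -
  interpret prob_space \<mu> by (rule prob_\<mu>)
  show ?thesis
    unfolding annealed_law_def measure_bind[OF quenched_law_measurable' last_passage_event[OF assms]]
    using quenched_law_tail[OF assms] by simp
qed

lemma annealed_law_prob_space: "prob_space (annealed_law \<mu>)"
  and sets_annealed_law: "sets (annealed_law \<mu>) = sets weight_space"
proof -
  interpret prob_space \<mu> by (rule prob_\<mu>)
  have "prob_space (quenched_law \<omega>)" for \<omega>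
    unfolding quenched_law_def case_prod_beta'
    by (intro prob_space_PiM measure_pmf.prob_space_axioms)
  then show "prob_space (annealed_law \<mu>)"
    unfolding annealed_law_def by (intro prob_space_bind[OF _ quenched_law_measurable']) auto
  show "sets (annealed_law \<mu>) = sets weight_space"
    unfolding annealed_law_def
    by (rule sets_bind) (use quenched_law_measurable' not_empty in \<open>auto dest: sets_kernel\<close>)
qed

text \<open>Almost sure convergence to a constant, read as a statement on tails. From here on the shape
  function enters only through these limits.\<close>

lemma annealed_tail_limits:
  assumes g: "is_shape_function \<mu> g" and st: "0 < s" "0 < t"
  shows "ennreal y < g s t \<Longrightarrow>
      (\<lambda>N. \<integral>\<omega>. quenched_tail (fst \<omega>) (snd \<omega>) (scaled s N) (scaled t N) (real N * y) \<partial>\<mu>) \<longlonglongrightarrow> 1"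
    and "g s t < ennreal y \<Longrightarrow>
      (\<lambda>N. \<integral>\<omega>. quenched_tail (fst \<omega>) (snd \<omega>) (scaled s N) (scaled t N) (real N * y) \<partial>\<mu>) \<longlonglongrightarrow> 0"
proof -
  interpret L: prob_space "annealed_law \<mu>" by (rule annealed_law_prob_space)
  have space_L: "space (annealed_law \<mu>) = space weight_space"
    using sets_annealed_law by (rule sets_eq_imp_space_eq)
  define E where "E = (\<lambda>N. if 1 \<le> scaled s N \<and> 1 \<le> scaled t N
    then {W \<in> space weight_space. real N * y \<le> real (last_passage W (scaled s N) (scaled t N))} else {})"
  have E: "E N \<in> sets (annealed_law \<mu>)" for N
    unfolding E_def sets_annealed_law using last_passage_event by auto
  have ev: "\<forall>\<^sub>F N in sequentially. 0 < N \<and> 1 \<le> scaled s N \<and> 1 \<le> scaled t N"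
    using st by (intro eventually_conj eventually_gt_at_top eventually_scaled_ge)
  have prob_E: "\<forall>\<^sub>F N in sequentially. (\<integral>W. indicator (E N) W \<partial>annealed_law \<mu>) =
      (\<integral>\<omega>. quenched_tail (fst \<omega>) (snd \<omega>) (scaled s N) (scaled t N) (real N * y) \<partial>\<mu>)"
    using ev
  proof eventually_elim
    case (elim N)
    then have "(\<integral>W. indicator (E N) W \<partial>annealed_law \<mu>) = measure (annealed_law \<mu>) (E N)"
      using E by simp
    with elim show ?case
      by (simp only: E_def annealed_tail if_True simp_thms)
  qed
  have conv: "(\<lambda>N. \<integral>\<omega>. quenched_tail (fst \<omega>) (snd \<omega>) (scaled s N) (scaled t N) (real N * y) \<partial>\<mu>) \<longlonglongrightarrow> c"
    if lim: "AE W in annealed_law \<mu>. (\<lambda>N. indicator (E N) W) \<longlonglongrightarrow> c" for c :: real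
  proof -
    have "(\<lambda>N. \<integral>W. indicator (E N) W \<partial>annealed_law \<mu>) \<longlonglongrightarrow> (\<integral>W. c \<partial>annealed_law \<mu>)"
    proof (rule integral_dominated_convergence)
      show "integrable (annealed_law \<mu>) (\<lambda>_. 1 :: real)" by simp
      show "AE W in annealed_law \<mu>. norm (indicator (E N) W :: real) \<le> 1" for N
        by (auto split: split_indicator)
    qed (use E lim in auto)
    then have "(\<lambda>N. \<integral>W. indicator (E N) W \<partial>annealed_law \<mu>) \<longlonglongrightarrow> c"
      by (simp add: L.prob_space)
    then show ?thesis
      using prob_E by (rule Lim_transform_eventually)
  qed
  have AE_g: "AE W in annealed_law \<mu>. W \<in> space weight_space \<and>
      (\<lambda>N. ennreal (real (last_passage W (scaled s N) (scaled t N)) / real N)) \<longlonglongrightarrow> g s t"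
    using AE_space g[unfolded is_shape_function_def]
    by eventually_elim (use st in \<open>auto simp: space_L scaled_def\<close>)
  show "(\<lambda>N. \<integral>\<omega>. quenched_tail (fst \<omega>) (snd \<omega>) (scaled s N) (scaled t N) (real N * y) \<partial>\<mu>) \<longlonglongrightarrow> 1"
    if y: "ennreal y < g s t"
  proof (rule conv)
    show "AE W in annealed_law \<mu>. (\<lambda>N. indicator (E N) W :: real) \<longlonglongrightarrow> 1"
      using AE_g
    proof eventually_elim
      case (elim W)
      then have "\<forall>\<^sub>F N in sequentially.
          ennreal y < ennreal (real (last_passage W (scaled s N) (scaled t N)) / real N)"
        using y order_tendstoD(1) by blast
      then have "\<forall>\<^sub>F N in sequentially. (indicator (E N) W :: real) = 1"
        using ev
      proof eventually_elim
        case (elim N)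
        then have "y < real (last_passage W (scaled s N) (scaled t N)) / real N"
          by (meson ennreal_leI not_le)
        then have "real N * y \<le> real (last_passage W (scaled s N) (scaled t N))"
          using elim(2) by (simp add: field_simps)
        then show ?case
          using elim(2) \<open>W \<in> space weight_space \<and> _\<close> by (simp add: E_def)
      qed
      then show ?case by (rule tendsto_eventually)
    qed
  qed
  show "(\<lambda>N. \<integral>\<omega>. quenched_tail (fst \<omega>) (snd \<omega>) (scaled s N) (scaled t N) (real N * y) \<partial>\<mu>) \<longlonglongrightarrow> 0"
    if y: "g s t < ennreal y"
  proof (rule conv)
    show "AE W in annealed_law \<mu>. (\<lambda>N. indicator (E N) W :: real) \<longlonglongrightarrow> 0"
      using AE_g
    proof eventually_elim
      case (elim W)
      then have "\<forall>\<^sub>F N in sequentially.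
          ennreal (real (last_passage W (scaled s N) (scaled t N)) / real N) < ennreal y"
        using y order_tendstoD(2) by blast
      then have "\<forall>\<^sub>F N in sequentially. (indicator (E N) W :: real) = 0"
        using ev
      proof eventually_elim
        case (elim N)
        then have "real (last_passage W (scaled s N) (scaled t N)) / real N < y"
          by (meson ennreal_leI not_le)
        then have "\<not> real N * y \<le> real (last_passage W (scaled s N) (scaled t N))"
          using elim(2) by (simp add: field_simps)
        then show ?case
          by (simp add: E_def)
      qed
      then show ?case by (rule tendsto_eventually)
    qed
  qed
qed

lemma param_average_tendsto:
  fixes \<phi> :: "real \<Rightarrow> real"
  assumes \<phi>: "\<phi> \<in> borel_measurable borel"
  shows "integrable \<mu> (\<lambda>\<omega>. \<phi> (fst \<omega> 1)) \<Longrightarrow>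
      AE \<omega> in \<mu>. (\<lambda>n. (\<Sum>i\<in>{0<..n}. \<phi> (fst \<omega> i)) / real n) \<longlonglongrightarrow> (\<integral>\<omega>. \<phi> (fst \<omega> 1) \<partial>\<mu>)"
    and "integrable \<mu> (\<lambda>\<omega>. \<phi> (snd \<omega> 1)) \<Longrightarrow>
      AE \<omega> in \<mu>. (\<lambda>n. (\<Sum>i\<in>{0<..n}. \<phi> (snd \<omega> i)) / real n) \<longlonglongrightarrow> (\<integral>\<omega>. \<phi> (snd \<omega> 1) \<partial>\<mu>)"
proof -
  have erg: "ergodic \<mu> (map_prod (shift 1) (shift 1))"
    using te by (simp add: totally_ergodic_def)
  have iter: "fst ((map_prod (shift 1) (shift 1) ^^ k) \<omega>) i = fst \<omega> (i + k) \<and>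
      snd ((map_prod (shift 1) (shift 1) ^^ k) \<omega>) i = snd \<omega> (i + k)" if "1 \<le> i" for i k \<omega>
    using that
  proof (induction k arbitrary: i)
    case (Suc k)
    then show ?case by (auto simp: shift_def split: prod.split)
  qed simp
  have sum: "(\<Sum>k<n. h (1 + k)) = (\<Sum>i\<in>{0<..n}. h i)" for h :: "nat \<Rightarrow> real" and n
    by (rule sum.reindex_bij_witness[of _ "\<lambda>i. i - 1" "\<lambda>k. 1 + k"]) auto
  show "AE \<omega> in \<mu>. (\<lambda>n. (\<Sum>i\<in>{0<..n}. \<phi> (fst \<omega> i)) / real n) \<longlonglongrightarrow> (\<integral>\<omega>. \<phi> (fst \<omega> 1) \<partial>\<mu>)"
    if "integrable \<mu> (\<lambda>\<omega>. \<phi> (fst \<omega> 1))"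
    using ergodic_average_tendsto[OF erg that] by (simp only: iter order_refl sum[of "\<lambda>i. \<phi> (fst _ i)"])
  show "AE \<omega> in \<mu>. (\<lambda>n. (\<Sum>i\<in>{0<..n}. \<phi> (snd \<omega> i)) / real n) \<longlonglongrightarrow> (\<integral>\<omega>. \<phi> (snd \<omega> 1) \<partial>\<mu>)"
    if "integrable \<mu> (\<lambda>\<omega>. \<phi> (snd \<omega> 1))"
    using ergodic_average_tendsto[OF erg that] by (simp only: iter order_refl sum[of "\<lambda>i. \<phi> (snd _ i)"])
qed

lemma param_law_stationary:
  assumes "1 \<le> i"
  shows "measure \<mu> {\<omega> \<in> space \<mu>. \<theta> < fst \<omega> i} = measure \<mu> {\<omega> \<in> space \<mu>. \<theta> < fst \<omega> 1}"
    and "measure \<mu> {\<omega> \<in> space \<mu>. \<theta> < snd \<omega> i} = measure \<mu> {\<omega> \<in> space \<mu>. \<theta> < snd \<omega> 1}"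
proof -
  interpret prob_space \<mu> by (rule prob_\<mu>)
  let ?T = "map_prod (shift (i - 1)) (shift (i - 1))"
  have T: "fst (?T \<omega>) 1 = fst \<omega> i \<and> snd (?T \<omega>) 1 = snd \<omega> i" for \<omega>
    using assms by (auto simp: shift_def split: prod.split)
  have T_space: "?T \<omega> \<in> space \<mu>" if "\<omega> \<in> space \<mu>" for \<omega>
    using measurable_space[OF shifts_measurable that] .
  have invariant: "measure \<mu> (?T -` A \<inter> space \<mu>) = measure \<mu> A" if "A \<in> sets \<mu>" for A
    using measure_distr[OF shifts_measurable that, of "i - 1" "i - 1"] by (simp add: shifts_preserve)
  note [measurable] = param_measurable[of 1]
  have "measure \<mu> (?T -` {\<omega> \<in> space \<mu>. \<theta> < fst \<omega> 1} \<inter> space \<mu>) = measure \<mu> {\<omega> \<in> space \<mu>. \<theta> < fst \<omega> 1}"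
    by (rule invariant) measurable
  moreover have "?T -` {\<omega> \<in> space \<mu>. \<theta> < fst \<omega> 1} \<inter> space \<mu> = {\<omega> \<in> space \<mu>. \<theta> < fst \<omega> i}"
    using T T_space by auto
  ultimately show "measure \<mu> {\<omega> \<in> space \<mu>. \<theta> < fst \<omega> i} = measure \<mu> {\<omega> \<in> space \<mu>. \<theta> < fst \<omega> 1}"
    by simp
  have "measure \<mu> (?T -` {\<omega> \<in> space \<mu>. \<theta> < snd \<omega> 1} \<inter> space \<mu>) = measure \<mu> {\<omega> \<in> space \<mu>. \<theta> < snd \<omega> 1}"
    by (rule invariant) measurable
  moreover have "?T -` {\<omega> \<in> space \<mu>. \<theta> < snd \<omega> 1} \<inter> space \<mu> = {\<omega> \<in> space \<mu>. \<theta> < snd \<omega> i}"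
    using T T_space by auto
  ultimately show "measure \<mu> {\<omega> \<in> space \<mu>. \<theta> < snd \<omega> i} = measure \<mu> {\<omega> \<in> space \<mu>. \<theta> < snd \<omega> 1}"
    by simp
qed

end

section \<open>Real-variable lemmas\<close>

lemma ennreal_less_between:
  assumes "x < ennreal c"
  obtains y where "0 \<le> y" "y < c" "x < ennreal y"
proof -
  obtain r where r: "x = ennreal r" "0 \<le> r"
    using assms by (cases x) auto
  with assms have "r < c" by (simp add: ennreal_less_iff)
  with r that[of "(r + c) / 2"] show ?thesis
    by (auto simp: ennreal_less_iff)
qed

lemma ennreal_le_of_shifts:
  assumes "\<And>\<delta>. 0 < \<delta> \<Longrightarrow> ennreal (c - \<delta>) \<le> x"
  shows "ennreal c \<le> x"
proof (rule ccontr)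
  assume "\<not> ennreal c \<le> x"
  then obtain y where y: "y < c" "x < ennreal y"
    using ennreal_less_between by (metis not_le)
  with assms[of "c - y"] show False by simp
qed

lemma (in prob_space) resolvent_bounds:
  fixes X :: "'a \<Rightarrow> real"
  assumes X [measurable]: "X \<in> borel_measurable M"
    and AE_X: "AE \<omega> in M. 0 < X \<omega> \<and> X \<omega> \<le> c" and y: "c < y"
  shows "integrable M (\<lambda>\<omega>. X \<omega> / (y - X \<omega>))" "0 < (\<integral>\<omega>. X \<omega> / (y - X \<omega>) \<partial>M)"
proof -
  show int: "integrable M (\<lambda>\<omega>. X \<omega> / (y - X \<omega>))"
  proof (rule integrable_const_bound)
    show "AE \<omega> in M. norm (X \<omega> / (y - X \<omega>)) \<le> c / (y - c)"
      using AE_X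
    proof eventually_elim
      case (elim \<omega>)
      then have "X \<omega> / (y - X \<omega>) \<le> c / (y - c)"
        using y by (intro frac_le) auto
      with elim y show ?case by auto
    qed
  qed simp
  have pos: "AE \<omega> in M. 0 < X \<omega> / (y - X \<omega>)"
    using AE_X by eventually_elim (use y in auto)
  then have nonneg: "AE \<omega> in M. 0 \<le> X \<omega> / (y - X \<omega>)"
    by eventually_elim simp
  then have ge: "0 \<le> (\<integral>\<omega>. X \<omega> / (y - X \<omega>) \<partial>M)"
    by (rule integral_nonneg_AE)
  show "0 < (\<integral>\<omega>. X \<omega> / (y - X \<omega>) \<partial>M)"
  proof (rule ccontr)
    assume "\<not> 0 < (\<integral>\<omega>. X \<omega> / (y - X \<omega>) \<partial>M)"
    with ge have "(\<integral>\<omega>. X \<omega> / (y - X \<omega>) \<partial>M) = 0" by simp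
    then have "AE \<omega> in M. X \<omega> / (y - X \<omega>) = 0"
      using integral_nonneg_eq_0_iff_AE[OF int nonneg] by simp
    with pos have "AE \<omega> in M. False"
      by eventually_elim simp
    then show False by simp
  qed
qed

text \<open>Both \<open>A(z)\<close> and \<open>B(z)\<close> are of this form, the latter at \<open>y = 1 / z\<close>. The error of the first-order
  expansion is bounded by a multiple of \<open>(w - y)\<^sup>2\<close>.\<close>

lemma (in prob_space) resolvent_derivative:
  fixes X :: "'a \<Rightarrow> real"
  assumes X [measurable]: "X \<in> borel_measurable M"
    and AE_X: "AE \<omega> in M. 0 < X \<omega> \<and> X \<omega> \<le> c" and y: "c < y"
  obtains D where "0 < D" "((\<lambda>y. \<integral>\<omega>. X \<omega> / (y - X \<omega>) \<partial>M) has_real_derivative - D) (at y)"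
proof
  define F where "F = (\<lambda>y. \<integral>\<omega>. X \<omega> / (y - X \<omega>) \<partial>M)"
  define D where "D = (\<integral>\<omega>. X \<omega> / (y - X \<omega>)\<^sup>2 \<partial>M)"
  define d where "d = (y - c) / 2"
  have d: "0 < d" using y by (simp add: d_def)
  have int_D: "integrable M (\<lambda>\<omega>. X \<omega> / (y - X \<omega>)\<^sup>2)"
  proof (rule integrable_const_bound)
    show "AE \<omega> in M. norm (X \<omega> / (y - X \<omega>)\<^sup>2) \<le> c / d\<^sup>2"
      using AE_X
    proof eventually_elim
      case (elim \<omega>)
      then have "X \<omega> / (y - X \<omega>)\<^sup>2 \<le> c / d\<^sup>2"
        using y d by (intro frac_le power_mono) (auto simp: d_def field_simps)
      with elim show ?case by simp
    qed
  qed simp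
  have pos: "AE \<omega> in M. 0 < X \<omega> / (y - X \<omega>)\<^sup>2"
    using AE_X by eventually_elim (use y in auto)
  then have nonneg: "AE \<omega> in M. 0 \<le> X \<omega> / (y - X \<omega>)\<^sup>2"
    by eventually_elim simp
  then have ge: "0 \<le> D"
    unfolding D_def by (rule integral_nonneg_AE)
  show "0 < D"
  proof (rule ccontr)
    assume "\<not> 0 < D"
    with ge have "D = 0" by simp
    then have "AE \<omega> in M. X \<omega> / (y - X \<omega>)\<^sup>2 = 0"
      using integral_nonneg_eq_0_iff_AE[OF int_D nonneg] by (simp only: D_def)
    with pos have "AE \<omega> in M. False"
      by eventually_elim simp
    then show False by simp
  qed
  have quadratic: "\<bar>F w - F y - (w - y) * (- D)\<bar> \<le> c / d ^ 3 * (w - y)\<^sup>2" if w: "\<bar>w - y\<bar> < d" for w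
  proof -
    have cw: "c + d < w" using w by (simp add: d_def) (simp add: field_simps abs_if split: if_splits)
    have int: "integrable M (\<lambda>\<omega>. X \<omega> / (w - X \<omega>))" "integrable M (\<lambda>\<omega>. X \<omega> / (y - X \<omega>))"
      using resolvent_bounds(1)[OF X AE_X] cw d y by auto
    \<comment> \<open>The remainder equals \<open>X (w - y)\<^sup>2 / ((w - X) (y - X)\<^sup>2)\<close> pointwise.\<close>
    define f where "f = (\<lambda>\<omega>. X \<omega> / (w - X \<omega>) - X \<omega> / (y - X \<omega>) + (w - y) * (X \<omega> / (y - X \<omega>)\<^sup>2))"
    have int_f: "integrable M f"
      unfolding f_def using int int_D
      by (intro Bochner_Integration.integrable_add Bochner_Integration.integrable_diff
          integrable_mult_right)
    have "AE \<omega> in M. \<bar>f \<omega>\<bar> \<le> c / d ^ 3 * (w - y)\<^sup>2"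
      using AE_X
    proof eventually_elim
      case (elim \<omega>)
      define p q where "p = w - X \<omega>" and "q = y - X \<omega>"
      have pq: "d \<le> p" "d \<le> q"
        using elim cw y d by (auto simp: p_def q_def d_def field_simps)
      have p0: "0 < p" "0 < q" using pq d by auto
      have "f \<omega> = X \<omega> / p - X \<omega> / q + (p - q) * (X \<omega> / q\<^sup>2)"
        by (simp add: f_def p_def q_def)
      also have "\<dots> = X \<omega> / (p * q\<^sup>2) * (p - q)\<^sup>2"
        using p0 by (simp add: field_simps power2_eq_square)
      finally have f: "f \<omega> = X \<omega> / (p * q\<^sup>2) * (w - y)\<^sup>2"
        by (simp add: p_def q_def)
      have "d * d\<^sup>2 \<le> p * q\<^sup>2"
        using pq d by (intro mult_mono power_mono) auto
      then have "X \<omega> / (p * q\<^sup>2) \<le> c / d ^ 3"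
        using elim d by (intro frac_le) (auto simp: power3_eq_cube power2_eq_square)
      moreover have "0 \<le> X \<omega> / (p * q\<^sup>2)"
        using elim p0 by simp
      ultimately show ?case
        unfolding f abs_mult abs_power2 by (intro mult_right_mono zero_le_power2) (simp only: abs_of_nonneg)
    qed
    then have "(\<integral>\<omega>. \<bar>f \<omega>\<bar> \<partial>M) \<le> (\<integral>\<omega>. c / d ^ 3 * (w - y)\<^sup>2 \<partial>M)"
      using int_f by (intro integral_mono_AE) auto
    also have "\<dots> = c / d ^ 3 * (w - y)\<^sup>2"
      by (simp add: prob_space)
    finally have "(\<integral>\<omega>. \<bar>f \<omega>\<bar> \<partial>M) \<le> c / d ^ 3 * (w - y)\<^sup>2" .
    with integral_abs_bound[of M f] have "\<bar>\<integral>\<omega>. f \<omega> \<partial>M\<bar> \<le> c / d ^ 3 * (w - y)\<^sup>2"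
      by (rule order_trans)
    moreover have "F w - F y - (w - y) * (- D) = (\<integral>\<omega>. f \<omega> \<partial>M)"
    proof -
      have "(\<integral>\<omega>. f \<omega> \<partial>M) = (\<integral>\<omega>. X \<omega> / (w - X \<omega>) - X \<omega> / (y - X \<omega>) \<partial>M) +
          (\<integral>\<omega>. (w - y) * (X \<omega> / (y - X \<omega>)\<^sup>2) \<partial>M)"
        unfolding f_def using int int_D
        by (intro Bochner_Integration.integral_add Bochner_Integration.integrable_diff
            integrable_mult_right)
      also have "(\<integral>\<omega>. X \<omega> / (w - X \<omega>) - X \<omega> / (y - X \<omega>) \<partial>M) = F w - F y"
        unfolding F_def using int by (rule Bochner_Integration.integral_diff)
      also have "(\<integral>\<omega>. (w - y) * (X \<omega> / (y - X \<omega>)\<^sup>2) \<partial>M) = (w - y) * D"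
        unfolding D_def by (rule integral_mult_right_zero)
      finally show ?thesis by simp
    qed
    ultimately show ?thesis by simp
  qed
  have "(F has_real_derivative - D) (at y)"
    unfolding has_field_derivative_iff
  proof (rule LIM_zero_cancel, rule Lim_null_comparison)
    show "\<forall>\<^sub>F w in at y. norm ((F w - F y) / (w - y) - - D) \<le> c / d ^ 3 * \<bar>w - y\<bar>"
      unfolding eventually_at
    proof (intro exI[of _ d] conjI ballI impI d)
      fix w assume w: "w \<noteq> y \<and> dist w y < d"
      then have "(F w - F y) / (w - y) - - D = (F w - F y - (w - y) * (- D)) / (w - y)"
        by (simp add: field_simps)
      then have "norm ((F w - F y) / (w - y) - - D) = \<bar>F w - F y - (w - y) * (- D)\<bar> / \<bar>w - y\<bar>"
        by (simp only: real_norm_def abs_divide)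
      also have "\<dots> \<le> c / d ^ 3 * (w - y)\<^sup>2 / \<bar>w - y\<bar>"
        using quadratic[of w] w by (intro divide_right_mono) (auto simp: dist_real_def)
      also have "\<dots> = c / d ^ 3 * \<bar>w - y\<bar>"
      proof -
        have sq: "(w - y)\<^sup>2 = \<bar>w - y\<bar>\<^sup>2" by simp
        have "\<bar>w - y\<bar> \<noteq> 0" using w by simp
        then show ?thesis
          unfolding sq unfolding power2_eq_square mult.assoc[symmetric] by (rule nonzero_mult_div_cancel_right)
      qed
      finally show "norm ((F w - F y) / (w - y) - - D) \<le> c / d ^ 3 * \<bar>w - y\<bar>" .
    qed
    have "((\<lambda>w. c / d ^ 3 * \<bar>w - y\<bar>) \<longlongrightarrow> c / d ^ 3 * \<bar>y - y\<bar>) (at y)"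
      by (intro tendsto_intros)
    then show "((\<lambda>w. c / d ^ 3 * \<bar>w - y\<bar>) \<longlongrightarrow> 0) (at y)" by simp
  qed
  then show "((\<lambda>y. \<integral>\<omega>. X \<omega> / (y - X \<omega>) \<partial>M) has_real_derivative - D) (at y)"
    by (simp add: F_def)
qed

text \<open>The intermediate value property of derivatives: if the derivative took both signs, an extremum
  over the interval between two such points would lie in its interior, where the derivative would be zero.\<close>

lemma derivative_sign_constant:
  fixes h h' :: "real \<Rightarrow> real"
  assumes der: "\<And>z. z \<in> {a<..<b} \<Longrightarrow> (h has_real_derivative h' z) (at z)"
    and nz: "\<And>z. z \<in> {a<..<b} \<Longrightarrow> h' z \<noteq> 0"
  shows "(\<forall>z\<in>{a<..<b}. 0 < h' z) \<or> (\<forall>z\<in>{a<..<b}. h' z < 0)"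
proof (rule ccontr)
  assume "\<not> ?thesis"
  then obtain x y where xy: "x \<in> {a<..<b}" "y \<in> {a<..<b}" "h' x < 0" "0 < h' y"
    using nz by (metis linorder_less_linear)
  then have "x \<noteq> y" by auto
  define u v where "u = min x y" and "v = max x y"
  have uv: "u < v" "{u..v} \<subseteq> {a<..<b}"
    using xy \<open>x \<noteq> y\<close> by (auto simp: u_def v_def min_def max_def)
  have cont: "continuous_on {u..v} h"
    using DERIV_isCont[OF der] uv(2) by (intro continuous_at_imp_continuous_on) blast
  have no_inner: False
    if "x' \<in> {u<..<v}" "(\<forall>z\<in>{u..v}. h x' \<le> h z) \<or> (\<forall>z\<in>{u..v}. h z \<le> h x')" for x'
  proof -
    have x': "x' \<in> {a<..<b}" using that(1) subsetD[OF uv(2), of x'] by simp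
    define \<epsilon> where "\<epsilon> = min (x' - u) (v - x')"
    have \<epsilon>: "0 < \<epsilon>" using that by (auto simp: \<epsilon>_def)
    have near: "z \<in> {u..v}" if "\<bar>x' - z\<bar> < \<epsilon>" for z
      using that by (auto simp: \<epsilon>_def)
    have "h' x' = 0"
      using that(2)
    proof
      assume "\<forall>z\<in>{u..v}. h x' \<le> h z"
      then show ?thesis using DERIV_local_min[OF der[OF x'] \<epsilon>] near by blast
    next
      assume "\<forall>z\<in>{u..v}. h z \<le> h x'"
      then show ?thesis using DERIV_local_max[OF der[OF x'] \<epsilon>] near by blast
    qed
    with nz[OF x'] show False by simp
  qed
  obtain lo where lo: "lo \<in> {u..v}" "\<forall>z\<in>{u..v}. h lo \<le> h z"
    using continuous_attains_inf[OF compact_Icc _ cont] uv by auto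
  obtain hi where hi: "hi \<in> {u..v}" "\<forall>z\<in>{u..v}. h z \<le> h hi"
    using continuous_attains_sup[OF compact_Icc _ cont] uv by auto
  have lo_end: "lo = u \<or> lo = v" and hi_end: "hi = u \<or> hi = v"
    using no_inner[of lo] no_inner[of hi] lo hi by force+
  have uI: "u \<in> {a<..<b}" and vI: "v \<in> {a<..<b}"
    using uv(1) subsetD[OF uv(2), of u] subsetD[OF uv(2), of v] by simp_all
  show False
  proof (cases "x < y")
    case True
    then have x: "x = u" "y = v" by (auto simp: u_def v_def)
    obtain d where d: "0 < d" "\<And>e. 0 < e \<Longrightarrow> e < d \<Longrightarrow> h (u + e) < h u"
      using DERIV_neg_dec_right[OF der[OF uI]] xy x by auto
    obtain d' where d': "0 < d'" "\<And>e. 0 < e \<Longrightarrow> e < d' \<Longrightarrow> h (v - e) < h v"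
      using DERIV_pos_inc_left[OF der[OF vI]] xy x by auto
    define e where "e = min (min d d') (v - u) / 2"
    have "0 < e" "e \<le> d / 2" "e \<le> d' / 2" "e \<le> (v - u) / 2"
      using d(1) d'(1) uv(1) by (auto simp: e_def)
    then have e: "0 < e" "e < d" "e < d'" "u + e \<in> {u..v}" "v - e \<in> {u..v}"
      using d(1) d'(1) uv(1) by auto
    show False
      using lo_end bspec[OF lo(2) e(4)] bspec[OF lo(2) e(5)] d(2)[OF e(1,2)] d'(2)[OF e(1,3)]
      by (elim disjE) simp_all
  next
    case False
    then have x: "x = v" "y = u" by (auto simp: u_def v_def)
    obtain d where d: "0 < d" "\<And>e. 0 < e \<Longrightarrow> e < d \<Longrightarrow> h u < h (u + e)"
      using DERIV_pos_inc_right[OF der[OF uI]] xy x by auto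
    obtain d' where d': "0 < d'" "\<And>e. 0 < e \<Longrightarrow> e < d' \<Longrightarrow> h v < h (v - e)"
      using DERIV_neg_dec_left[OF der[OF vI]] xy x by auto
    define e where "e = min (min d d') (v - u) / 2"
    have "0 < e" "e \<le> d / 2" "e \<le> d' / 2" "e \<le> (v - u) / 2"
      using d(1) d'(1) uv(1) by (auto simp: e_def)
    then have e: "0 < e" "e < d" "e < d'" "u + e \<in> {u..v}" "v - e \<in> {u..v}"
      using d(1) d'(1) uv(1) by auto
    show False
      using hi_end bspec[OF hi(2) e(4)] bspec[OF hi(2) e(5)] d(2)[OF e(1,2)] d'(2)[OF e(1,3)]
      by (elim disjE) simp_all
  qed
qed

text \<open>The analytic core of the lower bound. At a stationary point of \<open>h\<close>, the function \<open>h - x P\<close> can be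
  lowered strictly by moving off \<open>z\<close> when \<open>x > 0\<close>, by an amount bounded below as long as \<open>x\<close> is bounded
  away from zero; for small \<open>x\<close> the value at \<open>z\<close> itself stays above \<open>y < h z\<close>.\<close>

lemma stationary_point_gap:
  fixes h P :: "real \<Rightarrow> real"
  assumes h: "(h has_real_derivative 0) (at z)" and P: "(P has_real_derivative p) (at z)" "p \<noteq> 0"
    and I: "open I" "z \<in> I" and pos: "0 < P z" and y: "y < h z"
  obtains \<eta> where "0 < \<eta>"
    "\<And>x. 0 \<le> x \<Longrightarrow> h z - x * P z - \<eta> \<le> y \<Longrightarrow> \<exists>w\<in>I. h w - x * P w < h z - x * P z - \<eta>"
proof -
  \<comment> \<open>Below \<open>x0\<close> the term \<open>x P z\<close> costs less than half of \<open>h z - y\<close>.\<close>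
  define x0 where "x0 = (h z - y) / (2 * P z)"
  have x0: "0 < x0" "x0 * P z = (h z - y) / 2"
    using pos y by (auto simp: x0_def)
  have k: "((\<lambda>w. x0 * P w - h w) has_real_derivative x0 * p - 0) (at z)"
    by (intro DERIV_diff DERIV_cmult h P)
  obtain r where r: "0 < r" "ball z r \<subseteq> I"
    using I openE by blast
  obtain w where w: "w \<in> I" "x0 * P z - h z < x0 * P w - h w" "P z < P w"
  proof (cases "0 < p")
    case True
    obtain d where d: "0 < d" "\<And>e. 0 < e \<Longrightarrow> e < d \<Longrightarrow> x0 * P z - h z < x0 * P (z + e) - h (z + e)"
      using DERIV_pos_inc_right[OF k] True x0 by auto
    obtain d' where d': "0 < d'" "\<And>e. 0 < e \<Longrightarrow> e < d' \<Longrightarrow> P z < P (z + e)"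
      using DERIV_pos_inc_right[OF P(1) True] by auto
    define e where "e = min (min d d') r / 2"
    have e: "0 < e" "e < d" "e < d'" "e < r" using d d' r by (auto simp: e_def)
    then have "z + e \<in> I" using r(2) by (auto simp: dist_real_def)
    with d(2)[OF e(1,2)] d'(2)[OF e(1,3)] that show ?thesis by blast
  next
    case False
    then have p: "p < 0" using P(2) by simp
    obtain d where d: "0 < d" "\<And>e. 0 < e \<Longrightarrow> e < d \<Longrightarrow> x0 * P z - h z < x0 * P (z - e) - h (z - e)"
      using DERIV_neg_dec_left[OF k] p x0 by (auto simp: mult_pos_neg)
    obtain d' where d': "0 < d'" "\<And>e. 0 < e \<Longrightarrow> e < d' \<Longrightarrow> P z < P (z - e)"
      using DERIV_neg_dec_left[OF P(1) p] by auto
    define e where "e = min (min d d') r / 2"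
    have e: "0 < e" "e < d" "e < d'" "e < r" using d d' r by (auto simp: e_def)
    then have "z - e \<in> I" using r(2) by (auto simp: dist_real_def)
    with d(2)[OF e(1,2)] d'(2)[OF e(1,3)] that show ?thesis by blast
  qed
  \<comment> \<open>As \<open>P z < P w\<close>, the gain at \<open>w\<close> grows with \<open>x\<close>, so the gain at \<open>x0\<close> is a bound for all larger \<open>x\<close>.\<close>
  define gap where "gap = x0 * P w - h w - (x0 * P z - h z)"
  define \<eta> where "\<eta> = min gap (h z - y) / 3"
  have \<eta>: "0 < \<eta>" "\<eta> < gap" "\<eta> < (h z - y) / 2"
    using w(2) y by (auto simp: \<eta>_def gap_def min_def field_simps)
  show ?thesis
  proof (rule that[OF \<eta>(1)])
    fix x assume x: "0 \<le> x" "h z - x * P z - \<eta> \<le> y"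
    have "x0 * P z \<le> x * P z"
      using x(2) x0(2) \<eta>(3) by (simp add: field_simps)
    then have "x0 \<le> x" using pos by simp
    then have "x0 * (P w - P z) \<le> x * (P w - P z)"
      using w(3) by (intro mult_right_mono) auto
    then have "gap \<le> x * P w - h w - (x * P z - h z)"
      by (simp add: gap_def algebra_simps)
    then show "\<exists>w\<in>I. h w - x * P w < h z - x * P z - \<eta>"
      using w(1) \<eta>(2) by (intro bexI[of _ w]) auto
  qed
qed

text \<open>A reverse Fatou lemma, by dominated convergence of the positive parts.\<close>

lemma (in prob_space) eventually_integral_less:
  fixes f :: "nat \<Rightarrow> 'a \<Rightarrow> real"
  assumes int: "\<And>n. integrable M (f n)" and bound: "\<And>n x. f n x \<le> K"
    and lim: "AE x in M. \<forall>\<epsilon>>0. \<forall>\<^sub>F n in sequentially. f n x \<le> \<epsilon>"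
    and \<epsilon>: "0 < \<epsilon>"
  shows "\<forall>\<^sub>F n in sequentially. (\<integral>x. f n x \<partial>M) < \<epsilon>"
proof -
  have int_max: "integrable M (\<lambda>x. max 0 (f n x))" for n
    using int by (intro integrable_max) auto
  have "(\<lambda>n. \<integral>x. max 0 (f n x) \<partial>M) \<longlonglongrightarrow> (\<integral>x. 0 \<partial>M)"
  proof (rule integral_dominated_convergence)
    show "integrable M (\<lambda>_. max 0 K)" by simp
    show "AE x in M. norm (max 0 (f n x)) \<le> max 0 K" for n
      using bound[of n] by (auto simp: max_def intro: order_trans)
    show "AE x in M. (\<lambda>n. max 0 (f n x)) \<longlonglongrightarrow> 0"
      using lim
    proof eventually_elim
      case (elim x)
      show ?case
      proof (rule order_tendstoI)
        fix a :: real assume "a < 0"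
        then show "\<forall>\<^sub>F n in sequentially. a < max 0 (f n x)"
          by (intro always_eventually) (auto simp: less_max_iff_disj)
      next
        fix a :: real assume a: "0 < a"
        then have "\<forall>\<^sub>F n in sequentially. f n x \<le> a / 2"
          using elim half_gt_zero by blast
        then show "\<forall>\<^sub>F n in sequentially. max 0 (f n x) < a"
          by eventually_elim (use a in auto)
      qed
    qed
  qed (use int_max in \<open>auto intro: borel_measurable_integrable\<close>)
  then have "\<forall>\<^sub>F n in sequentially. (\<integral>x. max 0 (f n x) \<partial>M) < \<epsilon>"
    using \<epsilon> by (intro order_tendstoD(2)) auto
  then show ?thesis
  proof eventually_elim
    case (elim n)
    have "(\<integral>x. f n x \<partial>M) \<le> (\<integral>x. max 0 (f n x) \<partial>M)"
      using int int_max by (intro integral_mono) auto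
    with elim show ?case by simp
  qed
qed

section \<open>The shape function of a corner growth model\<close>

lemma quenched_tail_mono:
  assumes "1 \<le> m" "1 \<le> n" "m \<le> m'" "n \<le> n'"
  shows "quenched_tail a b m n y \<le> quenched_tail a b m' n' y"
proof -
  let ?P = "Pi_pmf ({1..m'} \<times> {1..n'}) 0 (\<lambda>x. geo (case x of (i, j) \<Rightarrow> a i * b j))"
  have "quenched_tail a b m n y = measure_pmf.prob ?P {W. y \<le> real (last_passage W m n)}"
    using assms by (intro prob_reindexed_last_passage[where h = "\<lambda>p. p", symmetric]) auto
  also have "\<dots> \<le> measure_pmf.prob ?P {W. y \<le> real (last_passage W m' n')}"
    using last_passage_mono[OF assms]
    by (intro measure_pmf.finite_measure_mono Collect_mono) (auto intro: order_trans)
  also have "\<dots> = quenched_tail a b m' n' y"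
    by (intro prob_reindexed_last_passage[where h = "\<lambda>p. p"]) auto
  finally show ?thesis .
qed

text \<open>The facts about the random environment that the argument uses. They are invariant under
  exchanging \<open>a\<close> with \<open>b\<close>, \<open>\<alpha>\<close> with \<open>\<beta>\<close> and the arguments of \<open>g\<close>; the assumptions \<open>near_\<alpha>\<close> and
  \<open>near_\<beta>\<close> say that \<open>\<alpha>\<close> and \<open>\<beta>\<close> are the right endpoints of stationary marginals.\<close>

locale corner = prob_space M
  for M :: "'w measure" and a b :: "'w \<Rightarrow> nat \<Rightarrow> real" and \<alpha> \<beta> :: real
    and g :: "real \<Rightarrow> real \<Rightarrow> ennreal" +
  assumes params: "AE \<omega> in M. params_upto \<alpha> (a \<omega>)" "AE \<omega> in M. params_upto \<beta> (b \<omega>)"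
    and endpoint_product: "\<alpha> * \<beta> < 1"
    and measurable_a: "\<And>i. 1 \<le> i \<Longrightarrow> (\<lambda>\<omega>. a \<omega> i) \<in> borel_measurable M"
    and measurable_b: "\<And>j. 1 \<le> j \<Longrightarrow> (\<lambda>\<omega>. b \<omega> j) \<in> borel_measurable M"
    and near_\<alpha>: "\<And>\<theta>. \<theta> < \<alpha> \<Longrightarrow> \<exists>p>0. \<forall>i\<ge>1. prob {\<omega> \<in> space M. \<theta> < a \<omega> i} = p"
    and near_\<beta>: "\<And>\<theta>. \<theta> < \<beta> \<Longrightarrow> \<exists>p>0. \<forall>j\<ge>1. prob {\<omega> \<in> space M. \<theta> < b \<omega> j} = p"
    and average_a: "\<And>\<phi> :: real \<Rightarrow> real. \<phi> \<in> borel_measurable borel \<Longrightarrow> integrable M (\<lambda>\<omega>. \<phi> (a \<omega> 1)) \<Longrightarrow>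
      AE \<omega> in M. (\<lambda>n. (\<Sum>i\<in>{0<..n}. \<phi> (a \<omega> i)) / real n) \<longlonglongrightarrow> (\<integral>\<omega>. \<phi> (a \<omega> 1) \<partial>M)"
    and average_b: "\<And>\<phi> :: real \<Rightarrow> real. \<phi> \<in> borel_measurable borel \<Longrightarrow> integrable M (\<lambda>\<omega>. \<phi> (b \<omega> 1)) \<Longrightarrow>
      AE \<omega> in M. (\<lambda>n. (\<Sum>j\<in>{0<..n}. \<phi> (b \<omega> j)) / real n) \<longlonglongrightarrow> (\<integral>\<omega>. \<phi> (b \<omega> 1) \<partial>M)"
    and tail_measurable: "\<And>k l m n y.
      (\<lambda>\<omega>. quenched_tail (\<lambda>i. a \<omega> (i + k)) (\<lambda>j. b \<omega> (j + l)) m n y) \<in> borel_measurable M"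
    and tail_stationary: "\<And>k l m n y.
      (\<integral>\<omega>. quenched_tail (\<lambda>i. a \<omega> (i + k)) (\<lambda>j. b \<omega> (j + l)) m n y \<partial>M) =
      (\<integral>\<omega>. quenched_tail (a \<omega>) (b \<omega>) m n y \<partial>M)"
    and tail_above: "\<And>s t y. 0 < s \<Longrightarrow> 0 < t \<Longrightarrow> ennreal y < g s t \<Longrightarrow>
      (\<lambda>N. \<integral>\<omega>. quenched_tail (a \<omega>) (b \<omega>) (scaled s N) (scaled t N) (real N * y) \<partial>M) \<longlonglongrightarrow> 1"
    and tail_below: "\<And>s t y. 0 < s \<Longrightarrow> 0 < t \<Longrightarrow> g s t < ennreal y \<Longrightarrow>
      (\<lambda>N. \<integral>\<omega>. quenched_tail (a \<omega>) (b \<omega>) (scaled s N) (scaled t N) (real N * y) \<partial>M) \<longlonglongrightarrow> 0"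
begin

lemma transposed: "corner M b a \<beta> \<alpha> (\<lambda>s t. g t s)"
proof unfold_locales
  fix k l m n :: nat and y :: real
  show "(\<lambda>\<omega>. quenched_tail (\<lambda>i. b \<omega> (i + k)) (\<lambda>j. a \<omega> (j + l)) m n y) \<in> borel_measurable M"
    using tail_measurable[of l k n m y] by (simp add: quenched_tail_swap[of "\<lambda>j. b _ (j + k)"])
  show "(\<integral>\<omega>. quenched_tail (\<lambda>i. b \<omega> (i + k)) (\<lambda>j. a \<omega> (j + l)) m n y \<partial>M) =
      (\<integral>\<omega>. quenched_tail (b \<omega>) (a \<omega>) m n y \<partial>M)"
    using tail_stationary[of l k n m y] by (simp add: quenched_tail_swap[where n = m])
next
  fix s t y :: real assume "0 < s" "0 < t"
  then show "(\<lambda>N. \<integral>\<omega>. quenched_tail (b \<omega>) (a \<omega>) (scaled s N) (scaled t N) (real N * y) \<partial>M) \<longlonglongrightarrow> 1"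
    if "ennreal y < g t s"
    using tail_above[of t s y] that by (simp add: quenched_tail_swap[where b = "b _"])
  show "(\<lambda>N. \<integral>\<omega>. quenched_tail (b \<omega>) (a \<omega>) (scaled s N) (scaled t N) (real N * y) \<partial>M) \<longlonglongrightarrow> 0"
    if "g t s < ennreal y"
    using tail_below[of t s y] that \<open>0 < s\<close> \<open>0 < t\<close> by (simp add: quenched_tail_swap[where b = "b _"])
qed (use params endpoint_product measurable_a measurable_b near_\<alpha> near_\<beta> average_a average_b
    in \<open>auto simp: mult.commute\<close>)

definition A :: "real \<Rightarrow> real" where
  "A z = (\<integral>\<omega>. (a \<omega> 1 / z) / (1 - a \<omega> 1 / z) \<partial>M)"

definition B :: "real \<Rightarrow> real" where
  "B z = (\<integral>\<omega>. (b \<omega> 1 * z) / (1 - b \<omega> 1 * z) \<partial>M)"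

definition Z :: "real set" where
  "Z = {\<alpha><..<1 / \<beta>}"

definition stationary_mean :: "real \<Rightarrow> real \<Rightarrow> real \<Rightarrow> real" where
  "stationary_mean s t z = s * A z + t * B z"

lemma endpoints_pos: "0 < \<alpha>" "0 < \<beta>"
proof -
  have "AE \<omega> in M. 0 < \<alpha> \<and> 0 < \<beta>"
    using params by eventually_elim (auto intro: params_upto_pos)
  then show "0 < \<alpha>" "0 < \<beta>" by auto
qed

lemma Z_iff: "z \<in> Z \<longleftrightarrow> \<alpha> < z \<and> \<beta> * z < 1"
  using endpoints_pos by (auto simp: Z_def field_simps)

lemma open_Z: "open Z"
  by (simp add: Z_def)

lemma Z_nonempty: "Z \<noteq> {}"
proof -
  have "\<alpha> < 1 / \<beta>" using endpoint_product endpoints_pos by (simp add: field_simps)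
  then show ?thesis by (simp add: Z_def)
qed

lemma B_conv: "0 < z \<Longrightarrow> B z = (\<integral>\<omega>. b \<omega> 1 / (1 / z - b \<omega> 1) \<partial>M)"
  unfolding B_def by (intro Bochner_Integration.integral_cong) (auto simp: field_simps)

lemma A_conv: "0 < z \<Longrightarrow> A z = (\<integral>\<omega>. a \<omega> 1 / (z - a \<omega> 1) \<partial>M)"
  unfolding A_def by (intro Bochner_Integration.integral_cong) (auto simp: field_simps)

lemma params_1: "AE \<omega> in M. 0 < a \<omega> 1 \<and> a \<omega> 1 \<le> \<alpha>" "AE \<omega> in M. 0 < b \<omega> 1 \<and> b \<omega> 1 \<le> \<beta>"
  using params by (auto simp: params_upto_def)

lemma A_facts:
  assumes "\<alpha> < z"
  shows "integrable M (\<lambda>\<omega>. (a \<omega> 1 / z) / (1 - a \<omega> 1 / z))" "0 < A z"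
proof -
  have z: "0 < z" using assms endpoints_pos by simp
  have eq: "(a \<omega> 1 / z) / (1 - a \<omega> 1 / z) = a \<omega> 1 / (z - a \<omega> 1)" for \<omega>
    using z by (simp add: field_simps)
  note r = resolvent_bounds[OF measurable_a[of 1] params_1(1) assms]
  show "integrable M (\<lambda>\<omega>. (a \<omega> 1 / z) / (1 - a \<omega> 1 / z))"
    unfolding eq using r by simp
  show "0 < A z"
    using r z by (simp add: A_conv)
qed

lemma B_facts:
  assumes "0 < z" "\<beta> * z < 1"
  shows "integrable M (\<lambda>\<omega>. (b \<omega> 1 * z) / (1 - b \<omega> 1 * z))" "0 < B z"
proof -
  have z: "\<beta> < 1 / z" using assms by (simp add: field_simps)
  have eq: "(b \<omega> 1 * z) / (1 - b \<omega> 1 * z) = b \<omega> 1 / (1 / z - b \<omega> 1)" for \<omega>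
    using assms by (simp add: field_simps)
  note r = resolvent_bounds[OF measurable_b[of 1] params_1(2) z]
  show "integrable M (\<lambda>\<omega>. (b \<omega> 1 * z) / (1 - b \<omega> 1 * z))"
    unfolding eq using r by simp
  show "0 < B z"
    using r assms by (simp add: B_conv)
qed

lemma A_derivative:
  assumes "\<alpha> < z"
  obtains D where "D < 0" "(A has_real_derivative D) (at z)"
proof -
  obtain D where D: "0 < D" "((\<lambda>y. \<integral>\<omega>. a \<omega> 1 / (y - a \<omega> 1) \<partial>M) has_real_derivative - D) (at z)"
    by (rule resolvent_derivative[OF measurable_a[of 1] params_1(1) assms]) auto
  have "0 < z" using assms endpoints_pos by simp
  then have "\<forall>\<^sub>F y in nhds z. A y = (\<integral>\<omega>. a \<omega> 1 / (y - a \<omega> 1) \<partial>M)"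
    by (intro eventually_mono[OF eventually_nhds_in_open[of "{0<..}"]] A_conv) auto
  with D(2) have "(A has_real_derivative - D) (at z)"
    by (subst DERIV_cong_ev[OF refl _ refl])
  with D(1) show ?thesis by (intro that[of "- D"]) auto
qed

lemma B_derivative:
  assumes "0 < z" "\<beta> * z < 1"
  obtains D where "0 < D" "(B has_real_derivative D) (at z)"
proof -
  have z: "\<beta> < 1 / z" using assms by (simp add: field_simps)
  obtain D where D: "0 < D" "((\<lambda>y. \<integral>\<omega>. b \<omega> 1 / (y - b \<omega> 1) \<partial>M) has_real_derivative - D) (at (1 / z))"
    by (rule resolvent_derivative[OF measurable_b[of 1] params_1(2) z]) auto
  have "((\<lambda>z. 1 / z) has_real_derivative - (1 / z\<^sup>2)) (at z)"
    using assms by (auto intro!: derivative_eq_intros simp: power2_eq_square)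
  from DERIV_chain2[OF D(2) this]
  have "((\<lambda>z. \<integral>\<omega>. b \<omega> 1 / (1 / z - b \<omega> 1) \<partial>M) has_real_derivative - D * - (1 / z\<^sup>2)) (at z)" .
  moreover have "\<forall>\<^sub>F y in nhds z. B y = (\<integral>\<omega>. b \<omega> 1 / (1 / y - b \<omega> 1) \<partial>M)"
    using assms by (intro eventually_mono[OF eventually_nhds_in_open[of "{0<..}"]] B_conv) auto
  ultimately have "(B has_real_derivative - D * - (1 / z\<^sup>2)) (at z)"
    by (subst DERIV_cong_ev[OF refl _ refl])
  moreover have "0 < - D * - (1 / z\<^sup>2)" using D assms by simp
  ultimately show ?thesis using that by blast
qed

lemma stationary_mean_pos: "0 < s \<Longrightarrow> 0 < t \<Longrightarrow> z \<in> Z \<Longrightarrow> 0 < stationary_mean s t z"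
  using A_facts(2)[of z] B_facts(2)[of z] endpoints_pos
  by (auto simp: Z_iff stationary_mean_def intro!: add_pos_pos)

lemma average_A:
  assumes "\<alpha> < z"
  shows "AE \<omega> in M. (\<lambda>n. (\<Sum>i\<in>{0<..n}. (a \<omega> i / z) / (1 - a \<omega> i / z)) / real n) \<longlonglongrightarrow> A z"
  using average_a[of "\<lambda>x. (x / z) / (1 - x / z)"] A_facts(1)[OF assms] by (simp add: A_def)

lemma average_B:
  assumes "0 < z" "\<beta> * z < 1"
  shows "AE \<omega> in M. (\<lambda>n. (\<Sum>j\<in>{0<..n}. (b \<omega> j * z) / (1 - b \<omega> j * z)) / real n) \<longlonglongrightarrow> B z"
  using average_b[of "\<lambda>x. (x * z) / (1 - x * z)"] B_facts(1)[OF assms] by (simp add: B_def)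

lemma tail_integrable:
  "integrable M (\<lambda>\<omega>. quenched_tail (\<lambda>i. a \<omega> (i + k)) (\<lambda>j. b \<omega> (j + l)) m n y)"
  by (rule integrable_const_bound[where B = 1])
     (auto simp: quenched_tail_bounds tail_measurable)

lemma tail_integrable_0: "integrable M (\<lambda>\<omega>. quenched_tail (a \<omega>) (b \<omega>) m n y)"
  using tail_integrable[of 0 0 m n y] by simp

section \<open>The upper bound\<close>

text \<open>Markov's inequality bounds \<open>y\<close> times the tail at height \<open>N y\<close> by an average that tends to
  \<open>h(z)\<close>. For \<open>y\<close> below \<open>g s t\<close> the tail tends to one.\<close>

lemma shape_le_stationary_mean:
  assumes st: "0 < s" "0 < t" and z: "z \<in> Z"
  shows "g s t \<le> ennreal (stationary_mean s t z)"
proof (rule ccontr)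
  define h where "h = stationary_mean s t z"
  assume "\<not> g s t \<le> ennreal (stationary_mean s t z)"
  then have "ennreal h < g s t" by (simp add: h_def)
  then obtain x where x: "ennreal h < x" "x < g s t" using dense by blast
  then obtain y where y: "x = ennreal y" "0 \<le> y"
    by (cases x) auto
  have h0: "0 < h" unfolding h_def by (rule stationary_mean_pos[OF st z])
  have hy: "h < y" using x y h0 by (simp add: ennreal_less_iff)
  then have y0: "0 < y" using h0 by simp
  have zz: "\<alpha> < z" "\<beta> * z < 1" "0 < z"
    using z endpoints_pos by (auto simp: Z_iff)
  define f where "f = (\<lambda>N \<omega>. y * quenched_tail (a \<omega>) (b \<omega>) (scaled s N) (scaled t N) (real N * y) - h)"
  have "\<forall>\<^sub>F N in sequentially. (\<integral>\<omega>. f N \<omega> \<partial>M) < (y - h) / 2"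
  proof (rule eventually_integral_less)
    show "integrable M (f N)" for N
      unfolding f_def using tail_integrable_0 by simp
    show "f N \<omega> \<le> y" for N \<omega>
    proof -
      have "y * quenched_tail (a \<omega>) (b \<omega>) (scaled s N) (scaled t N) (real N * y) \<le> y * 1"
        using y0 by (intro mult_left_mono quenched_tail_bounds) auto
      then show ?thesis using h0 by (simp add: f_def)
    qed
    show "AE \<omega> in M. \<forall>\<epsilon>>0. \<forall>\<^sub>F N in sequentially. f N \<omega> \<le> \<epsilon>"
      using params average_A[OF zz(1)] average_B[OF zz(3,2)]
    proof eventually_elim
      case (elim \<omega>)
      let ?S = "\<lambda>N. (\<Sum>i\<in>{0<..scaled s N}. (a \<omega> i / z) / (1 - a \<omega> i / z)) / real N +
          (\<Sum>j\<in>{0<..scaled t N}. (b \<omega> j * z) / (1 - b \<omega> j * z)) / real N"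
      have lim: "?S \<longlonglongrightarrow> h"
        unfolding h_def stationary_mean_def using st
        by (intro tendsto_add tendsto_partial_sums_along elim tendsto_scaled) auto
      show ?case
      proof (intro allI impI)
        fix \<epsilon> :: real assume "0 < \<epsilon>"
        then have "\<forall>\<^sub>F N in sequentially. ?S N < h + \<epsilon>"
          using lim by (intro order_tendstoD(2)) auto
        moreover have "\<forall>\<^sub>F N in sequentially. 0 < N \<and> 1 \<le> scaled s N \<and> 1 \<le> scaled t N"
          using st by (intro eventually_conj eventually_gt_at_top eventually_scaled_ge)
        ultimately show "\<forall>\<^sub>F N in sequentially. f N \<omega> \<le> \<epsilon>"
        proof eventually_elim
          case (elim N)
          have "real N * y * quenched_tail (a \<omega>) (b \<omega>) (scaled s N) (scaled t N) (real N * y) \<le>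
              (\<Sum>i\<in>{0<..scaled s N}. (a \<omega> i / z) / (1 - a \<omega> i / z)) +
              (\<Sum>j\<in>{0<..scaled t N}. (b \<omega> j * z) / (1 - b \<omega> j * z))"
            using elim y0 by (intro quenched_tail_markov[OF \<open>params_upto \<alpha> (a \<omega>)\<close> \<open>params_upto \<beta> (b \<omega>)\<close> zz(1,2)]) auto
          then have "y * quenched_tail (a \<omega>) (b \<omega>) (scaled s N) (scaled t N) (real N * y) \<le> ?S N"
            using elim(2) by (simp add: add_divide_distrib[symmetric] pos_le_divide_eq mult_ac)
          then show ?case using elim(1) by (simp add: f_def)
        qed
      qed
    qed
  qed (use hy in auto)
  then have "\<forall>\<^sub>F N in sequentially.
      y * (\<integral>\<omega>. quenched_tail (a \<omega>) (b \<omega>) (scaled s N) (scaled t N) (real N * y) \<partial>M) - h < (y - h) / 2"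
    unfolding f_def using tail_integrable_0 by (simp add: prob_space)
  moreover have "(\<lambda>N. y * (\<integral>\<omega>. quenched_tail (a \<omega>) (b \<omega>) (scaled s N) (scaled t N) (real N * y) \<partial>M) - h)
      \<longlonglongrightarrow> y * 1 - h"
    using x y by (intro tendsto_intros tail_above st) auto
  then have "\<forall>\<^sub>F N in sequentially. (y - h) / 2 <
      y * (\<integral>\<omega>. quenched_tail (a \<omega>) (b \<omega>) (scaled s N) (scaled t N) (real N * y) \<partial>M) - h"
    using hy by (intro order_tendstoD(1)) auto
  ultimately have "\<forall>\<^sub>F N in sequentially. False"
    by eventually_elim auto
  then show False by simp
qed

lemma shape_mono:
  assumes "0 < s" "0 < t" "s \<le> s'" "t \<le> t'"
  shows "g s t \<le> g s' t'"
proof (rule ccontr)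
  assume "\<not> g s t \<le> g s' t'"
  then have "g s' t' < g s t" by simp
  then obtain x where x: "g s' t' < x" "x < g s t" using dense by blast
  then obtain y where y: "x = ennreal y"
    by (cases x) auto
  let ?q = "\<lambda>s t N. \<integral>\<omega>. quenched_tail (a \<omega>) (b \<omega>) (scaled s N) (scaled t N) (real N * y) \<partial>M"
  have 1: "?q s t \<longlonglongrightarrow> 1" and 0: "?q s' t' \<longlonglongrightarrow> 0"
    using tail_above[of s t y] tail_below[of s' t' y] assms x y by auto
  have "\<forall>\<^sub>F N in sequentially. 1 \<le> scaled s N \<and> 1 \<le> scaled t N"
    using assms by (intro eventually_conj eventually_scaled_ge)
  then have "\<forall>\<^sub>F N in sequentially. ?q s t N \<le> ?q s' t' N"
  proof eventually_elim
    case (elim N)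
    then show ?case
      using assms by (intro integral_mono tail_integrable_0 quenched_tail_mono scaled_mono) auto
  qed
  then have "(1 :: real) \<le> 0"
    using tendsto_le[OF sequentially_bot 0 1] by simp
  then show False by simp
qed

section \<open>The lower bound at stationary points\<close>

text \<open>If all alternatives failed, the interior last-passage times at their thresholds would have
  vanishing tails, because a shifted rectangle has the annealed law of the unshifted one. This contradicts
  the lower bound on the sum of these tails.\<close>

lemma exit_point_alternative:
  fixes R :: nat
  assumes st: "0 < s" "0 < t" and z: "z \<in> Z" and R: "0 < R"
  obtains r where "r < R"
    "ennreal (stationary_mean s t z - s * (Suc r / R) * A z) \<le> g (s * (1 - r / R)) t \<or>
     ennreal (stationary_mean s t z - t * (Suc r / R) * B z) \<le> g s (t * (1 - r / R))"
proof (rule ccontr)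
  assume "\<not> thesis"
  define h where "h = stationary_mean s t z"
  have h_eq: "h = s * A z + t * B z" by (simp add: h_def stationary_mean_def)
  from \<open>\<not> thesis\<close> that have less:
    "g (s * (1 - r / R)) t < ennreal (h - s * (Suc r / R) * A z)"
    "g s (t * (1 - r / R)) < ennreal (h - t * (Suc r / R) * B z)" if "r < R" for r
    using that unfolding h_def by (meson not_le)+
  \<comment> \<open>The finitely many strict inequalities leave room for a common \<open>\<delta>\<close>.\<close>
  have lim: "((\<lambda>\<delta>. ennreal (c - 2 * \<delta>)) \<longlongrightarrow> ennreal (c - 2 * 0)) (at_right 0)" for c
    by (intro tendsto_intros)
  have ev1: "\<forall>\<^sub>F \<delta> in at_right 0. \<forall>r\<in>{..<R}.
      g (s * (1 - r / R)) t < ennreal (h - s * (Suc r / R) * A z - 2 * \<delta>)"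
    using less(1) by (intro eventually_ball_finite ballI order_tendstoD(1)[OF lim]) auto
  have ev2: "\<forall>\<^sub>F \<delta> in at_right 0. \<forall>r\<in>{..<R}.
      g s (t * (1 - r / R)) < ennreal (h - t * (Suc r / R) * B z - 2 * \<delta>)"
    using less(2) by (intro eventually_ball_finite ballI order_tendstoD(1)[OF lim]) auto
  have ev3: "\<forall>\<^sub>F \<delta> in at_right 0. (0::real) < \<delta>"
    by (simp add: eventually_at_right_less)
  obtain \<delta> where \<delta>: "0 < \<delta>"
    "\<And>r. r < R \<Longrightarrow> g (s * (1 - r / R)) t < ennreal (h - s * (Suc r / R) * A z - 2 * \<delta>)"
    "\<And>r. r < R \<Longrightarrow> g s (t * (1 - r / R)) < ennreal (h - t * (Suc r / R) * B z - 2 * \<delta>)"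
    using eventually_happens'[OF trivial_limit_at_right_real eventually_conj[OF ev3 eventually_conj[OF ev1 ev2]]]
    by (auto simp: lessThan_iff)
  have zz: "\<alpha> < z" "\<beta> * z < 1" "0 < z"
    using z endpoints_pos by (auto simp: Z_iff)
  define P where "P = (\<lambda>r N \<omega>. quenched_tail (\<lambda>i. a \<omega> (i + exit_cut s R r N)) (b \<omega>)
      (scaled (s * (1 - r / R)) N) (scaled t N) (real N * (h - s * (Suc r / R) * A z - 2 * \<delta>)))"
  define Q where "Q = (\<lambda>r N \<omega>. quenched_tail (a \<omega>) (\<lambda>j. b \<omega> (j + exit_cut t R r N))
      (scaled s N) (scaled (t * (1 - r / R)) N) (real N * (h - t * (Suc r / R) * B z - 2 * \<delta>)))"
  define f where "f = (\<lambda>N \<omega>. 1 - ((\<Sum>r<R. P r N \<omega>) + (\<Sum>r<R. Q r N \<omega>)))"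
  have int_PQ: "integrable M (P r N)" "integrable M (Q r N)" for r N
    using tail_integrable[of "exit_cut s R r N" 0] tail_integrable[of 0 "exit_cut t R r N"]
    by (auto simp: P_def Q_def)
  have "\<forall>\<^sub>F N in sequentially. (\<integral>\<omega>. f N \<omega> \<partial>M) < 1 / 2"
  proof (rule eventually_integral_less)
    show "integrable M (f N)" for N
      unfolding f_def using int_PQ by simp
    show "f N \<omega> \<le> 1" for N \<omega>
    proof -
      have "0 \<le> (\<Sum>r<R. P r N \<omega>)" "0 \<le> (\<Sum>r<R. Q r N \<omega>)"
        by (auto intro!: sum_nonneg simp: P_def Q_def quenched_tail_bounds)
      then show ?thesis by (simp add: f_def)
    qed
    show "AE \<omega> in M. \<forall>\<epsilon>>0. \<forall>\<^sub>F N in sequentially. f N \<omega> \<le> \<epsilon>"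
      using params average_A[OF zz(1)] average_B[OF zz(3,2)]
    proof eventually_elim
      case (elim \<omega>)
      show ?case
      proof (intro allI impI)
        fix \<epsilon> :: real assume "0 < \<epsilon>"
        from exit_points_liminf[OF elim(1,2) zz(1,2) elim(3,4) st R \<delta>(1) this]
        show "\<forall>\<^sub>F N in sequentially. f N \<omega> \<le> \<epsilon>"
          unfolding h_eq[symmetric] P_def[symmetric] Q_def[symmetric]
          by eventually_elim (simp add: f_def P_def Q_def)
      qed
    qed
  qed auto
  moreover have "(\<lambda>N. \<integral>\<omega>. f N \<omega> \<partial>M) \<longlonglongrightarrow> 1 - ((\<Sum>r<R. 0) + (\<Sum>r<R. 0))"
  proof -
    have eq: "(\<integral>\<omega>. f N \<omega> \<partial>M) = 1 - ((\<Sum>r<R. \<integral>\<omega>. P r N \<omega> \<partial>M) + (\<Sum>r<R. \<integral>\<omega>. Q r N \<omega> \<partial>M))" for N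
      unfolding f_def using int_PQ by (simp add: prob_space)
    have limP: "(\<lambda>N. \<integral>\<omega>. P r N \<omega> \<partial>M) \<longlonglongrightarrow> 0" if "r < R" for r
      using tail_below[OF _ st(2) \<delta>(2)[OF that]] st that tail_stationary[of _ 0]
      by (simp add: P_def)
    have limQ: "(\<lambda>N. \<integral>\<omega>. Q r N \<omega> \<partial>M) \<longlonglongrightarrow> 0" if "r < R" for r
      using tail_below[OF st(1) _ \<delta>(3)[OF that]] st that tail_stationary[of 0]
      by (simp add: Q_def)
    show ?thesis
      unfolding eq by (intro tendsto_diff tendsto_add tendsto_const tendsto_sum limP limQ) auto
  qed
  then have "\<forall>\<^sub>F N in sequentially. 1 / 2 < (\<integral>\<omega>. f N \<omega> \<partial>M)"
    by (intro order_tendstoD(1)) auto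
  ultimately have "\<forall>\<^sub>F N in sequentially. False"
    by eventually_elim auto
  then show False by simp
qed

text \<open>The exit block must be close to the corner: otherwise the upper bound at a nearby parameter
  \<open>w\<close> would be violated. Near the corner, monotonicity of \<open>g\<close> compares the smaller rectangle with \<open>(s, t)\<close>.\<close>

lemma shape_at_stationary_point:
  assumes st: "0 < s" "0 < t" and z: "z \<in> Z"
    and crit: "(stationary_mean s t has_real_derivative 0) (at z)"
  shows "ennreal (stationary_mean s t z) \<le> g s t"
proof (rule ccontr)
  let ?h = "stationary_mean s t"
  assume "\<not> ennreal (?h z) \<le> g s t"
  then have "g s t < ennreal (?h z)" by simp
  then obtain y where y: "0 \<le> y" "y < ?h z" "g s t < ennreal y"
    by (rule ennreal_less_between)
  have zz: "\<alpha> < z" "\<beta> * z < 1" "0 < z"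
    using z endpoints_pos by (auto simp: Z_iff)
  obtain DA where DA: "DA < 0" "(A has_real_derivative DA) (at z)"
    using A_derivative[OF zz(1)] .
  obtain DB where DB: "0 < DB" "(B has_real_derivative DB) (at z)"
    using B_derivative[OF zz(3,2)] .
  have A0: "0 < A z" and B0: "0 < B z"
    using A_facts(2) B_facts(2) zz by auto
  obtain \<eta>1 where \<eta>1: "0 < \<eta>1" "\<And>x. 0 \<le> x \<Longrightarrow> ?h z - x * (s * A z) - \<eta>1 \<le> y \<Longrightarrow>
      \<exists>w\<in>Z. ?h w - x * (s * A w) < ?h z - x * (s * A z) - \<eta>1"
    by (rule stationary_point_gap[OF crit DERIV_cmult[OF DA(2), of s] _ open_Z z _ y(2)])
       (use DA A0 st in auto)
  obtain \<eta>2 where \<eta>2: "0 < \<eta>2" "\<And>x. 0 \<le> x \<Longrightarrow> ?h z - x * (t * B z) - \<eta>2 \<le> y \<Longrightarrow>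
      \<exists>w\<in>Z. ?h w - x * (t * B w) < ?h z - x * (t * B z) - \<eta>2"
    by (rule stationary_point_gap[OF crit DERIV_cmult[OF DB(2), of t] _ open_Z z _ y(2)])
       (use DB B0 st in auto)
  obtain R :: nat where R: "0 < R" "s * A z / R \<le> \<eta>1" "t * B z / R \<le> \<eta>2"
  proof -
    obtain R :: nat where "max (s * A z / \<eta>1) (t * B z / \<eta>2) < real R"
      using reals_Archimedean2 by blast
    moreover have "0 < s * A z / \<eta>1" using st A0 \<eta>1 by simp
    ultimately show ?thesis
      using that[of R] \<eta>1(1) \<eta>2(1) by (cases "R = 0") (auto simp: field_simps)
  qed
  obtain r where r: "r < R" and alt:
    "ennreal (?h z - s * (Suc r / R) * A z) \<le> g (s * (1 - r / R)) t \<or>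
     ennreal (?h z - t * (Suc r / R) * B z) \<le> g s (t * (1 - r / R))"
    using exit_point_alternative[OF st z R(1)] by blast
  define x where "x = real r / real R"
  have x: "0 \<le> x" "x < 1" using r by (auto simp: x_def)
  have lower: "c \<le> d" if "ennreal c \<le> ennreal d" "0 \<le> d" for c d :: real
    using that by (simp add: ennreal_le_iff)
  from alt show False
  proof
    assume "ennreal (?h z - s * (Suc r / R) * A z) \<le> g (s * (1 - r / R)) t"
    moreover have "?h z - x * (s * A z) - \<eta>1 \<le> ?h z - s * (Suc r / R) * A z"
      using R(2) by (simp add: x_def add_divide_distrib algebra_simps)
    ultimately have main: "ennreal (?h z - x * (s * A z) - \<eta>1) \<le> g (s * (1 - x)) t"
      unfolding x_def by (meson ennreal_leI order_trans)
    have mono: "g (s * (1 - x)) t \<le> g s t"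
      using st x by (intro shape_mono) (auto simp: algebra_simps)
    have "?h z - x * (s * A z) - \<eta>1 \<le> y"
      by (rule lower[OF order_trans[OF main order_trans[OF mono less_imp_le[OF y(3)]]] y(1)])
    then obtain w where w: "w \<in> Z" "?h w - x * (s * A w) < ?h z - x * (s * A z) - \<eta>1"
      using \<eta>1(2)[OF x(1)] by blast
    have upper: "g (s * (1 - x)) t \<le> ennreal (stationary_mean (s * (1 - x)) t w)"
      using st x by (intro shape_le_stationary_mean w) auto
    have "0 \<le> stationary_mean (s * (1 - x)) t w"
      using stationary_mean_pos[of "s * (1 - x)" t w] st x w(1) by simp
    then have "?h z - x * (s * A z) - \<eta>1 \<le> stationary_mean (s * (1 - x)) t w"
      by (rule lower[OF order_trans[OF main upper]])
    also have "\<dots> = ?h w - x * (s * A w)"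
      by (simp add: stationary_mean_def algebra_simps)
    finally show False using w(2) by simp
  next
    assume "ennreal (?h z - t * (Suc r / R) * B z) \<le> g s (t * (1 - r / R))"
    moreover have "?h z - x * (t * B z) - \<eta>2 \<le> ?h z - t * (Suc r / R) * B z"
      using R(3) by (simp add: x_def add_divide_distrib algebra_simps)
    ultimately have main: "ennreal (?h z - x * (t * B z) - \<eta>2) \<le> g s (t * (1 - x))"
      unfolding x_def by (meson ennreal_leI order_trans)
    have mono: "g s (t * (1 - x)) \<le> g s t"
      using st x by (intro shape_mono) (auto simp: algebra_simps)
    have "?h z - x * (t * B z) - \<eta>2 \<le> y"
      by (rule lower[OF order_trans[OF main order_trans[OF mono less_imp_le[OF y(3)]]] y(1)])
    then obtain w where w: "w \<in> Z" "?h w - x * (t * B w) < ?h z - x * (t * B z) - \<eta>2"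
      using \<eta>2(2)[OF x(1)] by blast
    have upper: "g s (t * (1 - x)) \<le> ennreal (stationary_mean s (t * (1 - x)) w)"
      using st x by (intro shape_le_stationary_mean w) auto
    have "0 \<le> stationary_mean s (t * (1 - x)) w"
      using stationary_mean_pos[of s "t * (1 - x)" w] st x w(1) by simp
    then have "?h z - x * (t * B z) - \<eta>2 \<le> stationary_mean s (t * (1 - x)) w"
      by (rule lower[OF order_trans[OF main upper]])
    also have "\<dots> = ?h w - x * (t * B w)"
      by (simp add: stationary_mean_def algebra_simps)
    finally show False using w(2) by simp
  qed
qed

section \<open>The lower bound near the endpoints\<close>

text \<open>The event that the last column has parameter above \<open>\<theta>\<close> has a fixed probability \<open>p > 0\<close>. On it,
  a large last-passage time to \<open>(s', t')\<close> makes the one to \<open>(s, t)\<close> large, so the tail at \<open>(s, t)\<close> cannot tend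
  to zero.\<close>

lemma shape_add_column:
  assumes s: "0 < s'" "s' \<le> s" and t: "0 < t'" "t' \<le> t" and \<theta>: "0 < \<theta>" "\<theta> < \<alpha>"
    and c: "0 < c" "ennreal c \<le> g s' t'"
  shows "ennreal (c + (t - t') * B \<theta>) \<le> g s t"
proof (rule ccontr)
  assume "\<not> ennreal (c + (t - t') * B \<theta>) \<le> g s t"
  then have "g s t < ennreal (c + (t - t') * B \<theta>)" by simp
  then obtain Y where Y: "Y < c + (t - t') * B \<theta>" "g s t < ennreal Y"
    using ennreal_less_between by metis
  define \<delta> where "\<delta> = (c + (t - t') * B \<theta> - Y) / 2"
  have \<delta>: "0 < \<delta>" using Y by (simp add: \<delta>_def)
  have Y_eq: "c - \<delta> + (t - t') * B \<theta> - \<delta> = Y" by (simp add: \<delta>_def field_simps)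
  have "ennreal (c - \<delta>) < g s' t'"
    using c \<delta> by (intro less_le_trans[OF ennreal_lessI]) auto
  obtain p where p: "0 < p" "\<And>i. 1 \<le> i \<Longrightarrow> prob {\<omega> \<in> space M. \<theta> < a \<omega> i} = p"
    using near_\<alpha>[OF \<theta>(2)] by auto
  have st: "0 < s" "0 < t" using s t by auto
  have \<beta>\<theta>: "\<beta> * \<theta> < 1"
  proof -
    have "\<beta> * \<theta> \<le> \<beta> * \<alpha>" using endpoints_pos \<theta> by (intro mult_left_mono) auto
    then show ?thesis using endpoint_product by (simp add: mult.commute)
  qed
  \<comment> \<open>The maximum with 1 keeps the column index valid for small \<open>N\<close>.\<close>
  define E where "E = (\<lambda>N. {\<omega> \<in> space M. \<theta> < a \<omega> (max 1 (scaled s N))})"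
  have E: "E N \<in> sets M" "prob (E N) = p" for N
  proof -
    have [measurable]: "(\<lambda>\<omega>. a \<omega> (max 1 (scaled s N))) \<in> borel_measurable M"
      by (rule measurable_a) simp
    show "E N \<in> sets M" unfolding E_def by measurable
    show "prob (E N) = p" unfolding E_def by (rule p) simp
  qed
  define q where "q = (\<lambda>N \<omega>. quenched_tail (a \<omega>) (b \<omega>) (scaled s' N) (scaled t' N) (real N * (c - \<delta>)))"
  define q' where "q' = (\<lambda>N \<omega>. quenched_tail (a \<omega>) (b \<omega>) (scaled s N) (scaled t N) (real N * Y))"
  define f where "f = (\<lambda>N \<omega>. indicator (E N) \<omega> - (1 - q N \<omega>) - q' N \<omega>)"
  have int: "integrable M (q N)" "integrable M (q' N)" "integrable M (indicator (E N) :: _ \<Rightarrow> real)" for N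
    using tail_integrable_0 E by (auto simp: q_def q'_def less_top[symmetric])
  have "\<forall>\<^sub>F N in sequentially. (\<integral>\<omega>. f N \<omega> \<partial>M) < p / 2"
  proof (rule eventually_integral_less)
    show "integrable M (f N)" for N
      unfolding f_def using int by simp
    show "f N \<omega> \<le> 1" for N \<omega>
    proof -
      have "indicator (E N) \<omega> \<le> (1 :: real)" by (simp split: split_indicator)
      then show ?thesis
        using quenched_tail_bounds(2)[of "a \<omega>" "b \<omega>" "scaled s' N" "scaled t' N" "real N * (c - \<delta>)"]
          quenched_tail_bounds(1)[of "a \<omega>" "b \<omega>" "scaled s N" "scaled t N" "real N * Y"]
        unfolding f_def q_def q'_def by linarith
    qed
    show "AE \<omega> in M. \<forall>\<epsilon>>0. \<forall>\<^sub>F N in sequentially. f N \<omega> \<le> \<epsilon>"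
      using params average_B[OF \<theta>(1) \<beta>\<theta>]
    proof eventually_elim
      case (elim \<omega>)
      show ?case
      proof (intro allI impI)
        fix \<epsilon> :: real assume "0 < \<epsilon>"
        from column_liminf[OF elim(1,2) endpoint_product \<theta>(1) less_imp_le[OF \<theta>(2)] elim(3) s t \<delta> this, of "c - \<delta>"]
        have "\<forall>\<^sub>F N in sequentially. \<theta> \<le> a \<omega> (scaled s N) \<longrightarrow> q N \<omega> - \<epsilon> \<le> q' N \<omega>"
          unfolding Y_eq q_def q'_def .
        moreover have "\<forall>\<^sub>F N in sequentially. 1 \<le> scaled s N"
          using st by (intro eventually_scaled_ge)
        ultimately show "\<forall>\<^sub>F N in sequentially. f N \<omega> \<le> \<epsilon>"
        proof eventually_elim
          case (elim N)
          have bounds: "q N \<omega> \<le> 1" "0 \<le> q' N \<omega>"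
            by (auto simp: q_def q'_def quenched_tail_bounds)
          show ?case
          proof (cases "\<omega> \<in> E N")
            case True
            then have "\<theta> \<le> a \<omega> (scaled s N)"
              using elim(2) by (simp add: E_def max_def split: if_splits)
            with True elim(1) show ?thesis by (simp add: f_def)
          next
            case False
            with bounds \<open>0 < \<epsilon>\<close> show ?thesis by (simp add: f_def)
          qed
        qed
      qed
    qed
  qed (use p in auto)
  moreover have "(\<lambda>N. \<integral>\<omega>. f N \<omega> \<partial>M) \<longlonglongrightarrow> p - (1 - 1) - 0"
  proof -
    have eq: "(\<integral>\<omega>. f N \<omega> \<partial>M) = p - (1 - (\<integral>\<omega>. q N \<omega> \<partial>M)) - (\<integral>\<omega>. q' N \<omega> \<partial>M)" for N
      unfolding f_def using int E by (simp add: prob_space)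
    have lim: "(\<lambda>N. \<integral>\<omega>. q N \<omega> \<partial>M) \<longlonglongrightarrow> 1"
      unfolding q_def by (rule tail_above[OF s(1) t(1)]) fact
    have lim': "(\<lambda>N. \<integral>\<omega>. q' N \<omega> \<partial>M) \<longlonglongrightarrow> 0"
      unfolding q'_def by (rule tail_below[OF st Y(2)])
    show ?thesis
      unfolding eq by (intro tendsto_intros lim lim')
  qed
  then have "\<forall>\<^sub>F N in sequentially. p / 2 < (\<integral>\<omega>. f N \<omega> \<partial>M)"
    using p by (intro order_tendstoD(1)) auto
  ultimately have "\<forall>\<^sub>F N in sequentially. False"
    by eventually_elim auto
  then show False by simp
qed

text \<open>Climbing the last column instead of following the stationary direction of \<open>z\<close> loses
  \<open>(t - t') (B z - B \<theta>)\<close> compared to \<open>h(z)\<close>. This vanishes as \<open>z\<close> and \<open>\<theta>\<close> approach \<open>\<alpha>\<close> from the two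
  sides; \<open>B\<close> is continuous at \<open>\<alpha>\<close> because \<open>\<alpha> < 1 / \<beta>\<close>.\<close>

lemma shape_when_increasing:
  assumes st: "0 < s" "0 < t"
    and incr: "\<And>z. z \<in> Z \<Longrightarrow> \<exists>d>0. (stationary_mean s t has_real_derivative d) (at z)"
  shows "ennreal (INF z\<in>Z. stationary_mean s t z) \<le> g s t"
proof (rule ennreal_le_of_shifts)
  fix \<delta> :: real assume \<delta>: "0 < \<delta>"
  have \<alpha>: "0 < \<alpha>" "\<beta> * \<alpha> < 1"
    using endpoints_pos endpoint_product by (auto simp: mult.commute)
  obtain D where "(B has_real_derivative D) (at \<alpha>)"
    using B_derivative[OF \<alpha>] by blast
  then have "isCont B \<alpha>" by (rule DERIV_isCont)
  then have "\<forall>\<^sub>F x in at \<alpha>. \<bar>B x - B \<alpha>\<bar> < \<delta> / (2 * t)"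
    using \<delta> st tendstoD[of B "B \<alpha>" "at \<alpha>" "\<delta> / (2 * t)"] by (simp add: isCont_def dist_real_def)
  then obtain r where r: "0 < r" "\<And>x. x \<noteq> \<alpha> \<Longrightarrow> \<bar>x - \<alpha>\<bar> < r \<Longrightarrow> \<bar>B x - B \<alpha>\<bar> < \<delta> / (2 * t)"
    by (auto simp: eventually_at dist_real_def)
  obtain z0 where z0: "z0 \<in> Z" using Z_nonempty by auto
  define z where "z = \<alpha> + min (r / 2) ((z0 - \<alpha>) / 2)"
  define \<theta> where "\<theta> = \<alpha> - min (r / 2) (\<alpha> / 2)"
  have z: "\<alpha> < z" "\<bar>z - \<alpha>\<bar> < r" "z \<le> z0"
    using r z0 by (auto simp: z_def Z_iff min_def field_simps)
  have \<theta>: "0 < \<theta>" "\<theta> < \<alpha>" "\<bar>\<theta> - \<alpha>\<bar> < r"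
    using r \<alpha> by (auto simp: \<theta>_def min_def)
  have "\<beta> * z \<le> \<beta> * z0" using z endpoints_pos by (intro mult_left_mono) auto
  then have zZ: "z \<in> Z" using z z0 by (auto simp: Z_iff)
  then have zz: "\<beta> * z < 1" "0 < z" using z \<alpha> by (auto simp: Z_iff)
  obtain DA where DA: "DA < 0" "(A has_real_derivative DA) (at z)"
    using A_derivative[OF z(1)] .
  obtain DB where DB: "0 < DB" "(B has_real_derivative DB) (at z)"
    using B_derivative[OF zz(2,1)] .
  have deriv: "(stationary_mean s' t' has_real_derivative s' * DA + t' * DB) (at z)" for s' t'
  proof -
    have "stationary_mean s' t' = (\<lambda>z. s' * A z + t' * B z)"
      by (simp add: fun_eq_iff stationary_mean_def)
    then show ?thesis
      by (simp only:) (intro DERIV_add DERIV_cmult DA DB)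
  qed
  have slope: "0 < s * DA + t * DB"
    using incr[OF zZ] DERIV_unique[OF deriv] by metis
  \<comment> \<open>The direction for which \<open>z\<close> is a stationary point lies on the \<open>s\<close> side of \<open>(s, t)\<close>.\<close>
  define t' where "t' = s * (- DA) / DB"
  have t': "0 < t'" "t' \<le> t" "s * DA + t' * DB = 0"
  proof -
    have "s * DA < 0" using DA st by (intro mult_pos_neg)
    then show "0 < t'" "t' \<le> t" "s * DA + t' * DB = 0"
      using DB(1) slope by (auto simp: t'_def field_simps)
  qed
  have "ennreal (stationary_mean s t' z) \<le> g s t'"
    using deriv[of s t'] t' st zZ by (intro shape_at_stationary_point) auto
  from shape_add_column[OF st(1) order_refl t'(1,2) \<theta>(1,2) _ this]
  have "ennreal (stationary_mean s t' z + (t - t') * B \<theta>) \<le> g s t"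
    using stationary_mean_pos[OF st(1) t'(1) zZ] by simp
  moreover have "(INF z\<in>Z. stationary_mean s t z) - \<delta> \<le> stationary_mean s t' z + (t - t') * B \<theta>"
  proof -
    have "(INF z\<in>Z. stationary_mean s t z) \<le> stationary_mean s t z"
      using stationary_mean_pos[OF st] by (intro cINF_lower zZ bdd_belowI2[of _ 0]) (auto intro: less_imp_le)
    moreover have "stationary_mean s t z = stationary_mean s t' z + (t - t') * B \<theta> + (t - t') * (B z - B \<theta>)"
      by (simp add: stationary_mean_def algebra_simps)
    moreover have "(t - t') * (B z - B \<theta>) \<le> t * (\<delta> / t)"
    proof -
      have "\<bar>B z - B \<theta>\<bar> \<le> \<delta> / (2 * t) + \<delta> / (2 * t)"
        using r(2)[of z] r(2)[of \<theta>] z \<theta> by auto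
      also have "\<dots> = \<delta> / t" by simp
      finally have "\<bar>B z - B \<theta>\<bar> \<le> \<delta> / t" .
      then have "(t - t') * (B z - B \<theta>) \<le> (t - t') * (\<delta> / t)"
        using t' by (intro mult_left_mono) auto
      also have "\<dots> \<le> t * (\<delta> / t)"
        using t' \<delta> st by (intro mult_right_mono) auto
      finally show ?thesis .
    qed
    ultimately show ?thesis using st by simp
  qed
  ultimately show "ennreal ((INF z\<in>Z. stationary_mean s t z) - \<delta>) \<le> g s t"
    by (meson ennreal_leI order_trans)
qed

end

section \<open>The variational formula\<close>

context corner
begin

lemma INF_le_mean:
  assumes "0 < s" "0 < t" "z \<in> Z"
  shows "(INF z\<in>Z. stationary_mean s t z) \<le> stationary_mean s t z"
  using stationary_mean_pos[OF assms(1,2)]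
  by (intro cINF_lower assms(3) bdd_belowI2[of _ 0]) (auto intro: less_imp_le)

text \<open>In the decreasing case the transposed model has the mean \<open>x \<mapsto> h(1 / x)\<close>, which increases.\<close>

lemma shape_ge_INF:
  assumes st: "0 < s" "0 < t"
  shows "ennreal (INF z\<in>Z. stationary_mean s t z) \<le> g s t"
proof -
  have "\<exists>d. (stationary_mean s t has_real_derivative d) (at z)" if "z \<in> Z" for z
  proof -
    have z: "\<alpha> < z" "\<beta> * z < 1" "0 < z"
      using that endpoints_pos by (auto simp: Z_iff)
    obtain DA where DA: "(A has_real_derivative DA) (at z)"
      using A_derivative[OF z(1)] by blast
    obtain DB where DB: "(B has_real_derivative DB) (at z)"
      using B_derivative[OF z(3,2)] by blast
    have "stationary_mean s t = (\<lambda>z. s * A z + t * B z)"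
      by (simp add: fun_eq_iff stationary_mean_def)
    then show ?thesis
      using DERIV_add[OF DERIV_cmult[OF DA] DERIV_cmult[OF DB]] by metis
  qed
  then obtain h' where h': "\<And>z. z \<in> Z \<Longrightarrow> (stationary_mean s t has_real_derivative h' z) (at z)"
    by metis
  show ?thesis
  proof (cases "\<exists>z\<in>Z. h' z = 0")
    case True
    then obtain z where z: "z \<in> Z" "(stationary_mean s t has_real_derivative 0) (at z)"
      using h' by metis
    have "ennreal (INF z\<in>Z. stationary_mean s t z) \<le> ennreal (stationary_mean s t z)"
      by (intro ennreal_leI INF_le_mean st z)
    also have "\<dots> \<le> g s t"
      by (rule shape_at_stationary_point[OF st z])
    finally show ?thesis .
  next
    case False
    then have "(\<forall>z\<in>Z. 0 < h' z) \<or> (\<forall>z\<in>Z. h' z < 0)"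
      using h' unfolding Z_def by (intro derivative_sign_constant) auto
    then show ?thesis
    proof
      assume "\<forall>z\<in>Z. 0 < h' z"
      then show ?thesis
        using h' by (intro shape_when_increasing st) auto
    next
      assume decr: "\<forall>z\<in>Z. h' z < 0"
      interpret T: corner M b a \<beta> \<alpha> "\<lambda>s t. g t s" by (rule transposed)
      have mean: "T.stationary_mean t s x = stationary_mean s t (1 / x)" for x
        by (simp add: T.stationary_mean_def stationary_mean_def T.A_def T.B_def A_def B_def)
      have inverse_in: "1 / x \<in> Z" if "x \<in> T.Z" for x
        using that endpoints_pos by (auto simp: Z_iff T.Z_iff field_simps)
      have inverse_in': "1 / z \<in> T.Z" if "z \<in> Z" for z
        using that endpoints_pos by (auto simp: Z_iff T.Z_iff field_simps)
      have "ennreal (INF x\<in>T.Z. T.stationary_mean t s x) \<le> g s t"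
      proof (rule T.shape_when_increasing[OF st(2,1)])
        fix x assume x: "x \<in> T.Z"
        then have "0 < x" using endpoints_pos by (auto simp: T.Z_iff)
        then have "((\<lambda>x. 1 / x) has_real_derivative - (1 / x\<^sup>2)) (at x)"
          by (auto intro!: derivative_eq_intros simp: power2_eq_square)
        from DERIV_chain2[OF h'[OF inverse_in[OF x]] this]
        have "(T.stationary_mean t s has_real_derivative h' (1 / x) * - (1 / x\<^sup>2)) (at x)"
          unfolding mean[abs_def] .
        moreover have "0 < h' (1 / x) * - (1 / x\<^sup>2)"
          using decr inverse_in[OF x] \<open>0 < x\<close> by (intro mult_neg_neg) auto
        ultimately show "\<exists>d>0. (T.stationary_mean t s has_real_derivative d) (at x)" by blast
      qed
      moreover have "(\<lambda>x. T.stationary_mean t s x) ` T.Z = stationary_mean s t ` Z"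
      proof -
        have "(\<lambda>x. 1 / x) ` T.Z = Z"
          using inverse_in inverse_in' by (force simp: image_iff)
        then show ?thesis
          unfolding mean by (metis image_image)
      qed
      ultimately show ?thesis by simp
    qed
  qed
qed

lemma shape_eq_INF:
  assumes st: "0 < s" "0 < t"
  shows "g s t = ennreal (INF z\<in>Z. stationary_mean s t z)"
proof (rule antisym)
  obtain z0 where "z0 \<in> Z" using Z_nonempty by blast
  then have "g s t < \<top>"
    using shape_le_stationary_mean[OF st] ennreal_less_top le_less_trans by blast
  then obtain r where r: "g s t = ennreal r" "0 \<le> r"
    by (cases "g s t") auto
  have "r \<le> stationary_mean s t z" if "z \<in> Z" for z
    using shape_le_stationary_mean[OF st that] stationary_mean_pos[OF st that]
    by (simp add: r ennreal_le_iff)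
  then have "r \<le> (INF z\<in>Z. stationary_mean s t z)"
    by (intro cINF_greatest Z_nonempty)
  then show "g s t \<le> ennreal (INF z\<in>Z. stationary_mean s t z)"
    unfolding r by (rule ennreal_leI)
qed (rule shape_ge_INF[OF st])

end

lemma esssup_tail_positive:
  assumes M: "prob_space M" and X: "X \<in> borel_measurable M"
    and sup: "ereal c = esssup M (\<lambda>\<omega>. ereal (X \<omega>))" and "\<theta> < c"
  shows "0 < measure M {\<omega> \<in> space M. \<theta> < X \<omega>}"
proof (rule ccontr)
  interpret prob_space M by (rule M)
  note [measurable] = X
  assume "\<not> 0 < measure M {\<omega> \<in> space M. \<theta> < X \<omega>}"
  then have "prob {\<omega> \<in> space M. \<theta> < X \<omega>} = 0"
    using measure_nonneg[of M "{\<omega> \<in> space M. \<theta> < X \<omega>}"] by simp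
  then have "AE \<omega> in M. \<not> \<theta> < X \<omega>"
    by (subst AE_iff_measurable[OF _ refl]) (auto simp: emeasure_eq_measure)
  then have "esssup M (\<lambda>\<omega>. ereal (X \<omega>)) \<le> ereal \<theta>"
    by (intro esssup_I) (auto simp: not_less)
  with sup \<open>\<theta> < c\<close> show False by (metis ereal_less_eq(3) not_le)
qed

lemma corner_of_totally_ergodic:
  assumes te: "totally_ergodic \<mu>" and g: "is_shape_function \<mu> g"
    and prod: "alpha_bar \<mu> * beta_bar \<mu> < 1"
  shows "corner \<mu> fst snd (alpha_bar \<mu>) (beta_bar \<mu>) g"
proof -
  interpret prob_space \<mu> by (rule prob_\<mu>[OF te])
  have sup: "ereal (alpha_bar \<mu>) = esssup \<mu> (\<lambda>\<omega>. ereal (fst \<omega> 1))"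
    "ereal (beta_bar \<mu>) = esssup \<mu> (\<lambda>\<omega>. ereal (snd \<omega> 1))"
    using ereal_endpoints[OF te] by (simp_all add: case_prod_beta')
  have le: "prob {\<omega> \<in> space \<mu>. alpha_bar \<mu> < fst \<omega> 1} = 0" "prob {\<omega> \<in> space \<mu>. beta_bar \<mu> < snd \<omega> 1} = 0"
  proof -
    have "AE \<omega> in \<mu>. \<not> alpha_bar \<mu> < fst \<omega> 1"
      using esssup_AE[of "\<lambda>\<omega>. ereal (fst \<omega> 1)" \<mu>] unfolding sup[symmetric] by (simp add: not_less)
    then show "prob {\<omega> \<in> space \<mu>. alpha_bar \<mu> < fst \<omega> 1} = 0"
      by (subst prob_eq_0) (use param_measurable[OF te, of 1] in auto)
    have "AE \<omega> in \<mu>. \<not> beta_bar \<mu> < snd \<omega> 1"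
      using esssup_AE[of "\<lambda>\<omega>. ereal (snd \<omega> 1)" \<mu>] unfolding sup[symmetric] by (simp add: not_less)
    then show "prob {\<omega> \<in> space \<mu>. beta_bar \<mu> < snd \<omega> 1} = 0"
      by (subst prob_eq_0) (use param_measurable[OF te, of 1] in auto)
  qed
  have AE_i: "AE \<omega> in \<mu>. 0 < fst \<omega> i \<and> fst \<omega> i \<le> alpha_bar \<mu>"
    "AE \<omega> in \<mu>. 0 < snd \<omega> i \<and> snd \<omega> i \<le> beta_bar \<mu>" if i: "1 \<le> i" for i
  proof -
    note [measurable] = param_measurable[OF te i]
    have "AE \<omega> in \<mu>. \<not> alpha_bar \<mu> < fst \<omega> i" "AE \<omega> in \<mu>. \<not> beta_bar \<mu> < snd \<omega> i"
      using le param_law_stationary[OF te i]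
      by (auto simp: prob_eq_0 AE_iff_measurable[OF _ refl] emeasure_eq_measure)
    then show "AE \<omega> in \<mu>. 0 < fst \<omega> i \<and> fst \<omega> i \<le> alpha_bar \<mu>"
      "AE \<omega> in \<mu>. 0 < snd \<omega> i \<and> snd \<omega> i \<le> beta_bar \<mu>"
      using AE_space param_in_unit_interval[OF te _ i] by (auto elim!: eventually_rev_mp simp: not_less)
  qed
  show ?thesis
  proof unfold_locales
    have "AE \<omega> in \<mu>. \<forall>i. 1 \<le> i \<longrightarrow> 0 < fst \<omega> i \<and> fst \<omega> i \<le> alpha_bar \<mu>"
      unfolding AE_all_countable using AE_i(1) by auto
    then show "AE \<omega> in \<mu>. params_upto (alpha_bar \<mu>) (fst \<omega>)"
      by (simp add: params_upto_def)
    have "AE \<omega> in \<mu>. \<forall>i. 1 \<le> i \<longrightarrow> 0 < snd \<omega> i \<and> snd \<omega> i \<le> beta_bar \<mu>"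
      unfolding AE_all_countable using AE_i(2) by auto
    then show "AE \<omega> in \<mu>. params_upto (beta_bar \<mu>) (snd \<omega>)"
      by (simp add: params_upto_def)
    show "alpha_bar \<mu> * beta_bar \<mu> < 1" by (rule prod)
    show "(\<lambda>\<omega>. fst \<omega> i) \<in> borel_measurable \<mu>" "(\<lambda>\<omega>. snd \<omega> i) \<in> borel_measurable \<mu>" if "1 \<le> i" for i
      using param_measurable[OF te that] by auto
    show "\<exists>p>0. \<forall>i\<ge>1. prob {\<omega> \<in> space \<mu>. \<theta> < fst \<omega> i} = p" if "\<theta> < alpha_bar \<mu>" for \<theta>
      using esssup_tail_positive[OF prob_space_axioms param_measurable(1)[OF te order_refl] sup(1) that]
        param_law_stationary(1)[OF te] by blast
    show "\<exists>p>0. \<forall>i\<ge>1. prob {\<omega> \<in> space \<mu>. \<theta> < snd \<omega> i} = p" if "\<theta> < beta_bar \<mu>" for \<theta>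
      using esssup_tail_positive[OF prob_space_axioms param_measurable(2)[OF te order_refl] sup(2) that]
        param_law_stationary(2)[OF te] by blast
    fix \<phi> :: "real \<Rightarrow> real" assume \<phi>: "\<phi> \<in> borel_measurable borel"
    show "AE \<omega> in \<mu>. (\<lambda>n. (\<Sum>i\<in>{0<..n}. \<phi> (fst \<omega> i)) / real n) \<longlonglongrightarrow> (\<integral>\<omega>. \<phi> (fst \<omega> 1) \<partial>\<mu>)"
      if "integrable \<mu> (\<lambda>\<omega>. \<phi> (fst \<omega> 1))"
      using param_average_tendsto(1)[OF te \<phi> that] .
    show "AE \<omega> in \<mu>. (\<lambda>n. (\<Sum>i\<in>{0<..n}. \<phi> (snd \<omega> i)) / real n) \<longlonglongrightarrow> (\<integral>\<omega>. \<phi> (snd \<omega> 1) \<partial>\<mu>)"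
      if "integrable \<mu> (\<lambda>\<omega>. \<phi> (snd \<omega> 1))"
      using param_average_tendsto(2)[OF te \<phi> that] .
  qed (rule shifted_quenched_tail_measurable[OF te] quenched_tail_stationary[OF te]
      annealed_tail_limits[OF te g]; assumption)+
qed

theorem mainTheorem3:
  fixes \<mu> :: "((nat \<Rightarrow> real) \<times> (nat \<Rightarrow> real)) measure"
    and g :: "real \<Rightarrow> real \<Rightarrow> ennreal"
  assumes "totally_ergodic \<mu>"
    and "is_shape_function \<mu> g"
    and "alpha_bar \<mu> * beta_bar \<mu> < 1"
  shows "\<forall>s>0. \<forall>t>0. g s t =
    ennreal (INF z\<in>{alpha_bar \<mu><..<1 / beta_bar \<mu>}.
      s * (\<integral>(a, b). (a 1 / z) / (1 - a 1 / z) \<partial>\<mu>) +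
      t * (\<integral>(a, b). (b 1 * z) / (1 - b 1 * z) \<partial>\<mu>))"
proof (intro allI impI)
  interpret corner \<mu> fst snd "alpha_bar \<mu>" "beta_bar \<mu>" g
    by (rule corner_of_totally_ergodic[OF assms])
  fix s t :: real assume "0 < s" "0 < t"
  from shape_eq_INF[OF this]
  show "g s t = ennreal (INF z\<in>{alpha_bar \<mu><..<1 / beta_bar \<mu>}.
      s * (\<integral>(a, b). (a 1 / z) / (1 - a 1 / z) \<partial>\<mu>) +
      t * (\<integral>(a, b). (b 1 * z) / (1 - b 1 * z) \<partial>\<mu>))"
    by (simp only: stationary_mean_def A_def B_def Z_def case_prod_beta')
qed

end
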